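(* Let $1<p<\infty$. Let $E$ be a UMD space and let $\mathcal{T}\subseteq\mathcal{L}(E)$ be a UMD subspace of $\mathcal{L}(E)$. Then $$\|\Pi_bf\|_{L^p(\mathbb{R}^d;E)}\le6\cdot2^d\,pp'\,\beta_p(E)^2\,\beta_p(\mathcal{T})\,\|b\|_{\mathrm{BMO}_p(\mathbb{R}^d;\mathcal{T})}\,\|f\|_{L^p(\mathbb{R}^d;E)}$$ for all $b\in\mathrm{BMO}_p(\mathbb{R}^d;\mathcal{T})$ and $f\in L^p(\mathbb{R}^d;E)$.
   Context: $p'=p/(p-1)$. $\mathcal{D}$ is a system of dyadic cubes of $\mathbb{R}^d$, $\langle f\rangle_Q=\frac1{|Q|}\int_Qf\,dx$. UMD constant: a Banach space $X$ is UMD if there is a finite (least) constant $\beta_p(X)$ with $\|\sum_{n=1}^N\epsilon_nd_n\|_{L^p(X)}\le\beta_p(X)\|\sum_{n=1}^Nd_n\|_{L^p(X)}$ for all $X$-valued $L^p$-martingale difference sequences and all signs $\epsilon_n\in\{-1,+1\}$. A UMD subspace of $\mathcal{L}(E)$ is a subspace which, with the operator norm, is a UMD space. Haar projection: $D_Qb=\sum_{Q'\in\mathrm{child}(Q)}\langle b\rangle_{Q'}1_{Q'}-\langle b\rangle_Q1_Q$, where $\mathrm{child}(Q)$ is the set of dyadic children of $Q$. Dyadic paraproduct: $\Pi_bf=\sum_{Q\in\mathcal{D}}D_Qb\,\langle f\rangle_Q$ (the operator-valued function $D_Qb$ applied to the vector $\langle f\rangle_Q$), the sum being understood as the limit of finite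 partial sums in $L^p(\mathbb{R}^d;E)$. $\|b\|_{\mathrm{BMO}_p(\mathbb{R}^d;\mathcal{T})}=\sup_{Q\in\mathcal{D}}\big(\frac1{|Q|}\int_Q|b(x)-\langle b\rangle_Q|_{\mathcal{T}}^p\,dx\big)^{1/p}$. *)

theory Defs
  imports "HOL-Probability.Conditional_Expectation"
begin

section \<open>Strong measurability, Bochner integral and Lebesgue--Bochner spaces\<close>

text \<open>
  The library's \<open>has_bochner_integral\<close>, \<open>integrable\<close> and \<open>lebesgue_integral\<close> need a second
  countable range, which would exclude non-separable Banach spaces and in particular the operator
  space \<open>'e \<Rightarrow>\<^sub>L 'e\<close>. The notions are therefore restated for arbitrary normed spaces, with Borel
  measurability replaced by strong measurability. Exceptional null sets are allowed, so
  strong measurability with respect to \<open>lborel\<close> and to \<open>lebesgue\<close> is the same notion.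
\<close>

definition strongly_measurable :: "'a measure \<Rightarrow> ('a \<Rightarrow> 'b::real_normed_vector) \<Rightarrow> bool" where
  "strongly_measurable M f \<longleftrightarrow>
     (\<exists>s. (\<forall>i. simple_function M (s i)) \<and> (AE x in M. (\<lambda>i::nat. s i x) \<longlonglongrightarrow> f x))"

definition has_bint :: "'a measure \<Rightarrow> ('a \<Rightarrow> 'b::real_normed_vector) \<Rightarrow> 'b \<Rightarrow> bool" where
  "has_bint M f v \<longleftrightarrow> strongly_measurable M f \<and>
     (\<exists>s. (\<forall>i. Bochner_Integration.simple_bochner_integrable M (s i)) \<and>
          (\<lambda>i::nat. \<integral>\<^sup>+x. ennreal (norm (f x - s i x)) \<partial>M) \<longlonglongrightarrow> 0 \<and>
          (\<lambda>i. Bochner_Integration.simple_bochner_integral M (s i)) \<longlonglongrightarrow> v)"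

definition bint :: "'a measure \<Rightarrow> ('a \<Rightarrow> 'b::real_normed_vector) \<Rightarrow> 'b" where
  "bint M f = (if \<exists>v. has_bint M f v then THE v. has_bint M f v else 0)"

definition in_Lp :: "'a measure \<Rightarrow> real \<Rightarrow> ('a \<Rightarrow> 'b::real_normed_vector) \<Rightarrow> bool" where
  "in_Lp M p f \<longleftrightarrow> strongly_measurable M f \<and> (\<integral>\<^sup>+x. ennreal (norm (f x) powr p) \<partial>M) < \<infinity>"

text \<open>Only meaningful for functions satisfying \<open>in_Lp M p\<close>, because \<open>enn2real \<infinity> = 0\<close>.\<close>

definition Lp_norm :: "'a measure \<Rightarrow> real \<Rightarrow> ('a \<Rightarrow> 'b::real_normed_vector) \<Rightarrow> real" where
  "Lp_norm M p f = enn2real (\<integral>\<^sup>+x. ennreal (norm (f x) powr p) \<partial>M) powr (1 / p)"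


section \<open>UMD spaces\<close>

definition has_cond_exp ::
    "'a measure \<Rightarrow> 'a measure \<Rightarrow> ('a \<Rightarrow> 'b::real_normed_vector) \<Rightarrow> ('a \<Rightarrow> 'b) \<Rightarrow> bool" where
  "has_cond_exp M G f g \<longleftrightarrow> strongly_measurable (restr_to_subalg M G) g \<and>
     (\<forall>A\<in>sets G. \<exists>v. has_bint M (\<lambda>x. indicator A x *\<^sub>R f x) v \<and>
                      has_bint M (\<lambda>x. indicator A x *\<^sub>R g x) v)"

text \<open>The sequence is \<open>d 1, \<dots>, d N\<close>, the filtration is \<open>F 0, \<dots>, F N\<close>.\<close>

definition Lp_martingale_differences ::
    "real \<Rightarrow> 'a measure \<Rightarrow> nat \<Rightarrow> (nat \<Rightarrow> 'a measure) \<Rightarrow> (nat \<Rightarrow> 'a \<Rightarrow> 'b::real_normed_vector) \<Rightarrow> bool" where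
  "Lp_martingale_differences p M N F d \<longleftrightarrow>
     (\<forall>n\<le>N. subalgebra M (F n)) \<and>
     (\<forall>m n. m \<le> n \<and> n \<le> N \<longrightarrow> sets (F m) \<subseteq> sets (F n)) \<and>
     (\<forall>n\<in>{1..N}. in_Lp M p (d n) \<and> strongly_measurable (restr_to_subalg M (F n)) (d n) \<and>
                 has_cond_exp M (F (n - 1)) (d n) (\<lambda>_. 0))"

text \<open>
  \<open>X\<close> is a linear subspace of the ambient type, with the inherited norm.
  HOL cannot quantify over the types of underlying sample spaces inside a formula. The probability
  measures range over all measures (with arbitrary \<open>\<sigma>\<close>-algebras) on the sequence space
  \<open>nat \<Rightarrow> 'b\<close>. Nothing is lost: whether a sequence \<open>d 1, \<dots>, d N\<close> on some probability space is a
  martingale difference sequence for its own filtration, and the two norms below, depend only on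
  its joint law, and that law is realised by the coordinates of \<open>nat \<Rightarrow> 'b\<close>.
\<close>

definition UMD_bound :: "real \<Rightarrow> 'b::real_normed_vector set \<Rightarrow> real \<Rightarrow> bool" where
  "UMD_bound p X C \<longleftrightarrow> 0 \<le> C \<and>
     (\<forall>(M :: (nat \<Rightarrow> 'b) measure) N F d (\<epsilon> :: nat \<Rightarrow> real).
        prob_space M \<and> Lp_martingale_differences p M N F d \<and>
        (\<forall>n\<in>{1..N}. \<forall>\<omega>\<in>space M. d n \<omega> \<in> X) \<and> (\<forall>n\<in>{1..N}. \<epsilon> n \<in> {-1, 1}) \<longrightarrow>
        Lp_norm M p (\<lambda>\<omega>. \<Sum>n=1..N. \<epsilon> n *\<^sub>R d n \<omega>) \<le> C * Lp_norm M p (\<lambda>\<omega>. \<Sum>n=1..N. d n \<omega>))"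

definition UMD :: "real \<Rightarrow> 'b::real_normed_vector set \<Rightarrow> bool" where
  "UMD p X \<longleftrightarrow> subspace X \<and> complete X \<and> (\<exists>C. UMD_bound p X C)"

definition UMD_const :: "real \<Rightarrow> 'b::real_normed_vector set \<Rightarrow> real" where
  "UMD_const p X = Inf {C. UMD_bound p X C}"


section \<open>Dyadic cubes, dyadic BMO and the paraproduct\<close>

text \<open>\<open>D k\<close> is the family of cubes of generation \<open>k\<close>, of side length \<open>2\<^sup>-\<^sup>k\<close>; translated
  systems are included.\<close>

definition dyadic_system :: "(int \<Rightarrow> (real^'n) set set) \<Rightarrow> bool" where
  "dyadic_system D \<longleftrightarrow>
     (\<forall>k. \<forall>Q\<in>D k. \<exists>a. Q = {x. \<forall>i. a $ i \<le> x $ i \<and> x $ i < a $ i + 2 powi (-k)}) \<and>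
     (\<forall>k. partition_on UNIV (D k)) \<and>
     (\<forall>k. \<forall>Q'\<in>D (k + 1). \<exists>Q\<in>D k. Q' \<subseteq> Q)"

definition cubes :: "(int \<Rightarrow> (real^'n) set set) \<Rightarrow> (real^'n) set set" where
  "cubes D = (\<Union>k. D k)"

definition children :: "(int \<Rightarrow> (real^'n) set set) \<Rightarrow> (real^'n) set \<Rightarrow> (real^'n) set set" where
  "children D Q = {Q'. Q' \<subseteq> Q \<and> (\<exists>k. Q \<in> D k \<and> Q' \<in> D (k + 1))}"

definition average :: "(real^'n \<Rightarrow> 'b::real_normed_vector) \<Rightarrow> (real^'n) set \<Rightarrow> 'b" where
  "average f Q = (1 / measure lborel Q) *\<^sub>R bint lborel (\<lambda>x. indicator Q x *\<^sub>R f x)"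

definition mean_osc :: "real \<Rightarrow> (real^'n \<Rightarrow> 'b::real_normed_vector) \<Rightarrow> (real^'n) set \<Rightarrow> real" where
  "mean_osc p b Q =
     (1 / measure lborel Q *
      enn2real (\<integral>\<^sup>+x\<in>Q. ennreal (norm (b x - average b Q) powr p) \<partial>lborel)) powr (1 / p)"

definition BMO_norm ::
    "(int \<Rightarrow> (real^'n) set set) \<Rightarrow> real \<Rightarrow> (real^'n \<Rightarrow> 'b::real_normed_vector) \<Rightarrow> real" where
  "BMO_norm D p b = (SUP Q\<in>cubes D. mean_osc p b Q)"

text \<open>The second line is local integrability. The last two conditions say that the
  supremum defining the norm is finite.\<close>

definition in_BMO ::
    "(int \<Rightarrow> (real^'n) set set) \<Rightarrow> real \<Rightarrow> 'b::real_normed_vector set \<Rightarrow> (real^'n \<Rightarrow> 'b) \<Rightarrow> bool" where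
  "in_BMO D p T b \<longleftrightarrow> strongly_measurable lborel b \<and> (AE x in lborel. b x \<in> T) \<and>
     (\<forall>Q\<in>cubes D. \<exists>v. has_bint lborel (\<lambda>x. indicator Q x *\<^sub>R b x) v) \<and>
     (\<forall>Q\<in>cubes D. (\<integral>\<^sup>+x\<in>Q. ennreal (norm (b x - average b Q) powr p) \<partial>lborel) < \<infinity>) \<and>
     bdd_above (mean_osc p b ` cubes D)"

definition haar_proj ::
    "(int \<Rightarrow> (real^'n) set set) \<Rightarrow> (real^'n) set \<Rightarrow> (real^'n \<Rightarrow> 'b::real_normed_vector) \<Rightarrow> real^'n \<Rightarrow> 'b" where
  "haar_proj D Q b x =
     (\<Sum>Q'\<in>children D Q. indicator Q' x *\<^sub>R average b Q') - indicator Q x *\<^sub>R average b Q"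

text \<open>\<open>g\<close> represents \<open>\<Pi>\<^sub>b f\<close>: the partial sums over finite sets of dyadic cubes, directed by
  inclusion, converge to \<open>g\<close> in \<open>L\<^sup>p\<close>.\<close>

definition has_paraproduct ::
    "(int \<Rightarrow> (real^'n) set set) \<Rightarrow> real \<Rightarrow> (real^'n \<Rightarrow> 'e::real_normed_vector \<Rightarrow>\<^sub>L 'e) \<Rightarrow>
     (real^'n \<Rightarrow> 'e) \<Rightarrow> (real^'n \<Rightarrow> 'e) \<Rightarrow> bool" where
  "has_paraproduct D p b f g \<longleftrightarrow> in_Lp lborel p g \<and>
     ((\<lambda>\<F>. \<integral>\<^sup>+x. ennreal (norm ((\<Sum>Q\<in>\<F>. blinfun_apply (haar_proj D Q b x) (average f Q)) - g x) powr p)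
             \<partial>lborel) \<longlongrightarrow> 0) (finite_subsets_at_top (cubes D))"

end

theory Submission
  imports Defs "HOL-Library.Sublist" "HOL-Library.Cardinality"
begin

text \<open>
  Decoupling: for martingale differences \<open>h w (x n)\<close> along a branch \<open>x\<close> of the dyadic tree,
  the symmetric and antisymmetric parts of \<open>h w (x n)\<close> in \<open>x n\<close> and an independent copy \<open>y n\<close>
  are again martingale differences, so the UMD property allows \<open>x n\<close> to be exchanged for \<open>y n\<close>.
  Decouple \<open>\<Pi>\<^sub>b f\<close> in \<open>E\<close>; then Stein's inequality, also a consequence of UMD for \<open>E\<close>, replaces the
  averages of \<open>f\<close> by \<open>f\<close> itself; if \<open>f\<close> is bounded it can be estimated pointwise, and undoing the
  decoupling in \<open>T\<close> leaves \<open>b\<close>. This gives \<open>\<parallel>\<Pi>\<^sub>b f\<parallel> \<le> \<beta>(E)\<^sup>2 \<beta>(T) \<parallel>f\<parallel>\<^sub>\<infinity> \<parallel>b - \<langle>b\<rangle>\<parallel>\<close> on a cube.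

  For general \<open>f\<close>, group the cubes by their principal (stopping) cubes \<open>F\<close>, chosen so that the averages
  of \<open>|f|\<close> double. In each group \<open>f\<close> may be replaced by a function bounded by \<open>2 \<cdot> 2\<^sup>d \<langle>|f|\<rangle>\<^sub>F\<close>. Since
  the part belonging to \<open>F\<close> is constant on the next principal cubes, duality and the Carleson embedding
  theorem show that the \<open>p\<close>-th powers of the norms add up to a factor \<open>3 p\<close>, and a second application
  of the embedding theorem sums \<open>\<langle>|f|\<rangle>\<^sub>F\<^sup>p |F|\<close>.

  Unconditional convergence follows from this uniform bound and the density of dyadic step functions.
\<close>

section \<open>Strong measurability and the Bochner integral\<close>

text \<open>A finite partial sum involves only finitely many generations of cubes, so the estimates
  are made on a finite tree with 2^d labels and counting measure. Decoupling has to precede Stein's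
  inequality: the increments of \<open>b\<close> and the averages of \<open>f\<close> depend on the
  same branch, and only increments drawn from an independent copy keep mean zero when the whole
  branch is fixed. Arbitrary finite families of cubes are carried along as a predicate
  \<open>\<theta>\<close>. The selection disappears together with the decoupling in
  \<open>T\<close>, within the same constant, and this uniformity over families is what
  unconditional convergence asks for. The constant is 2 * 2^d times 3 p p'. The factor 2 * 2^d
  compares stopped averages with the principal one. The Carleson embedding for \<open>f\<close>,
  with exponent p, gives p' and a numerical 2. The embedding for the dual function, with exponent
  p', gives p and 3^(p-1) in the p-th power, and 2 * 3^(p-1) is at most 3^p.\<close>

abbreviation Lp_int :: "'a measure \<Rightarrow> real \<Rightarrow> ('a \<Rightarrow> 'b::real_normed_vector) \<Rightarrow> ennreal" where
  "Lp_int M p f \<equiv> \<integral>\<^sup>+x. ennreal (norm (f x) powr p) \<partial>M"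

abbreviation Lp_int_on :: "'a::euclidean_space set \<Rightarrow> real \<Rightarrow> ('a \<Rightarrow> 'b::real_normed_vector) \<Rightarrow> ennreal" where
  "Lp_int_on A p f \<equiv> \<integral>\<^sup>+x\<in>A. ennreal (norm (f x) powr p) \<partial>lborel"

lemma simple_bochner_integrable_simple:
  "Bochner_Integration.simple_bochner_integrable M s \<Longrightarrow> simple_function M s"
  by (auto elim: Bochner_Integration.simple_bochner_integrable.cases)

text \<open>Unlike for \<open>strongly_measurable\<close>, norms are Borel measurable here even if \<open>M\<close> is not complete.\<close>

definition smeas :: "'a measure \<Rightarrow> ('a \<Rightarrow> 'b::real_normed_vector) \<Rightarrow> bool" where
  "smeas M f \<longleftrightarrow> (\<exists>s. (\<forall>i. simple_function M (s i)) \<and> (\<forall>x\<in>space M. (\<lambda>i::nat. s i x) \<longlonglongrightarrow> f x))"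

lemma smeas_strongly_measurable: "smeas M f \<Longrightarrow> strongly_measurable M f"
  unfolding smeas_def strongly_measurable_def by (blast intro: AE_I2)

lemma strongly_measurable_obtain_smeas:
  assumes "strongly_measurable M f"
  obtains g where "smeas M g" "AE x in M. f x = g x"
proof -
  obtain s where s: "\<And>i. simple_function M (s i)" "AE x in M. (\<lambda>i::nat. s i x) \<longlonglongrightarrow> f x"
    using assms unfolding strongly_measurable_def by auto
  from AE_E[OF s(2)] obtain N where N: "{x \<in> space M. \<not> (\<lambda>i::nat. s i x) \<longlonglongrightarrow> f x} \<subseteq> N" "emeasure M N = 0" "N \<in> sets M"
    by blast
  \<comment> \<open>Approximants and limit are set to 0 on a measurable null set covering the
    exceptional points, so that convergence holds everywhere.\<close>
  define t where "t i x = (if x \<in> N then 0 else s i x)" for i x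
  define g where "g x = (if x \<in> N then 0 else f x)" for x
  have "simple_function M (t i)" for i
    unfolding t_def using s(1)[of i] N(3)
    by (intro simple_function_If_set) (auto simp: sets.Int_space_eq1)
  moreover have "(\<lambda>i. t i x) \<longlonglongrightarrow> g x" if "x \<in> space M" for x
    using N(1) that unfolding t_def g_def by auto
  ultimately have "smeas M g" unfolding smeas_def by blast
  moreover have "AE x in M. f x = g x"
    using N by (auto simp: g_def intro!: AE_I[of _ _ N])
  ultimately show ?thesis by (rule that)
qed

lemma smeas_simple: "simple_function M f \<Longrightarrow> smeas M f"
  unfolding smeas_def by (rule exI[of _ "\<lambda>_. f"]) auto

lemma smeas_compose2:
  assumes "smeas M f" "smeas M g" and "\<And>x y. isCont (\<lambda>z. h (fst z) (snd z)) (x, y)"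
  shows "smeas M (\<lambda>x. h (f x) (g x))"
proof -
  obtain s t where s: "\<And>i. simple_function M (s i)" "\<And>x. x \<in> space M \<Longrightarrow> (\<lambda>i::nat. s i x) \<longlonglongrightarrow> f x"
    and t: "\<And>i. simple_function M (t i)" "\<And>x. x \<in> space M \<Longrightarrow> (\<lambda>i::nat. t i x) \<longlonglongrightarrow> g x"
    using assms(1,2) unfolding smeas_def by blast
  have "(\<lambda>i. h (s i x) (t i x)) \<longlonglongrightarrow> h (f x) (g x)" if "x \<in> space M" for x
    using isCont_tendsto_compose[OF assms(3) tendsto_Pair[OF s(2)[OF that] t(2)[OF that]]] by simp
  then show ?thesis
    unfolding smeas_def using s(1) t(1)
    by (intro exI[of _ "\<lambda>i x. h (s i x) (t i x)"]) (auto intro: simple_function_compose2)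
qed

lemma smeas_add: "smeas M f \<Longrightarrow> smeas M g \<Longrightarrow> smeas M (\<lambda>x. f x + g x)"
  by (rule smeas_compose2) (auto intro!: continuous_intros)

lemma smeas_diff: "smeas M f \<Longrightarrow> smeas M g \<Longrightarrow> smeas M (\<lambda>x. f x - g x)"
  by (rule smeas_compose2) (auto intro!: continuous_intros)

lemma smeas_scaleR_indicator:
  assumes "smeas M f" "A \<in> sets M" shows "smeas M (\<lambda>x. indicator A x *\<^sub>R f x)"
  by (rule smeas_compose2[OF smeas_simple[OF simple_function_indicator[OF assms(2)]] assms(1), where h="scaleR"])
     (auto intro!: continuous_intros)

lemma smeas_scaleR: assumes "smeas M f" shows "smeas M (\<lambda>x. c *\<^sub>R f x)"
  by (rule smeas_compose2[OF smeas_simple[OF simple_function_const[of _ c]] assms, where h="scaleR"])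
     (auto intro!: continuous_intros)

lemma smeas_norm:
  assumes "smeas M f" shows "(\<lambda>x. norm (f x)) \<in> borel_measurable M"
proof -
  obtain s where s: "\<And>i. simple_function M (s i)" "\<And>x. x \<in> space M \<Longrightarrow> (\<lambda>i::nat. s i x) \<longlonglongrightarrow> f x"
    using assms unfolding smeas_def by blast
  show ?thesis
  proof (rule borel_measurable_LIMSEQ_real)
    show "(\<lambda>i. norm (s i x)) \<longlonglongrightarrow> norm (f x)" if "x \<in> space M" for x
      using s(2)[OF that] by (rule tendsto_norm)
    show "(\<lambda>x. norm (s i x)) \<in> borel_measurable M" for i
      by (rule borel_measurable_simple_function[OF simple_function_compose1[OF s(1)]])
  qed
qed

lemma strongly_measurable_cong_AE:
  assumes "strongly_measurable M f" "AE x in M. f x = g x" shows "strongly_measurable M g"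
proof -
  obtain s where s: "\<And>i. simple_function M (s i)" "AE x in M. (\<lambda>i::nat. s i x) \<longlonglongrightarrow> f x"
    using assms unfolding strongly_measurable_def by auto
  have "AE x in M. (\<lambda>i::nat. s i x) \<longlonglongrightarrow> g x"
    using s(2) assms(2) by eventually_elim simp
  then show ?thesis unfolding strongly_measurable_def using s(1) by blast
qed

lemma has_bint_cong_AE':
  assumes "AE x in M. f x = g x" "has_bint M f v" shows "has_bint M g v"
proof -
  have "(\<integral>\<^sup>+x. ennreal (norm (g x - s x)) \<partial>M) = (\<integral>\<^sup>+x. ennreal (norm (f x - s x)) \<partial>M)" for s
    using assms(1) by (intro nn_integral_cong_AE) auto
  then show ?thesis
    using assms strongly_measurable_cong_AE[of M f g] unfolding has_bint_def by simp
qed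

lemma has_bint_cong_AE:
  assumes "AE x in M. f x = g x" shows "has_bint M f v \<longleftrightarrow> has_bint M g v"
  using has_bint_cong_AE'[OF assms] has_bint_cong_AE'[of g f M] assms by (auto simp: eq_commute)

lemma bint_cong_AE:
  assumes "AE x in M. f x = g x" shows "bint M f = bint M g"
  unfolding bint_def has_bint_cong_AE[OF assms] ..

lemma ennreal_norm_simple_bochner_integral_le:
  fixes s :: "'a \<Rightarrow> 'b::real_normed_vector"
  assumes "Bochner_Integration.simple_bochner_integrable M s"
  shows "ennreal (norm (Bochner_Integration.simple_bochner_integral M s)) \<le> (\<integral>\<^sup>+x. norm (s x) \<partial>M)"
proof -
  have "norm (Bochner_Integration.simple_bochner_integral M s)
      \<le> Bochner_Integration.simple_bochner_integral M (\<lambda>x. norm (s x))" (is "_ \<le> ?I")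
    by (rule simple_bochner_integral_norm_bound[OF assms])
  moreover have "ennreal ?I = (\<integral>\<^sup>+x. norm (s x) \<partial>M)"
    using simple_bochner_integrable_compose2[of "\<lambda>x y. norm x" M s s] assms
    by (intro simple_bochner_integral_eq_nn_integral) auto
  ultimately show ?thesis by (metis ennreal_leI)
qed

lemma has_bint_norm_le:
  assumes "has_bint M f v"
  shows "ennreal (norm v) \<le> (\<integral>\<^sup>+x. norm (f x) \<partial>M)"
proof -
  obtain s where s: "\<And>i. Bochner_Integration.simple_bochner_integrable M (s i)"
      "(\<lambda>i::nat. \<integral>\<^sup>+x. ennreal (norm (f x - s i x)) \<partial>M) \<longlonglongrightarrow> 0"
      "(\<lambda>i. Bochner_Integration.simple_bochner_integral M (s i)) \<longlonglongrightarrow> v"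
    using assms unfolding has_bint_def by blast
  \<comment> \<open>Splitting the integral of a sum of norms needs Borel measurable norms, which the
    representative \<open>g\<close> has.\<close>
  obtain g where g: "smeas M g" "AE x in M. f x = g x"
    using assms strongly_measurable_obtain_smeas unfolding has_bint_def by metis
  have ae: "(\<integral>\<^sup>+x. ennreal (norm (f x - t x)) \<partial>M) = (\<integral>\<^sup>+x. ennreal (norm (g x - t x)) \<partial>M)" for t
    using g(2) by (intro nn_integral_cong_AE) auto
  have ae0: "(\<integral>\<^sup>+x. norm (f x) \<partial>M) = (\<integral>\<^sup>+x. norm (g x) \<partial>M)"
    using ae[of "\<lambda>_. 0"] by simp
  have le: "ennreal (norm (Bochner_Integration.simple_bochner_integral M (s i)))
      \<le> (\<integral>\<^sup>+x. norm (f x - s i x) \<partial>M) + (\<integral>\<^sup>+x. norm (f x) \<partial>M)" for i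
  proof -
    have [measurable]: "(\<lambda>x. norm (g x - s i x)) \<in> borel_measurable M" "(\<lambda>x. norm (g x)) \<in> borel_measurable M"
      by (intro smeas_norm smeas_diff g(1) smeas_simple simple_bochner_integrable_simple s(1))+
    have "ennreal (norm (Bochner_Integration.simple_bochner_integral M (s i))) \<le> (\<integral>\<^sup>+x. norm (s i x) \<partial>M)"
      by (rule ennreal_norm_simple_bochner_integral_le[OF s(1)])
    also have "\<dots> \<le> (\<integral>\<^sup>+x. ennreal (norm (g x - s i x)) + ennreal (norm (g x)) \<partial>M)"
    proof (rule nn_integral_mono)
      fix x
      have "norm (s i x) \<le> norm (g x - s i x) + norm (g x)"
        by (metis add.commute norm_minus_commute norm_triangle_sub)
      then show "ennreal (norm (s i x)) \<le> ennreal (norm (g x - s i x)) + ennreal (norm (g x))"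
        by (metis ennreal_leI ennreal_plus norm_ge_zero)
    qed
    also have "\<dots> = (\<integral>\<^sup>+x. norm (g x - s i x) \<partial>M) + (\<integral>\<^sup>+x. norm (g x) \<partial>M)"
      by (rule nn_integral_add) auto
    finally show ?thesis using ae ae0 by simp
  qed
  have "(\<lambda>i. (\<integral>\<^sup>+x. ennreal (norm (f x - s i x)) \<partial>M) + (\<integral>\<^sup>+x. norm (f x) \<partial>M)) \<longlonglongrightarrow> 0 + (\<integral>\<^sup>+x. norm (f x) \<partial>M)"
    by (intro tendsto_add s(2) tendsto_const)
  moreover have "(\<lambda>i. ennreal (norm (Bochner_Integration.simple_bochner_integral M (s i)))) \<longlonglongrightarrow> ennreal (norm v)"
    by (intro tendsto_ennrealI tendsto_norm s(3))
  ultimately have "ennreal (norm v) \<le> 0 + (\<integral>\<^sup>+x. norm (f x) \<partial>M)"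
    using le by (intro LIMSEQ_le[of "\<lambda>i. ennreal (norm (Bochner_Integration.simple_bochner_integral M (s i)))"]) auto
  then show ?thesis by simp
qed

lemma strongly_measurable_add:
  assumes "strongly_measurable M f" "strongly_measurable M g"
  shows "strongly_measurable M (\<lambda>x. f x + g x)"
proof -
  obtain f' where f': "smeas M f'" "AE x in M. f x = f' x" by (rule strongly_measurable_obtain_smeas[OF assms(1)])
  obtain g' where g': "smeas M g'" "AE x in M. g x = g' x" by (rule strongly_measurable_obtain_smeas[OF assms(2)])
  have "AE x in M. f' x + g' x = f x + g x"
    using f'(2) g'(2) by eventually_elim simp
  then show ?thesis
    by (rule strongly_measurable_cong_AE[OF smeas_strongly_measurable[OF smeas_add[OF f'(1) g'(1)]]])
qed

lemma strongly_measurable_scaleR: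
  assumes "strongly_measurable M f"
  shows "strongly_measurable M (\<lambda>x. c *\<^sub>R f x)"
proof -
  obtain f' where f': "smeas M f'" "AE x in M. f x = f' x" by (rule strongly_measurable_obtain_smeas[OF assms(1)])
  have "AE x in M. c *\<^sub>R f' x = c *\<^sub>R f x"
    using f'(2) by eventually_elim simp
  then show ?thesis
    by (rule strongly_measurable_cong_AE[OF smeas_strongly_measurable[OF smeas_scaleR[OF f'(1)]]])
qed

lemma nn_integral_norm_add_le:
  assumes "strongly_measurable M f" "strongly_measurable M g"
  shows "(\<integral>\<^sup>+x. ennreal (norm (f x + g x)) \<partial>M) \<le> (\<integral>\<^sup>+x. ennreal (norm (f x)) \<partial>M) + (\<integral>\<^sup>+x. ennreal (norm (g x)) \<partial>M)"
proof -
  obtain f' where f': "smeas M f'" "AE x in M. f x = f' x" by (rule strongly_measurable_obtain_smeas[OF assms(1)])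
  obtain g' where g': "smeas M g'" "AE x in M. g x = g' x" by (rule strongly_measurable_obtain_smeas[OF assms(2)])
  note [measurable] = smeas_norm[OF f'(1)] smeas_norm[OF g'(1)]
  have "(\<integral>\<^sup>+x. ennreal (norm (f x + g x)) \<partial>M) \<le> (\<integral>\<^sup>+x. ennreal (norm (f' x)) + ennreal (norm (g' x)) \<partial>M)"
  proof (rule nn_integral_mono_AE)
    show "AE x in M. ennreal (norm (f x + g x)) \<le> ennreal (norm (f' x)) + ennreal (norm (g' x))"
      using f'(2) g'(2)
      by eventually_elim (simp add: norm_triangle_ineq flip: ennreal_plus)
  qed
  also have "\<dots> = (\<integral>\<^sup>+x. ennreal (norm (f' x)) \<partial>M) + (\<integral>\<^sup>+x. ennreal (norm (g' x)) \<partial>M)"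
    by (rule nn_integral_add) auto
  also have "(\<integral>\<^sup>+x. ennreal (norm (f' x)) \<partial>M) = (\<integral>\<^sup>+x. ennreal (norm (f x)) \<partial>M)"
    using f'(2) by (intro nn_integral_cong_AE) auto
  also have "(\<integral>\<^sup>+x. ennreal (norm (g' x)) \<partial>M) = (\<integral>\<^sup>+x. ennreal (norm (g x)) \<partial>M)"
    using g'(2) by (intro nn_integral_cong_AE) auto
  finally show ?thesis .
qed

lemma has_bint_add:
  assumes "has_bint M f v" "has_bint M g w"
  shows "has_bint M (\<lambda>x. f x + g x) (v + w)"
proof -
  obtain s where s: "\<And>i. Bochner_Integration.simple_bochner_integrable M (s i)"
      "(\<lambda>i::nat. \<integral>\<^sup>+x. ennreal (norm (f x - s i x)) \<partial>M) \<longlonglongrightarrow> 0"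
      "(\<lambda>i. Bochner_Integration.simple_bochner_integral M (s i)) \<longlonglongrightarrow> v"
    using assms unfolding has_bint_def by blast
  obtain t where t: "\<And>i. Bochner_Integration.simple_bochner_integrable M (t i)"
      "(\<lambda>i::nat. \<integral>\<^sup>+x. ennreal (norm (g x - t i x)) \<partial>M) \<longlonglongrightarrow> 0"
      "(\<lambda>i. Bochner_Integration.simple_bochner_integral M (t i)) \<longlonglongrightarrow> w"
    using assms unfolding has_bint_def by blast
  have sm: "strongly_measurable M f" "strongly_measurable M g"
    using assms unfolding has_bint_def by auto
  have dm: "strongly_measurable M (\<lambda>x. h x - u x)" if "strongly_measurable M h" "Bochner_Integration.simple_bochner_integrable M u"
    for h u :: "'a \<Rightarrow> 'b"
    using strongly_measurable_add[OF that(1) strongly_measurable_scaleR[OF smeas_strongly_measurable[OF smeas_simple[OF simple_bochner_integrable_simple[OF that(2)]]], of "-1"]]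
    by simp
  have le: "(\<integral>\<^sup>+x. ennreal (norm (f x + g x - (s i x + t i x))) \<partial>M)
      \<le> (\<integral>\<^sup>+x. ennreal (norm (f x - s i x)) \<partial>M) + (\<integral>\<^sup>+x. ennreal (norm (g x - t i x)) \<partial>M)" for i
    using nn_integral_norm_add_le[OF dm[OF sm(1) s(1)[of i]] dm[OF sm(2) t(1)[of i]]]
    by (simp add: algebra_simps)
  have "(\<lambda>i. (\<integral>\<^sup>+x. ennreal (norm (f x - s i x)) \<partial>M) + (\<integral>\<^sup>+x. ennreal (norm (g x - t i x)) \<partial>M)) \<longlonglongrightarrow> 0"
    using tendsto_add[OF s(2) t(2)] by simp
  then have "(\<lambda>i. (\<integral>\<^sup>+x. ennreal (norm (f x + g x - (s i x + t i x))) \<partial>M)) \<longlonglongrightarrow> 0"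
    by (rule tendsto_sandwich[rotated 2, OF tendsto_const]) (use le in auto)
  moreover have "(\<lambda>i. Bochner_Integration.simple_bochner_integral M (\<lambda>x. s i x + t i x)) \<longlonglongrightarrow> v + w"
    using tendsto_add[OF s(3) t(3)] simple_bochner_integral_add[OF s(1) t(1)] by simp
  moreover have "Bochner_Integration.simple_bochner_integrable M (\<lambda>x. s i x + t i x)" for i
    by (rule simple_bochner_integrable_compose2[OF _ s(1) t(1)]) simp
  ultimately show ?thesis
    using strongly_measurable_add[OF sm] unfolding has_bint_def
    by (intro conjI exI[of _ "\<lambda>i x. s i x + t i x"]) auto
qed

lemma has_bint_scaleR:
  assumes "has_bint M f v"
  shows "has_bint M (\<lambda>x. c *\<^sub>R f x) (c *\<^sub>R v)"
proof -
  obtain s where s: "\<And>i. Bochner_Integration.simple_bochner_integrable M (s i)"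
      "(\<lambda>i::nat. \<integral>\<^sup>+x. ennreal (norm (f x - s i x)) \<partial>M) \<longlonglongrightarrow> 0"
      "(\<lambda>i. Bochner_Integration.simple_bochner_integral M (s i)) \<longlonglongrightarrow> v"
    using assms unfolding has_bint_def by blast
  obtain g where g: "smeas M g" "AE x in M. f x = g x"
    using assms strongly_measurable_obtain_smeas unfolding has_bint_def by metis
  have sm: "smeas M (\<lambda>x. g x - s i x)" for i
    by (intro smeas_diff g(1) smeas_simple simple_bochner_integrable_simple s(1))
  have eq: "(\<integral>\<^sup>+x. ennreal (norm (c *\<^sub>R f x - c *\<^sub>R s i x)) \<partial>M) = ennreal \<bar>c\<bar> * (\<integral>\<^sup>+x. ennreal (norm (f x - s i x)) \<partial>M)" for i
  proof -
    have [measurable]: "(\<lambda>x. norm (g x - s i x)) \<in> borel_measurable M"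
      by (rule smeas_norm[OF sm])
    have "(\<integral>\<^sup>+x. ennreal (norm (c *\<^sub>R f x - c *\<^sub>R s i x)) \<partial>M) = (\<integral>\<^sup>+x. ennreal \<bar>c\<bar> * ennreal (norm (g x - s i x)) \<partial>M)"
    proof (rule nn_integral_cong_AE)
      show "AE x in M. ennreal (norm (c *\<^sub>R f x - c *\<^sub>R s i x)) = ennreal \<bar>c\<bar> * ennreal (norm (g x - s i x))"
        using g(2) by eventually_elim (simp add: ennreal_mult[symmetric] flip: scaleR_diff_right)
    qed
    also have "\<dots> = ennreal \<bar>c\<bar> * (\<integral>\<^sup>+x. ennreal (norm (g x - s i x)) \<partial>M)"
      by (rule nn_integral_cmult) auto
    also have "(\<integral>\<^sup>+x. ennreal (norm (g x - s i x)) \<partial>M) = (\<integral>\<^sup>+x. ennreal (norm (f x - s i x)) \<partial>M)"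
      using g(2) by (intro nn_integral_cong_AE) auto
    finally show ?thesis .
  qed
  have "(\<lambda>i. ennreal \<bar>c\<bar> * (\<integral>\<^sup>+x. ennreal (norm (f x - s i x)) \<partial>M)) \<longlonglongrightarrow> ennreal \<bar>c\<bar> * 0"
    by (intro ennreal_tendsto_cmult s(2)) simp
  then have "(\<lambda>i. \<integral>\<^sup>+x. ennreal (norm (c *\<^sub>R f x - c *\<^sub>R s i x)) \<partial>M) \<longlonglongrightarrow> 0"
    unfolding eq by simp
  moreover have "(\<lambda>i. Bochner_Integration.simple_bochner_integral M (\<lambda>x. c *\<^sub>R s i x)) \<longlonglongrightarrow> c *\<^sub>R v"
    using tendsto_scaleR[OF tendsto_const s(3), of c] simple_bochner_integral_linear[OF linear_scaleR s(1)] by simp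
  moreover have "Bochner_Integration.simple_bochner_integrable M (\<lambda>x. c *\<^sub>R s i x)" for i
    by (rule simple_bochner_integrable_compose2[OF _ s(1) s(1), of "\<lambda>x y. c *\<^sub>R x"]) simp
  ultimately show ?thesis
    using strongly_measurable_scaleR[of M f c] assms unfolding has_bint_def
    by (intro conjI exI[of _ "\<lambda>i x. c *\<^sub>R s i x"]) auto
qed

lemma has_bint_unique:
  assumes "has_bint M f v" "has_bint M f w" shows "v = w"
proof -
  have "has_bint M (\<lambda>x. f x + (-1) *\<^sub>R f x) (v + (-1) *\<^sub>R w)"
    by (intro has_bint_add has_bint_scaleR assms)
  from has_bint_norm_le[OF this] show ?thesis by simp
qed

lemma has_bint_bint_eq: "has_bint M f v \<Longrightarrow> bint M f = v"
  unfolding bint_def using has_bint_unique[of M f] by (metis the_equality)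

lemma has_bint_zero: "has_bint M (\<lambda>_. 0) 0"
proof -
  have "Bochner_Integration.simple_bochner_integrable M (\<lambda>_::'a. 0::'b)"
    by (rule Bochner_Integration.simple_bochner_integrable.intros) auto
  moreover have "Bochner_Integration.simple_bochner_integral M (\<lambda>_::'a. 0::'b) = 0"
    unfolding Bochner_Integration.simple_bochner_integral_def by (rule sum.neutral) auto
  ultimately show ?thesis
    unfolding has_bint_def
    by (intro conjI exI[of _ "\<lambda>_ _. 0"] smeas_strongly_measurable[OF smeas_simple]) simp_all
qed

lemma has_bint_sum:
  assumes "\<And>i. i \<in> I \<Longrightarrow> has_bint M (f i) (v i)"
  shows "has_bint M (\<lambda>x. \<Sum>i\<in>I. f i x) (\<Sum>i\<in>I. v i)"
  using assms by (induction I rule: infinite_finite_induct) (auto intro: has_bint_zero has_bint_add)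

lemma has_bint_simple:
  assumes "Bochner_Integration.simple_bochner_integrable M f"
  shows "has_bint M f (Bochner_Integration.simple_bochner_integral M f)"
  unfolding has_bint_def using assms
  by (intro conjI exI[of _ "\<lambda>_. f"] smeas_strongly_measurable[OF smeas_simple] simple_bochner_integrable_simple) simp_all

lemma has_bint_indicator:
  assumes "A \<in> sets M" "emeasure M A < \<infinity>"
  shows "has_bint M (\<lambda>x. indicator A x *\<^sub>R c) (measure M A *\<^sub>R c)"
proof -
  have eq: "{x \<in> space M. indicat_real A x = 1} = A"
    using sets.sets_into_space[OF assms(1)] by (auto split: split_indicator)
  have sbi: "Bochner_Integration.simple_bochner_integrable M (indicator A :: 'a \<Rightarrow> real)"
  proof
    have "{y \<in> space M. (indicator A y::real) \<noteq> 0} = A"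
      using sets.sets_into_space[OF \<open>A\<in>sets M\<close>] by (auto split: split_indicator)
    then show "emeasure M {y \<in> space M. (indicator A y::real) \<noteq> 0} \<noteq> \<infinity>"
      using assms by auto
  qed (rule simple_function_indicator assms)+
  have lin: "linear (\<lambda>r::real. r *\<^sub>R c)"
    by (intro linearI) (auto simp: algebra_simps)
  have "Bochner_Integration.simple_bochner_integral M (indicator A :: 'a \<Rightarrow> real) = measure M A"
  proof -
    have "indicat_real A ` space M \<subseteq> {0, 1}" by (auto simp: indicator_def)
    then have "Bochner_Integration.simple_bochner_integral M (indicat_real A)
        = (\<Sum>y\<in>{0,1}. measure M {x\<in>space M. indicat_real A x = y} *\<^sub>R y)"
      unfolding Bochner_Integration.simple_bochner_integral_def
    proof (intro sum.mono_neutral_left ballI)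
      fix y assume "y \<in> {0, 1} - indicat_real A ` space M"
      then have "{x \<in> space M. indicat_real A x = y} = {}" by blast
      then show "measure M {x \<in> space M. indicat_real A x = y} *\<^sub>R y = 0" by (metis measure_empty scale_zero_left)
    qed auto
    then show ?thesis using eq by simp
  qed
  then have "Bochner_Integration.simple_bochner_integral M (\<lambda>x. indicat_real A x *\<^sub>R c) = measure M A *\<^sub>R c"
    using simple_bochner_integral_linear[OF lin sbi] by simp
  moreover have "Bochner_Integration.simple_bochner_integrable M (\<lambda>x. indicat_real A x *\<^sub>R c)"
    by (rule simple_bochner_integrable_compose2[OF _ sbi sbi, of "\<lambda>x y. x *\<^sub>R c"]) simp
  ultimately show ?thesis
    using has_bint_simple by metis
qed

text \<open>Convexity of \<open>t powr p\<close> at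
  \<open>c * (a / c) + (1 - c) * (b / (1 - c))\<close>. The free weight matters in limits: as
  \<open>c\<close> tends to 1 the factor of \<open>a powr p\<close> tends to 1, so a small
  perturbation \<open>b\<close> costs nothing in the constant.\<close>

lemma powr_add_le_weighted:
  fixes a b c p :: real
  assumes "0 \<le> a" "0 \<le> b" "0 < c" "c < 1" "1 \<le> p"
  shows "(a + b) powr p \<le> c powr (1 - p) * a powr p + (1 - c) powr (1 - p) * b powr p"
proof -
  have one: "1 \<le> \<mu> powr (1 - p)" if "0 < \<mu>" "\<mu> < 1" for \<mu> :: real
    using powr_mono'[of "1 - p" 0 \<mu>] that assms(5) by simp
  show ?thesis
  proof (cases "a = 0 \<or> b = 0")
    case True
    then show ?thesis
      using one[of c] one[of "1 - c"] assms mult_right_mono[of 1 "c powr (1 - p)" "a powr p"]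
        mult_right_mono[of 1 "(1 - c) powr (1 - p)" "b powr p"] by auto
  next
    case False
    then have pos: "a > 0" "b > 0" using assms by auto
    have "(c *\<^sub>R (a / c) + (1 - c) *\<^sub>R (b / (1 - c))) powr p
        \<le> c * (a / c) powr p + (1 - c) * (b / (1 - c)) powr p"
      using convex_onD[OF powr_convex[OF assms(5)], of "1 - c" "a / c" "b / (1 - c)"] pos assms
      by simp
    also have "c *\<^sub>R (a / c) + (1 - c) *\<^sub>R (b / (1 - c)) = a + b"
      using assms by simp
    also have "c * (a / c) powr p = c powr (1 - p) * a powr p"
      using assms pos by (simp add: powr_divide powr_diff)
    also have "(1 - c) * (b / (1 - c)) powr p = (1 - c) powr (1 - p) * b powr p"
      using assms pos by (simp add: powr_divide powr_diff)
    finally show ?thesis .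
  qed
qed

lemma powr_add_le:
  fixes a b p :: real
  assumes "0 \<le> a" "0 \<le> b" "1 \<le> p"
  shows "(a + b) powr p \<le> 2 powr p * (a powr p + b powr p)"
proof -
  have "(a + b) powr p \<le> (1 / 2) powr (1 - p) * a powr p + (1 / 2) powr (1 - p) * b powr p"
    using powr_add_le_weighted[of a b "1/2" p] assms by simp
  also have "(1 / 2 :: real) powr (1 - p) = 2 powr (p - 1)"
    by (simp add: powr_divide powr_diff)
  also have "2 powr (p - 1) * a powr p + 2 powr (p - 1) * b powr p = 2 powr (p - 1) * (a powr p + b powr p)"
    by (simp add: algebra_simps)
  also have "\<dots> \<le> 2 powr p * (a powr p + b powr p)"
    by (intro mult_right_mono powr_mono) auto
  finally show ?thesis .
qed

text \<open>The graph of \<open>t powr p\<close> lies above its tangent at \<open>r\<close>;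
  obtained from Young's inequality with the exponents p and p'.\<close>

lemma powr_tangent_le:
  fixes r t p :: real
  assumes "0 \<le> r" "0 \<le> t" "1 < p"
  shows "p * r powr (p - 1) * t \<le> t powr p + (p - 1) * r powr p"
proof -
  have "t * r powr (p - 1) \<le> t powr p / p + (r powr (p - 1)) powr (p / (p - 1)) / (p / (p - 1))"
    using assms by (intro Youngs_inequality) (auto simp: field_simps)
  also have "(r powr (p - 1)) powr (p / (p - 1)) = r powr p"
    using assms by (simp add: powr_powr)
  finally have "p * (t * r powr (p - 1)) \<le> p * (t powr p / p + r powr p / (p / (p - 1)))"
    using assms by (intro mult_left_mono) auto
  also have "\<dots> = t powr p + (p - 1) * r powr p"
    using assms by (simp add: field_simps)
  finally show ?thesis by (simp add: mult_ac)
qed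

lemma le_one_plus_powr:
  fixes t p :: real assumes "0 \<le> t" "1 \<le> p" shows "t \<le> 1 + t powr p"
proof (cases "t \<le> 1")
  case False
  then have "t powr 1 \<le> t powr p" using assms by (intro powr_mono) auto
  then show ?thesis using False by simp
qed (simp add: add_increasing2)

text \<open>Truncating \<open>s i\<close> where it exceeds \<open>2 |f|\<close> produces a dominated sequence.\<close>

lemma smeas_approx_simple_Lp:
  assumes "smeas M f" "0 < p" "Lp_int M p f < \<infinity>"
  obtains t where "\<And>i. Bochner_Integration.simple_bochner_integrable M (t i)"
    "(\<lambda>i::nat. Lp_int M p (\<lambda>x. f x - t i x)) \<longlonglongrightarrow> 0"
proof -
  obtain s where s: "\<And>i. simple_function M (s i)" "\<And>x. x \<in> space M \<Longrightarrow> (\<lambda>i::nat. s i x) \<longlonglongrightarrow> f x"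
    using assms(1) unfolding smeas_def by blast
  note [measurable] = smeas_norm[OF assms(1)] smeas_norm[OF smeas_simple[OF s(1)]]
  define A where "A i = {x\<in>space M. norm (s i x) \<le> 2 * norm (f x)}" for i
  have [measurable]: "A i \<in> sets M" for i unfolding A_def by measurable
  define t where "t i x = indicator (A i) x *\<^sub>R s i x" for i x
  have tsimple: "simple_function M (t i)" for i
    unfolding t_def
    by (rule simple_function_compose2[OF simple_function_indicator s(1), of _ "scaleR"]) simp
  have tle: "norm (t i x) \<le> 2 * norm (f x)" for i x
    by (auto simp: t_def A_def indicator_def)
  have tlim: "(\<lambda>i. t i x) \<longlonglongrightarrow> f x" if x: "x \<in> space M" for x
  proof (cases "f x = 0")
    case True
    then have "t i x = 0" for i using tle[of i x] by simp
    then show ?thesis using True by simp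
  next
    case False
    have "(\<lambda>i. norm (s i x)) \<longlonglongrightarrow> norm (f x)" using s(2)[OF x] by (rule tendsto_norm)
    then have "eventually (\<lambda>i. norm (s i x) < 2 * norm (f x)) sequentially"
      using False by (intro order_tendstoD) auto
    then have "eventually (\<lambda>i. s i x = t i x) sequentially"
      by eventually_elim (use x in \<open>auto simp: t_def A_def\<close>)
    then show ?thesis using s(2)[OF x] by (rule Lim_transform_eventually[rotated])
  qed
  have tsbi: "Bochner_Integration.simple_bochner_integrable M (t i)" for i
  proof
    show "simple_function M (t i)" by (rule tsimple)
    have "Lp_int M p (t i) \<le> (\<integral>\<^sup>+x. ennreal (2 powr p) * ennreal (norm (f x) powr p) \<partial>M)"
    proof (rule nn_integral_mono)
      fix x
      have "norm (t i x) powr p \<le> (2 * norm (f x)) powr p"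
        using tle assms(2) by (intro powr_mono2) auto
      then show "ennreal (norm (t i x) powr p) \<le> ennreal (2 powr p) * ennreal (norm (f x) powr p)"
        by (simp add: powr_mult flip: ennreal_mult)
    qed
    also have "\<dots> = ennreal (2 powr p) * Lp_int M p f"
      by (rule nn_integral_cmult) auto
    also have "\<dots> < \<infinity>" using assms(3) by (simp add: ennreal_mult_less_top)
    finally have "Lp_int M p (t i) < \<infinity>" .
    then have "emeasure M {x\<in>space M. ennreal (norm (t i x) powr p) \<noteq> 0} \<noteq> \<infinity>"
      by (intro simple_function_finite_support simple_function_compose1[OF tsimple]) auto
    then show "emeasure M {y \<in> space M. t i y \<noteq> 0} \<noteq> \<infinity>"
      by simp
  qed
  have meas[measurable]: "(\<lambda>x. norm (f x - t i x)) \<in> borel_measurable M" for i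
    by (intro smeas_norm smeas_diff assms(1) smeas_simple tsimple)
  have "(\<lambda>i::nat. Lp_int M p (\<lambda>x. f x - t i x)) \<longlonglongrightarrow> (\<integral>\<^sup>+x. 0 \<partial>M)"
  proof (rule nn_integral_dominated_convergence[where w="\<lambda>x. ennreal (3 powr p) * ennreal (norm (f x) powr p)"])
    show "AE x in M. ennreal (norm (f x - t j x) powr p) \<le> ennreal (3 powr p) * ennreal (norm (f x) powr p)" for j
    proof (rule AE_I2)
      fix x
      have "norm (f x - t j x) \<le> 3 * norm (f x)"
        using norm_triangle_ineq4[of "f x" "t j x"] tle[of j x] by simp
      then have "norm (f x - t j x) powr p \<le> (3 * norm (f x)) powr p"
        using assms(2) by (intro powr_mono2) auto
      then show "ennreal (norm (f x - t j x) powr p) \<le> ennreal (3 powr p) * ennreal (norm (f x) powr p)"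
        by (simp add: powr_mult flip: ennreal_mult)
    qed
    have "(\<integral>\<^sup>+x. ennreal (3 powr p) * ennreal (norm (f x) powr p) \<partial>M) = ennreal (3 powr p) * Lp_int M p f"
      by (rule nn_integral_cmult) auto
    also have "\<dots> < \<infinity>" using assms(3) by (simp add: ennreal_mult_less_top)
    finally show "(\<integral>\<^sup>+x. ennreal (3 powr p) * ennreal (norm (f x) powr p) \<partial>M) < \<infinity>" .
    show "AE x in M. (\<lambda>i. ennreal (norm (f x - t i x) powr p)) \<longlonglongrightarrow> 0"
    proof (rule AE_I2)
      fix x assume "x \<in> space M"
      then have "(\<lambda>i. norm (f x - t i x)) \<longlonglongrightarrow> 0"
        using tendsto_norm[OF tendsto_diff[OF tendsto_const tlim, of x "f x"]] by simp
      then have "(\<lambda>i. norm (f x - t i x) powr p) \<longlonglongrightarrow> 0"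
        using assms(2) by (intro tendsto_zero_powrI[where b=p]) auto
      then show "(\<lambda>i. ennreal (norm (f x - t i x) powr p)) \<longlonglongrightarrow> 0"
        using tendsto_ennrealI by fastforce
    qed
  qed auto
  with tsbi show ?thesis by (intro that) auto
qed

lemma has_bint_exists:
  fixes f :: "'a \<Rightarrow> 'b::banach"
  assumes "smeas M f" "(\<integral>\<^sup>+x. ennreal (norm (f x)) \<partial>M) < \<infinity>"
  shows "\<exists>v. has_bint M f v"
proof -
  obtain t where t: "\<And>i. Bochner_Integration.simple_bochner_integrable M (t i)"
    "(\<lambda>i::nat. Lp_int M 1 (\<lambda>x. f x - t i x)) \<longlonglongrightarrow> 0"
    by (rule smeas_approx_simple_Lp[OF assms(1), of 1]) (use assms(2) in auto)
  let ?e = "\<lambda>i. \<integral>\<^sup>+x. ennreal (norm (f x - t i x)) \<partial>M"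
  let ?I = "\<lambda>i. Bochner_Integration.simple_bochner_integral M (t i)"
  have lim: "?e \<longlonglongrightarrow> 0" using t(2) by simp
  have le: "ennreal (norm (?I i - ?I j)) \<le> ?e i + ?e j" for i j
  proof -
    have sbi: "Bochner_Integration.simple_bochner_integrable M (\<lambda>x. t i x - t j x)"
      by (rule simple_bochner_integrable_compose2[OF _ t(1) t(1)]) simp
    have "norm (?I i - ?I j) = norm (Bochner_Integration.simple_bochner_integral M (\<lambda>x. t i x - t j x))"
      using simple_bochner_integral_diff[OF t(1) t(1)] by simp
    also have "ennreal \<dots> \<le> (\<integral>\<^sup>+x. ennreal (norm (t i x - t j x)) \<partial>M)"
      by (rule ennreal_norm_simple_bochner_integral_le[OF sbi])
    also have "\<dots> = (\<integral>\<^sup>+x. ennreal (norm ((f x - t j x) + (-1) *\<^sub>R (f x - t i x))) \<partial>M)"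
      by (intro nn_integral_cong) (auto simp: norm_minus_commute)
    also have "\<dots> \<le> (\<integral>\<^sup>+x. ennreal (norm (f x - t j x)) \<partial>M) + (\<integral>\<^sup>+x. ennreal (norm ((-1) *\<^sub>R (f x - t i x))) \<partial>M)"
      by (intro nn_integral_norm_add_le smeas_strongly_measurable smeas_scaleR smeas_diff assms(1) smeas_simple
          simple_bochner_integrable_simple t(1))
    finally show ?thesis by (simp add: add.commute norm_minus_commute)
  qed
  have "Cauchy ?I"
  proof (rule metric_CauchyI)
    fix \<epsilon> :: real assume "0 < \<epsilon>"
    then have "0 < ennreal (\<epsilon> / 2)" by simp
    then obtain N where N: "\<And>i. i \<ge> N \<Longrightarrow> ?e i < ennreal (\<epsilon> / 2)"
      using order_tendstoD(2)[OF lim] unfolding eventually_sequentially by blast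
    have "dist (?I i) (?I j) < \<epsilon>" if "i \<ge> N" "j \<ge> N" for i j
    proof -
      have "ennreal (norm (?I i - ?I j)) < ennreal (\<epsilon> / 2) + ennreal (\<epsilon> / 2)"
        using le[of i j] add_strict_mono[OF N[OF that(1)] N[OF that(2)]] by (rule le_less_trans)
      also have "\<dots> = ennreal \<epsilon>" using \<open>0 < \<epsilon>\<close> by (simp flip: ennreal_plus)
      finally show ?thesis using \<open>0 < \<epsilon>\<close> by (simp add: dist_norm ennreal_less_iff)
    qed
    then show "\<exists>N. \<forall>i\<ge>N. \<forall>j\<ge>N. dist (?I i) (?I j) < \<epsilon>" by blast
  qed
  then obtain v where "?I \<longlonglongrightarrow> v" using Cauchy_convergent_iff convergent_def by blast
  then show ?thesis
    unfolding has_bint_def using lim t(1) smeas_strongly_measurable[OF assms(1)] by blast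
qed

section \<open>Bochner integrals of functions with values in a closed subspace\<close>

lemma infdist_less_obtain:
  assumes "infdist x A < r" "A \<noteq> {}"
  obtains a where "a \<in> A" "dist x a < r"
  using assms by (auto simp: infdist_notempty cINF_less_iff)

lemma infdist_subspace_add:
  fixes T :: "'a::real_normed_vector set"
  assumes "subspace T" shows "infdist (x + y) T \<le> infdist x T + infdist y T"
proof (rule field_le_epsilon)
  fix e :: real assume e: "0 < e"
  have ne: "T \<noteq> {}" using subspace_0[OF assms] by auto
  have ex: "\<exists>t\<in>T. dist z t < infdist z T + e / 2" for z
    using infdist_less_obtain[of z T "infdist z T + e / 2"] e ne by (metis half_gt_zero less_add_same_cancel1)
  obtain t where t: "t \<in> T" "dist x t < infdist x T + e / 2" using ex by blast
  obtain u where u: "u \<in> T" "dist y u < infdist y T + e / 2" using ex by blast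
  have "infdist (x + y) T \<le> dist (x + y) (t + u)"
    using subspace_add[OF assms t(1) u(1)] by (rule infdist_le)
  also have "\<dots> \<le> dist x t + dist y u"
    by (rule dist_triangle_add)
  finally show "infdist (x + y) T \<le> infdist x T + infdist y T + e" using t u by linarith
qed

lemma infdist_subspace_scaleR:
  fixes T :: "'a::real_normed_vector set"
  assumes "subspace T" "0 \<le> c" shows "infdist (c *\<^sub>R x) T \<le> c * infdist x T"
proof (rule field_le_epsilon)
  fix e :: real assume e: "0 < e"
  have ne: "T \<noteq> {}" using subspace_0[OF assms(1)] by auto
  \<comment> \<open>The denominator is \<open>c + 1\<close> because \<open>c\<close> may be
    0.\<close>
  have "infdist x T < infdist x T + e / (c + 1)" using e assms by simp
  then obtain t where t: "t \<in> T" "dist x t < infdist x T + e / (c + 1)" using infdist_less_obtain[OF _ ne] by blast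
  have "infdist (c *\<^sub>R x) T \<le> dist (c *\<^sub>R x) (c *\<^sub>R t)"
    using subspace_scale[OF assms(1) t(1)] by (rule infdist_le)
  also have "\<dots> = c * dist x t" using assms(2) by (simp add: dist_norm flip: scaleR_diff_right)
  also have "\<dots> \<le> c * (infdist x T + e / (c + 1))" using t(2) assms(2) by (intro mult_left_mono) auto
  also have "\<dots> \<le> c * infdist x T + e" using e assms(2) by (simp add: field_simps)
  finally show "infdist (c *\<^sub>R x) T \<le> c * infdist x T + e" .
qed

lemma infdist_subspace_sum:
  fixes T :: "'a::real_normed_vector set"
  assumes "subspace T" "finite I" "\<And>i. i \<in> I \<Longrightarrow> 0 \<le> c i"
  shows "infdist (\<Sum>i\<in>I. c i *\<^sub>R x i) T \<le> (\<Sum>i\<in>I. c i * infdist (x i) T)"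
  using assms(2,3)
proof (induction I)
  case empty
  then show ?case using subspace_0[OF assms(1)] by simp
next
  case (insert i I)
  have "infdist (c i *\<^sub>R x i + (\<Sum>i\<in>I. c i *\<^sub>R x i)) T \<le> c i * infdist (x i) T + (\<Sum>i\<in>I. c i * infdist (x i) T)"
    using infdist_subspace_add[OF assms(1), of "c i *\<^sub>R x i" "\<Sum>i\<in>I. c i *\<^sub>R x i"]
      infdist_subspace_scaleR[OF assms(1), of "c i" "x i"] insert by fastforce
  then show ?case using insert by simp
qed

text \<open>The distance to the subspace is a seminorm dominated by the norm, so it can be integrated.\<close>

lemma has_bint_in_subspace:
  assumes "has_bint M f v" "AE x in M. f x \<in> T" "subspace T" "closed T"
  shows "v \<in> T"
proof -
  obtain s where s: "\<And>i. Bochner_Integration.simple_bochner_integrable M (s i)"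
      "(\<lambda>i::nat. \<integral>\<^sup>+x. ennreal (norm (f x - s i x)) \<partial>M) \<longlonglongrightarrow> 0"
      "(\<lambda>i. Bochner_Integration.simple_bochner_integral M (s i)) \<longlonglongrightarrow> v"
    using assms unfolding has_bint_def by blast
  have ne: "T \<noteq> {}" using subspace_0[OF assms(3)] by auto
  have le: "ennreal (infdist (Bochner_Integration.simple_bochner_integral M (s i)) T)
      \<le> (\<integral>\<^sup>+x. ennreal (norm (f x - s i x)) \<partial>M)" for i
  proof -
    have fin: "finite (s i ` space M)"
      using simple_bochner_integrable_simple[OF s(1)] by (auto simp: simple_function_def)
    have sbi: "Bochner_Integration.simple_bochner_integrable M (\<lambda>x. infdist (s i x) T)"
      by (rule simple_bochner_integrable_compose2[OF _ s(1) s(1), of "\<lambda>x y. infdist x T"])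
        (use subspace_0[OF assms(3)] in simp)
    have "infdist (Bochner_Integration.simple_bochner_integral M (s i)) T
        \<le> (\<Sum>y\<in>s i ` space M. measure M {x\<in>space M. s i x = y} * infdist y T)"
      unfolding Bochner_Integration.simple_bochner_integral_def
      by (rule infdist_subspace_sum[OF assms(3) fin]) simp
    also have "\<dots> = (\<Sum>y\<in>s i ` space M. measure M {x\<in>space M. s i x = y} *\<^sub>R infdist y T)" by simp
    also have "\<dots> = Bochner_Integration.simple_bochner_integral M (\<lambda>x. infdist (s i x) T)"
      by (rule simple_bochner_integral_partition[symmetric, OF sbi simple_bochner_integrable_simple[OF s(1)]]) auto
    finally have "ennreal (infdist (Bochner_Integration.simple_bochner_integral M (s i)) T)
        \<le> ennreal (Bochner_Integration.simple_bochner_integral M (\<lambda>x. infdist (s i x) T))"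
      by (rule ennreal_leI)
    also have "\<dots> = (\<integral>\<^sup>+x. ennreal (infdist (s i x) T) \<partial>M)"
      by (rule simple_bochner_integral_eq_nn_integral[OF sbi infdist_nonneg])
    also have "\<dots> \<le> (\<integral>\<^sup>+x. ennreal (norm (f x - s i x)) \<partial>M)"
    proof (rule nn_integral_mono_AE)
      show "AE x in M. ennreal (infdist (s i x) T) \<le> ennreal (norm (f x - s i x))"
        using assms(2)
      proof eventually_elim
        fix x assume "f x \<in> T"
        then have "infdist (s i x) T \<le> dist (s i x) (f x)" by (rule infdist_le)
        then show "ennreal (infdist (s i x) T) \<le> ennreal (norm (f x - s i x))"
          by (simp add: dist_norm norm_minus_commute ennreal_leI)
      qed
    qed
    finally show ?thesis .
  qed
  have "(\<lambda>i. ennreal (infdist (Bochner_Integration.simple_bochner_integral M (s i)) T)) \<longlonglongrightarrow> ennreal (infdist v T)"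
    by (intro tendsto_ennrealI tendsto_infdist s(3))
  moreover have "(\<lambda>i. ennreal (infdist (Bochner_Integration.simple_bochner_integral M (s i)) T)) \<longlonglongrightarrow> 0"
    by (rule tendsto_sandwich[OF _ _ tendsto_const s(2)]) (use le in auto)
  ultimately have "ennreal (infdist v T) = 0" by (rule LIMSEQ_unique)
  then have "infdist v T = 0" using infdist_nonneg[of v T] by (simp add: ennreal_eq_0_iff)
  then show ?thesis using in_closed_iff_infdist_zero[OF assms(4) ne] by simp
qed

text \<open>Integrate the tangent inequality at the mean \<open>r\<close> of \<open>h\<close> over
  \<open>A\<close>: the left side becomes p r^p m, and cancelling (p - 1) r^p m leaves the claim. If
  the integral of \<open>h\<close> is infinite, \<open>enn2real\<close> turns the left side into
  0.\<close>

lemma nn_integral_Jensen_powr: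
  fixes h :: "'a \<Rightarrow> real"
  assumes [measurable]: "h \<in> borel_measurable M" and "\<And>x. 0 \<le> h x" and [measurable]: "A \<in> sets M"
    and "emeasure M A = ennreal m" "0 < m" "1 < p"
  shows "ennreal ((enn2real (\<integral>\<^sup>+x\<in>A. ennreal (h x) \<partial>M) / m) powr p * m) \<le> (\<integral>\<^sup>+x\<in>A. ennreal (h x powr p) \<partial>M)"
proof (cases "(\<integral>\<^sup>+x\<in>A. ennreal (h x) \<partial>M) = \<infinity>")
  case True
  then show ?thesis using assms(6) by simp
next
  case False
  define J where "J = enn2real (\<integral>\<^sup>+x\<in>A. ennreal (h x) \<partial>M)"
  have J: "(\<integral>\<^sup>+x\<in>A. ennreal (h x) \<partial>M) = ennreal J" and J0: "0 \<le> J"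
    using False by (auto simp: J_def less_top)
  define r where "r = J / m"
  have r: "0 \<le> r" using J0 assms(5) by (simp add: r_def)
  let ?c = "(p - 1) * r powr p"
  have c: "0 \<le> ?c" using assms(6) by simp
  have "ennreal (p * r powr (p - 1)) * ennreal J = (\<integral>\<^sup>+x\<in>A. ennreal (p * r powr (p - 1) * h x) \<partial>M)"
    unfolding J[symmetric] using assms(2,6)
    by (subst nn_integral_cmult[symmetric]) (auto simp: ennreal_mult mult.assoc intro!: nn_integral_cong)
  also have "\<dots> \<le> (\<integral>\<^sup>+x\<in>A. (ennreal (h x powr p) + ennreal ?c) \<partial>M)"
  proof (rule nn_integral_mono)
    fix x
    have "p * r powr (p - 1) * h x \<le> h x powr p + ?c"
      by (rule powr_tangent_le[OF r assms(2) assms(6)])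
    then have "ennreal (p * r powr (p - 1) * h x) \<le> ennreal (h x powr p) + ennreal ?c"
      using c by (simp add: ennreal_leI flip: ennreal_plus)
    then show "ennreal (p * r powr (p - 1) * h x) * indicator A x \<le> (ennreal (h x powr p) + ennreal ?c) * indicator A x"
      by (rule mult_right_mono) simp
  qed
  also have "\<dots> = (\<integral>\<^sup>+x\<in>A. ennreal (h x powr p) \<partial>M) + ennreal ?c * emeasure M A"
    by (simp add: distrib_right nn_integral_add nn_integral_cmult_indicator)
  finally have *: "ennreal (p * r powr (p - 1) * J) \<le> (\<integral>\<^sup>+x\<in>A. ennreal (h x powr p) \<partial>M) + ennreal (?c * m)"
    using J0 assms(4,5,6) c by (simp add: ennreal_mult)
  have "J = r * m" using assms(5) by (simp add: r_def)
  moreover have "r powr (p - 1) * r = r powr p"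
    using r powr_mult_base[of r "p - 1"] by (simp add: mult.commute)
  ultimately have "p * r powr (p - 1) * J = r powr p * m + ?c * m"
    by (simp add: algebra_simps)
  with * have "ennreal (r powr p * m) + ennreal (?c * m) \<le> (\<integral>\<^sup>+x\<in>A. ennreal (h x powr p) \<partial>M) + ennreal (?c * m)"
    using c assms(5) by (simp flip: ennreal_plus)
  then have "ennreal (r powr p * m) \<le> (\<integral>\<^sup>+x\<in>A. ennreal (h x powr p) \<partial>M)"
    by (simp add: ennreal_add_left_cancel_le add.commute)
  then show ?thesis unfolding r_def J_def .
qed

section \<open>Finite martingales and decoupling\<close>

text \<open>The infimum is attained because every condition \<open>a \<le> C * r\<close> is closed
  in \<open>C\<close>: divide by \<open>r\<close> if it is positive, and otherwise any single bound
  already gives \<open>a \<le> 0\<close>.\<close>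

lemma UMD_bound_UMD_const:
  assumes "UMD p X" shows "UMD_bound p X (UMD_const p X)"
proof -
  have ne: "{C. UMD_bound p X C} \<noteq> {}" and nn: "\<And>C. C \<in> {C. UMD_bound p X C} \<Longrightarrow> 0 \<le> C"
    using assms unfolding UMD_def by (blast, metis UMD_bound_def mem_Collect_eq)
  have le: "a \<le> UMD_const p X * r" if "0 \<le> r" and a: "\<And>C. UMD_bound p X C \<Longrightarrow> a \<le> C * r" for a r
  proof (cases "r = 0")
    case True
    then show ?thesis using a ne by fastforce
  next
    case False
    with \<open>0 \<le> r\<close> have "0 < r" by simp
    have "a / r \<le> UMD_const p X"
      unfolding UMD_const_def
      by (rule cInf_greatest[OF ne]) (use a \<open>0 < r\<close> in \<open>auto simp: divide_le_eq\<close>)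
    then show ?thesis using \<open>0 < r\<close> by (simp add: divide_le_eq)
  qed
  have "0 \<le> UMD_const p X"
    unfolding UMD_const_def by (rule cInf_greatest[OF ne nn])
  moreover have "0 \<le> Lp_norm M p f" for M :: "(nat \<Rightarrow> 'a) measure" and f :: "(nat \<Rightarrow> 'a) \<Rightarrow> 'a"
    by (simp add: Lp_norm_def)
  ultimately show ?thesis
    unfolding UMD_bound_def[of p X "UMD_const p X"]
    by (auto intro!: le simp: UMD_bound_def)
qed

lemma nn_integral_uniform_count_measure:
  assumes "finite A"
  shows "(\<integral>\<^sup>+x. ennreal (g x) \<partial>uniform_count_measure A) = (\<Sum>x\<in>A. ennreal (1 / card A) * ennreal (g x))"
  unfolding uniform_count_measure_def using assms by (simp add: nn_integral_point_measure_finite)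

lemma simple_function_uniform_count_measure:
  "finite A \<Longrightarrow> simple_function (uniform_count_measure A) f"
  by (auto simp: simple_function_def space_uniform_count_measure sets_uniform_count_measure)

lemma has_bint_uniform_count_measure:
  assumes "finite A"
  shows "has_bint (uniform_count_measure A) f ((1 / card A) *\<^sub>R (\<Sum>x\<in>A. f x))"
proof -
  let ?M = "uniform_count_measure A"
  have 1: "has_bint ?M (\<lambda>x. \<Sum>y\<in>A. indicator {y} x *\<^sub>R f y) (\<Sum>y\<in>A. measure ?M {y} *\<^sub>R f y)"
  proof (rule has_bint_sum, rule has_bint_indicator)
    fix y assume "y \<in> A"
    then show "{y} \<in> sets ?M" by (simp add: sets_uniform_count_measure)
    show "emeasure ?M {y} < \<infinity>"
      using \<open>y \<in> A\<close> assms by (simp add: emeasure_uniform_count_measure)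
  qed
  have "(\<Sum>y\<in>A. measure ?M {y} *\<^sub>R f y) = (1 / card A) *\<^sub>R (\<Sum>x\<in>A. f x)"
    using assms by (simp add: measure_uniform_count_measure scaleR_sum_right)
  moreover have "has_bint ?M (\<lambda>x. \<Sum>y\<in>A. indicator {y} x *\<^sub>R f y) v \<longleftrightarrow> has_bint ?M f v" for v
  proof (rule has_bint_cong_AE, rule AE_I2)
    fix x assume "x \<in> space ?M"
    then have "x \<in> A" by (simp add: space_uniform_count_measure)
    then show "(\<Sum>y\<in>A. indicator {y} x *\<^sub>R f y) = f x"
      using assms by (subst sum.remove[of A x]) (auto intro!: sum.neutral)
  qed
  ultimately show ?thesis using 1 by simp
qed

lemma Lp_norm_uniform_count_measure:
  assumes "finite A"
  shows "Lp_norm (uniform_count_measure A) p f = ((\<Sum>x\<in>A. norm (f x) powr p) / card A) powr (1 / p)"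
proof -
  have "(\<Sum>x\<in>A. ennreal (1 / card A) * ennreal (norm (f x) powr p)) = ennreal (\<Sum>x\<in>A. 1 / card A * norm (f x) powr p)"
    by (subst sum_ennreal[symmetric]) (auto simp: ennreal_mult[symmetric])
  also have "(\<Sum>x\<in>A. 1 / card A * norm (f x) powr p) = (\<Sum>x\<in>A. norm (f x) powr p) / card A"
    by (simp add: sum_divide_distrib)
  finally show ?thesis
    unfolding Lp_norm_def nn_integral_uniform_count_measure[OF assms]
    by (simp add: sum_nonneg divide_nonneg_nonneg)
qed

text \<open>For an equivalence relation these are the unions of its classes, so a finite filtration
  becomes a sequence of relations and conditional mean zero becomes a vanishing finite sum.\<close>

definition saturated :: "'a set \<Rightarrow> ('a \<Rightarrow> 'a \<Rightarrow> bool) \<Rightarrow> 'a set \<Rightarrow> bool" where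
  "saturated \<Omega> R A \<longleftrightarrow> A \<subseteq> \<Omega> \<and> (\<forall>u\<in>A. \<forall>v\<in>\<Omega>. R u v \<longrightarrow> v \<in> A)"

text \<open>Symmetry of \<open>R\<close> is what yields closure under complements.\<close>

lemma sigma_algebra_saturated:
  assumes "\<And>u v. u \<in> \<Omega> \<Longrightarrow> v \<in> \<Omega> \<Longrightarrow> R u v \<Longrightarrow> R v u"
  shows "sigma_algebra \<Omega> {A. saturated \<Omega> R A}"
proof (rule sigma_algebra_iff2[THEN iffD2], intro conjI ballI allI impI)
  show "{A. saturated \<Omega> R A} \<subseteq> Pow \<Omega>" "{} \<in> {A. saturated \<Omega> R A}"
    by (auto simp: saturated_def)
next
  fix s assume s: "s \<in> {A. saturated \<Omega> R A}"
  show "\<Omega> - s \<in> {A. saturated \<Omega> R A}"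
    using s assms unfolding saturated_def by blast
next
  fix A :: "nat \<Rightarrow> 'a set" assume "range A \<subseteq> {A. saturated \<Omega> R A}"
  then have A: "saturated \<Omega> R (A i)" for i by auto
  show "(\<Union>i. A i) \<in> {A. saturated \<Omega> R A}"
    using A unfolding saturated_def by blast
qed

text \<open>Finite martingales, with the filtration given by relations: \<open>R n\<close> relates the sample
  points not distinguished at time \<open>n\<close>. The sample space embeds into the sequence space over
  which \<open>UMD_bound\<close> quantifies unless the Banach space is trivial.\<close>

lemma UMD_bound_finite:
  fixes d :: "nat \<Rightarrow> 'a \<Rightarrow> 'b::real_normed_vector"
  assumes U: "UMD_bound p X C" and p: "0 < p" and fin: "finite \<Omega>"
    and sym: "\<And>n u v. n \<le> K \<Longrightarrow> u \<in> \<Omega> \<Longrightarrow> v \<in> \<Omega> \<Longrightarrow> R n u v \<Longrightarrow> R n v u"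
    and dec: "\<And>n u v. n < K \<Longrightarrow> u \<in> \<Omega> \<Longrightarrow> v \<in> \<Omega> \<Longrightarrow> R (Suc n) u v \<Longrightarrow> R n u v"
    and adapted: "\<And>n u v. n < K \<Longrightarrow> u \<in> \<Omega> \<Longrightarrow> v \<in> \<Omega> \<Longrightarrow> R (Suc n) u v \<Longrightarrow> d n u = d n v"
    and mean: "\<And>n A. n < K \<Longrightarrow> saturated \<Omega> (R n) A \<Longrightarrow> (\<Sum>u\<in>A. d n u) = 0"
    and X: "\<And>n u. n < K \<Longrightarrow> u \<in> \<Omega> \<Longrightarrow> d n u \<in> X"
    and \<epsilon>: "\<And>n. n < K \<Longrightarrow> \<epsilon> n \<in> {-1, 1}"
  shows "(\<Sum>u\<in>\<Omega>. norm (\<Sum>n<K. \<epsilon> n *\<^sub>R d n u) powr p) \<le> C powr p * (\<Sum>u\<in>\<Omega>. norm (\<Sum>n<K. d n u) powr p)"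
proof (cases "\<Omega> = {} \<or> (\<forall>x::'b. x = 0)")
  case True
  then show ?thesis
  proof
    assume "\<forall>x::'b. x = 0"
    then have "norm (x::'b) = 0" for x by simp
    then show ?thesis using p by (simp only: powr_0 sum.neutral_const mult_zero_right)
  qed simp
next
  case False
  then obtain v :: 'b where v: "v \<noteq> 0" by auto
  from False have ne: "\<Omega> \<noteq> {}" by simp
  obtain h :: "'a \<Rightarrow> nat" where h: "inj_on h \<Omega>"
    using finite_imp_inj_to_nat_seg[OF fin] by auto
  \<comment> \<open>Sample points become constant sequences, distinct because they are distinct
    multiples of the nonzero vector \<open>v\<close>.\<close>
  define emb :: "'a \<Rightarrow> nat \<Rightarrow> 'b" where "emb u = (\<lambda>_. real (h u) *\<^sub>R v)" for u
  have emb: "inj_on emb \<Omega>"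
    using h v by (auto simp: emb_def inj_on_def fun_eq_iff)
  define \<Omega>' where "\<Omega>' = emb ` \<Omega>"
  define k where "k = the_inv_into \<Omega> emb"
  have k: "k (emb u) = u" if "u \<in> \<Omega>" for u
    unfolding k_def using emb that by (rule the_inv_into_f_f)
  have kO: "k w \<in> \<Omega>" if "w \<in> \<Omega>'" for w
    using that k by (auto simp: \<Omega>'_def)
  have fin': "finite \<Omega>'" and ne': "\<Omega>' \<noteq> {}" and card: "card \<Omega>' = card \<Omega>"
    using fin ne emb by (auto simp: \<Omega>'_def card_image)
  have sum': "(\<Sum>w\<in>emb ` A. g (k w)) = (\<Sum>u\<in>A. g u)" if "A \<subseteq> \<Omega>" for A and g :: "'a \<Rightarrow> 'z::comm_monoid_add"
    using that emb k by (subst sum.reindex) (auto intro!: sum.cong dest: inj_on_subset)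
  define M where "M = uniform_count_measure \<Omega>'"
  define G where "G n = {A. saturated \<Omega>' (\<lambda>u v. R n (k u) (k v)) A}" for n
  define F where "F n = sigma \<Omega>' (G n)" for n
  have spM: "space M = \<Omega>'" and setsM: "sets M = Pow \<Omega>'"
    by (auto simp: M_def space_uniform_count_measure sets_uniform_count_measure)
  have G: "sigma_algebra \<Omega>' (G n)" if "n \<le> K" for n
    unfolding G_def by (rule sigma_algebra_saturated) (use that kO sym in blast)
  have spF: "space (F n) = \<Omega>'" for n
    unfolding F_def by (rule space_measure_of) (auto simp: G_def saturated_def)
  have setsF: "sets (F n) = G n" if "n \<le> K" for n
    unfolding F_def using G[OF that] by (rule sigma_algebra.sets_measure_of_eq)
  have sub: "subalgebra M (F n)" if "n \<le> K" for n
    unfolding subalgebra_def spM setsM spF setsF[OF that] by (auto simp: G_def saturated_def)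
  \<comment> \<open>Differences in \<open>UMD_bound\<close> are numbered from 1, with
    \<open>d' n\<close> measurable for \<open>F n\<close>; here \<open>d n\<close> is known from
    time \<open>Suc n\<close> on.\<close>
  define d' where "d' n w = d (n - 1) (k w)" for n w
  have simp: "simple_function M f" for f :: "(nat \<Rightarrow> 'b) \<Rightarrow> 'c"
    unfolding M_def using fin' by (rule simple_function_uniform_count_measure)
  have bint: "has_bint M f ((1 / card \<Omega>') *\<^sub>R (\<Sum>x\<in>\<Omega>'. f x))" for f :: "(nat \<Rightarrow> 'b) \<Rightarrow> 'b"
    unfolding M_def using fin' by (rule has_bint_uniform_count_measure)
  have mart: "Lp_martingale_differences p M K F d'"
    unfolding Lp_martingale_differences_def
  proof (intro conjI allI impI ballI)
    show "subalgebra M (F n)" if "n \<le> K" for n by (rule sub[OF that])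
  next
    fix m n assume mn: "m \<le> n \<and> n \<le> K"
    then have "m \<le> n" "n \<le> K" by auto
    then have "G m \<subseteq> G n"
    proof (induction n rule: dec_induct)
      case (step n)
      have "G n \<subseteq> G (Suc n)"
      proof
        fix A assume A: "A \<in> G n"
        have "v \<in> A" if "u \<in> A" "v \<in> \<Omega>'" "R (Suc n) (k u) (k v)" for u v
        proof -
          have "u \<in> \<Omega>'" using A that(1) by (auto simp: G_def saturated_def)
          then have "R n (k u) (k v)" using dec[of n "k u" "k v"] that kO step by auto
          then show ?thesis using A that unfolding G_def saturated_def by blast
        qed
        then show "A \<in> G (Suc n)" using A unfolding G_def saturated_def by blast
      qed
      then show ?case using step by auto
    qed simp
    then show "sets (F m) \<subseteq> sets (F n)" using setsF mn by auto
  next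
    fix n assume n: "n \<in> {1..K}"
    have "Lp_int M p (d' n) < \<infinity>"
      unfolding M_def nn_integral_uniform_count_measure[OF fin']
      by (simp add: ennreal_mult[symmetric])
    then show "in_Lp M p (d' n)"
      unfolding in_Lp_def by (auto intro: smeas_strongly_measurable smeas_simple simp)
    have sf: "simple_function (restr_to_subalg M (F n)) (d' n)"
      unfolding simple_function_def space_restr_to_subalg sets_restr_to_subalg[OF sub[of n, simplified]]
    proof (intro conjI ballI)
      show "finite (d' n ` space M)" using spM fin' by simp
      fix x assume "x \<in> d' n ` space M"
      have "d (n - 1) (k w) = d (n - 1) (k w')" if "w \<in> \<Omega>'" "w' \<in> \<Omega>'" "R n (k w) (k w')" for w w'
        using adapted[of "n - 1" "k w" "k w'"] kO that n by auto
      then show "d' n -` {x} \<inter> space M \<in> sets (restr_to_subalg M (F n))"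
        using n by (subst sets_restr_to_subalg[OF sub])
          (auto simp: setsF spM G_def saturated_def d'_def)
    qed
    then show "strongly_measurable (restr_to_subalg M (F n)) (d' n)"
      by (intro smeas_strongly_measurable smeas_simple)
    show "has_cond_exp M (F (n - 1)) (d' n) (\<lambda>_. 0)"
      unfolding has_cond_exp_def
    proof (intro conjI ballI exI)
      show "strongly_measurable (restr_to_subalg M (F (n - 1))) (\<lambda>_. 0::'b)"
        by (intro smeas_strongly_measurable smeas_simple) simp
      fix A assume A: "A \<in> sets (F (n - 1))"
      then have A': "saturated \<Omega>' (\<lambda>u v. R (n - 1) (k u) (k v)) A"
        using n setsF[of "n - 1"] by (auto simp: G_def)
      define B where "B = {u\<in>\<Omega>. emb u \<in> A}"
      have AB: "A = emb ` B" using A' by (auto simp: B_def saturated_def \<Omega>'_def)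
      have "saturated \<Omega> (R (n - 1)) B"
        using A' k unfolding saturated_def B_def \<Omega>'_def by auto
      then have "(\<Sum>u\<in>B. d (n - 1) u) = 0" using n by (intro mean) auto
      then have "(\<Sum>w\<in>A. d' n w) = 0"
        unfolding AB d'_def by (subst sum') (auto simp: B_def)
      moreover have "A \<subseteq> \<Omega>'" using A' by (simp add: saturated_def)
      ultimately have "(\<Sum>w\<in>\<Omega>'. indicator A w *\<^sub>R d' n w) = 0"
        using fin' by (simp add: indicator_scaleR_eq_if sum.If_cases Int_absorb1)
      then show "has_bint M (\<lambda>x. indicator A x *\<^sub>R d' n x) 0"
        using bint[of "\<lambda>x. indicator A x *\<^sub>R d' n x"] by simp
      show "has_bint M (\<lambda>x. indicator A x *\<^sub>R (0::'b)) 0"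
        using has_bint_zero by simp
    qed
  qed
  have prob: "prob_space M"
    unfolding M_def using fin' ne' by (rule prob_space_uniform_count_measure)
  define \<epsilon>' where "\<epsilon>' n = \<epsilon> (n - 1)" for n
  have shift: "(\<Sum>n=1..K. g (n - 1)) = (\<Sum>n<K. g n)" for g :: "nat \<Rightarrow> 'b"
    by (rule sum.reindex_bij_witness[of _ Suc "\<lambda>n. n - 1"]) auto
  have "Lp_norm M p (\<lambda>\<omega>. \<Sum>n=1..K. \<epsilon>' n *\<^sub>R d' n \<omega>) \<le> C * Lp_norm M p (\<lambda>\<omega>. \<Sum>n=1..K. d' n \<omega>)"
  proof (rule U[unfolded UMD_bound_def, THEN conjunct2, rule_format, of M K F d' \<epsilon>'], intro conjI ballI)
    show "d' n \<omega> \<in> X" if "n \<in> {1..K}" "\<omega> \<in> space M" for n \<omega>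
      using X[of "n - 1" "k \<omega>"] kO that by (auto simp: d'_def spM)
    show "\<epsilon>' n \<in> {-1, 1}" if "n \<in> {1..K}" for n
      using \<epsilon>[of "n - 1"] that by (auto simp: \<epsilon>'_def)
  qed (fact prob mart)+
  also have "(\<lambda>\<omega>. \<Sum>n=1..K. \<epsilon>' n *\<^sub>R d' n \<omega>) = (\<lambda>\<omega>. \<Sum>n<K. \<epsilon> n *\<^sub>R d n (k \<omega>))"
    using shift[of "\<lambda>n. \<epsilon> n *\<^sub>R d n (k \<omega>)" for \<omega>] by (simp add: \<epsilon>'_def d'_def)
  also have "(\<lambda>\<omega>. \<Sum>n=1..K. d' n \<omega>) = (\<lambda>\<omega>. \<Sum>n<K. d n (k \<omega>))"
    using shift[of "\<lambda>n. d n (k \<omega>)" for \<omega>] by (simp add: d'_def)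
  finally have ineq: "Lp_norm M p (\<lambda>\<omega>. \<Sum>n<K. \<epsilon> n *\<^sub>R d n (k \<omega>)) \<le> C * Lp_norm M p (\<lambda>\<omega>. \<Sum>n<K. d n (k \<omega>))" .
  have C: "0 \<le> C" using U by (simp add: UMD_bound_def)
  define P where "P = (\<Sum>u\<in>\<Omega>. norm (\<Sum>n<K. \<epsilon> n *\<^sub>R d n u) powr p)"
  define Q where "Q = (\<Sum>u\<in>\<Omega>. norm (\<Sum>n<K. d n u) powr p)"
  have nn: "0 \<le> P" "0 \<le> Q" by (auto simp: P_def Q_def sum_nonneg)
  have c: "0 < real (card \<Omega>)" using fin ne by (simp add: card_gt_0_iff)
  have "(P / card \<Omega>) powr (1 / p) \<le> C * (Q / card \<Omega>) powr (1 / p)"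
    using ineq sum'[of \<Omega> "\<lambda>u. norm (\<Sum>n<K. \<epsilon> n *\<^sub>R d n u) powr p"] sum'[of \<Omega> "\<lambda>u. norm (\<Sum>n<K. d n u) powr p"]
    unfolding M_def Lp_norm_uniform_count_measure[OF fin'] card
    by (simp add: P_def Q_def \<Omega>'_def)
  then have "((P / card \<Omega>) powr (1 / p)) powr p \<le> (C * (Q / card \<Omega>) powr (1 / p)) powr p"
    using p by (intro powr_mono2) auto
  then have "P / card \<Omega> \<le> C powr p * (Q / card \<Omega>)"
    using p nn c C by (simp add: powr_powr powr_mult)
  then show ?thesis
    using c by (simp add: P_def Q_def field_simps)
qed

lemma norm_half_sum_powr_le:
  fixes u v :: "'a::real_normed_vector"
  assumes "1 \<le> p"
  shows "norm ((1/2) *\<^sub>R (u + v)) powr p \<le> (norm u powr p + norm v powr p) / 2"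
proof -
  have "norm ((1/2) *\<^sub>R (u + v)) powr p \<le> (norm u / 2 + norm v / 2) powr p"
    using norm_triangle_ineq[of u v] assms by (intro powr_mono2) auto
  also have "\<dots> \<le> (1/2) powr (1 - p) * (norm u / 2) powr p + (1/2) powr (1 - p) * (norm v / 2) powr p"
    using powr_add_le_weighted[of "norm u / 2" "norm v / 2" "1/2" p] assms by simp
  also have "\<dots> = (norm u powr p + norm v powr p) / 2"
    by (simp add: powr_divide powr_diff field_simps)
  finally show ?thesis .
qed

text \<open>A multiplier \<open>0\<close> is the mean of the multipliers \<open>1\<close> and \<open>-1\<close>.\<close>

lemma UMD_bound_finite_multiplier:
  fixes d :: "nat \<Rightarrow> 'a \<Rightarrow> 'b::real_normed_vector"
  assumes U: "UMD_bound p X C" and p: "1 \<le> p" and fin: "finite \<Omega>"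
    and sym: "\<And>n u v. n \<le> K \<Longrightarrow> u \<in> \<Omega> \<Longrightarrow> v \<in> \<Omega> \<Longrightarrow> R n u v \<Longrightarrow> R n v u"
    and dec: "\<And>n u v. n < K \<Longrightarrow> u \<in> \<Omega> \<Longrightarrow> v \<in> \<Omega> \<Longrightarrow> R (Suc n) u v \<Longrightarrow> R n u v"
    and adapted: "\<And>n u v. n < K \<Longrightarrow> u \<in> \<Omega> \<Longrightarrow> v \<in> \<Omega> \<Longrightarrow> R (Suc n) u v \<Longrightarrow> d n u = d n v"
    and mean: "\<And>n A. n < K \<Longrightarrow> saturated \<Omega> (R n) A \<Longrightarrow> (\<Sum>u\<in>A. d n u) = 0"
    and X: "\<And>n u. n < K \<Longrightarrow> u \<in> \<Omega> \<Longrightarrow> d n u \<in> X"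
    and \<epsilon>: "\<And>n. n < K \<Longrightarrow> \<epsilon> n \<in> {-1, 0, 1}"
  shows "(\<Sum>u\<in>\<Omega>. norm (\<Sum>n<K. \<epsilon> n *\<^sub>R d n u) powr p) \<le> C powr p * (\<Sum>u\<in>\<Omega>. norm (\<Sum>n<K. d n u) powr p)"
proof -
  define \<epsilon>' where "\<epsilon>' \<sigma> n = (if \<epsilon> n = 0 then \<sigma> else \<epsilon> n)" for \<sigma> n
  have bound: "(\<Sum>u\<in>\<Omega>. norm (\<Sum>n<K. \<epsilon>' \<sigma> n *\<^sub>R d n u) powr p) \<le> C powr p * (\<Sum>u\<in>\<Omega>. norm (\<Sum>n<K. d n u) powr p)"
    if "\<sigma> \<in> {-1, 1}" for \<sigma>
    by (rule UMD_bound_finite[where R=R and X=X, OF U _ fin sym dec adapted mean X])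
      (use that \<epsilon> p in \<open>auto simp: \<epsilon>'_def\<close>)
  have "(\<Sum>n<K. \<epsilon> n *\<^sub>R d n u) = (1/2) *\<^sub>R ((\<Sum>n<K. \<epsilon>' 1 n *\<^sub>R d n u) + (\<Sum>n<K. \<epsilon>' (-1) n *\<^sub>R d n u))" for u
  proof -
    have "\<epsilon> n *\<^sub>R d n u = (1/2) *\<^sub>R (\<epsilon>' 1 n *\<^sub>R d n u + \<epsilon>' (-1) n *\<^sub>R d n u)" for n
      by (simp add: \<epsilon>'_def flip: scaleR_add_left)
    then show ?thesis by (simp only: scaleR_sum_right sum.distrib[symmetric] scaleR_add_right)
  qed
  then have "(\<Sum>u\<in>\<Omega>. norm (\<Sum>n<K. \<epsilon> n *\<^sub>R d n u) powr p)
      \<le> (\<Sum>u\<in>\<Omega>. (norm (\<Sum>n<K. \<epsilon>' 1 n *\<^sub>R d n u) powr p + norm (\<Sum>n<K. \<epsilon>' (-1) n *\<^sub>R d n u) powr p) / 2)"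
    by (intro sum_mono) (simp only: norm_half_sum_powr_le[OF p])
  also have "\<dots> = ((\<Sum>u\<in>\<Omega>. norm (\<Sum>n<K. \<epsilon>' 1 n *\<^sub>R d n u) powr p) + (\<Sum>u\<in>\<Omega>. norm (\<Sum>n<K. \<epsilon>' (-1) n *\<^sub>R d n u) powr p)) / 2"
    by (simp only: sum_divide_distrib[symmetric] sum.distrib)
  also have "\<dots> \<le> C powr p * (\<Sum>u\<in>\<Omega>. norm (\<Sum>n<K. d n u) powr p)"
    using bound[of 1] bound[of "-1"] by simp
  finally show ?thesis .
qed

lemma sum_lessThan_mult3:
  fixes f :: "nat \<Rightarrow> 'a::comm_monoid_add"
  shows "(\<Sum>n<3 * m. f n) = (\<Sum>k<m. f (3 * k) + f (3 * k + 1) + f (3 * k + 2))"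
proof (induction m)
  case (Suc m)
  have "3 * Suc m = Suc (Suc (Suc (3 * m)))" by simp
  then show ?case using Suc by (simp add: add.assoc del: mult_Suc_right)
qed simp

text \<open>Each level of the tree is resolved in three steps of one martingale of length
  \<open>3 * m\<close>, with \<open>R1 n\<close> and \<open>R2 n\<close> interpolated between
  \<open>R n\<close> and \<open>R (Suc n)\<close>. Decoupling uses the steps for the unordered pair,
  its order and the remaining information; Stein's inequality uses one step for each of the two
  branches.\<close>

lemma UMD_bound_blocks:
  fixes a b c :: "nat \<Rightarrow> 'a \<Rightarrow> 'b::real_normed_vector"
  assumes U: "UMD_bound p X C" and p: "1 \<le> p" and fin: "finite \<Omega>"
    and sym: "\<And>n u v. R n u v \<Longrightarrow> R n v u" "\<And>n u v. R1 n u v \<Longrightarrow> R1 n v u" "\<And>n u v. R2 n u v \<Longrightarrow> R2 n v u"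
    and dec: "\<And>n u v. R1 n u v \<Longrightarrow> R n u v" "\<And>n u v. R2 n u v \<Longrightarrow> R1 n u v" "\<And>n u v. R (Suc n) u v \<Longrightarrow> R2 n u v"
    and adapted: "\<And>n u v. R1 n u v \<Longrightarrow> a n u = a n v" "\<And>n u v. R2 n u v \<Longrightarrow> b n u = b n v"
      "\<And>n u v. R (Suc n) u v \<Longrightarrow> c n u = c n v"
    and mean: "\<And>n A. n < m \<Longrightarrow> saturated \<Omega> (R n) A \<Longrightarrow> (\<Sum>u\<in>A. a n u) = 0"
      "\<And>n A. n < m \<Longrightarrow> saturated \<Omega> (R1 n) A \<Longrightarrow> (\<Sum>u\<in>A. b n u) = 0"
      "\<And>n A. n < m \<Longrightarrow> saturated \<Omega> (R2 n) A \<Longrightarrow> (\<Sum>u\<in>A. c n u) = 0"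
    and X: "\<And>n u. a n u \<in> X" "\<And>n u. b n u \<in> X" "\<And>n u. c n u \<in> X"
    and \<epsilon>: "\<alpha> \<in> {-1, 0, 1}" "\<beta> \<in> {-1, 0, 1}" "\<gamma> \<in> {-1, 0, 1}"
  shows "(\<Sum>u\<in>\<Omega>. norm (\<Sum>n<m. \<alpha> *\<^sub>R a n u + \<beta> *\<^sub>R b n u + \<gamma> *\<^sub>R c n u) powr p)
    \<le> C powr p * (\<Sum>u\<in>\<Omega>. norm (\<Sum>n<m. a n u + b n u + c n u) powr p)"
proof -
  define d where "d n = (if n mod 3 = 0 then a (n div 3) else if n mod 3 = 1 then b (n div 3) else c (n div 3))" for n
  define S where "S n = (if n mod 3 = 0 then R (n div 3) else if n mod 3 = 1 then R1 (n div 3) else R2 (n div 3))" for n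
  define \<epsilon> where "\<epsilon> n = (if n mod 3 = 0 then \<alpha> else if n mod 3 = 1 then \<beta> else \<gamma>)" for n :: nat
  have [simp]: "Suc (3 * k) mod 3 = 1" "Suc (Suc (3 * k)) mod 3 = 2" "Suc (3 * k) div 3 = k" "Suc (Suc (3 * k)) div 3 = k" for k
    by presburger+
  have cases: "\<exists>k. n = 3 * k \<or> n = Suc (3 * k) \<or> n = Suc (Suc (3 * k))" for n :: nat
    by presburger
  have S3: "S (3 * k) = R k" "S (Suc (3 * k)) = R1 k" "S (Suc (Suc (3 * k))) = R2 k" "S (Suc (Suc (Suc (3 * k)))) = R (Suc k)" for k
    by (auto simp: S_def)
  have d3: "d (3 * k) = a k" "d (Suc (3 * k)) = b k" "d (Suc (Suc (3 * k))) = c k" for k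
    by (auto simp: d_def)
  have \<epsilon>3: "\<epsilon> (3 * k) = \<alpha>" "\<epsilon> (Suc (3 * k)) = \<beta>" "\<epsilon> (Suc (Suc (3 * k))) = \<gamma>" for k
    by (auto simp: \<epsilon>_def)
  have "(\<Sum>u\<in>\<Omega>. norm (\<Sum>n<3 * m. \<epsilon> n *\<^sub>R d n u) powr p) \<le> C powr p * (\<Sum>u\<in>\<Omega>. norm (\<Sum>n<3 * m. d n u) powr p)"
  proof (rule UMD_bound_finite_multiplier[where R=S, OF U p fin])
    show "S n v u" if "S n u v" for n u v
      using cases[of n] that sym by (auto simp: S3)
    show "S n u v" if "S (Suc n) u v" for n u v
      using cases[of n] that dec by (auto simp: S3)
    show "d n u = d n v" if "S (Suc n) u v" for n u v
      using cases[of n] that adapted by (auto simp: S3 d3)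
    show "(\<Sum>u\<in>A. d n u) = 0" if "n < 3 * m" "saturated \<Omega> (S n) A" for n A
      using cases[of n] that mean by (auto simp: S3 d3)
    show "d n u \<in> X" for n u
      using cases[of n] X by (auto simp: d3)
    show "\<epsilon> n \<in> {-1, 0, 1}" for n
      using cases[of n] \<epsilon> by (auto simp: \<epsilon>3)
  qed
  then show ?thesis
    by (simp add: sum_lessThan_mult3 d3 \<epsilon>3)
qed

text \<open>Words over \<open>'l\<close> are the nodes of a tree, with \<open>i # w\<close> the child of \<open>w\<close> with label \<open>i\<close>;
  \<open>node x n\<close> is the node at depth \<open>n\<close> of the branch \<open>x\<close>.\<close>

primrec node :: "(nat \<Rightarrow> 'l) \<Rightarrow> nat \<Rightarrow> 'l list" where
  "node x 0 = []"
| "node x (Suc n) = x n # node x n"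

lemma path_cong: "(\<And>k. k < n \<Longrightarrow> x k = y k) \<Longrightarrow> node x n = node y n"
  by (induction n) auto

lemma path_upd [simp]: "n \<le> k \<Longrightarrow> node (x(k := i)) n = node x n"
  by (rule path_cong) auto

text \<open>Resampling one coordinate: on \<open>A\<close> times the label set, sending
  \<open>(u, i)\<close> to \<open>(upd u i, get u)\<close> is an involution, so the sum over
  \<open>A\<close> equals its average over the resampled label, which vanishes.\<close>

lemma sum_eq_0_by_update:
  fixes g :: "'a \<Rightarrow> 'b::real_vector" and upd :: "'a \<Rightarrow> 'l::finite \<Rightarrow> 'a"
  assumes "finite A" and closed: "\<And>u i. u \<in> A \<Longrightarrow> upd u i \<in> A"
    and upd: "\<And>u i j. upd (upd u i) j = upd u j" "\<And>u. upd u (get u) = u" "\<And>u i. get (upd u i) = i"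
    and zero: "\<And>u. u \<in> A \<Longrightarrow> (\<Sum>i\<in>UNIV. g (upd u i)) = 0"
  shows "(\<Sum>u\<in>A. g u) = 0"
proof -
  have "real CARD('l) *\<^sub>R (\<Sum>u\<in>A. g u) = (\<Sum>(u, i)\<in>A \<times> (UNIV::'l set). g u)"
    by (simp add: sum.cartesian_product[symmetric] scaleR_sum_right scaleR_conv_of_real sum_constant_scaleR)
  also have "\<dots> = (\<Sum>(u, i)\<in>A \<times> (UNIV::'l set). g (upd u i))"
    by (rule sum.reindex_bij_witness[of _ "\<lambda>(u, i). (upd u i, get u)" "\<lambda>(u, i). (upd u i, get u)"])
      (auto simp: upd closed)
  also have "\<dots> = 0"
    using zero by (simp add: sum.cartesian_product[symmetric])
  finally show ?thesis by simp
qed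

lemma sum_eq_0_by_involution:
  fixes g :: "'a \<Rightarrow> 'b::real_vector"
  assumes "\<And>u. u \<in> A \<Longrightarrow> s u \<in> A" "\<And>u. u \<in> A \<Longrightarrow> s (s u) = u" "\<And>u. u \<in> A \<Longrightarrow> g (s u) = - g u"
  shows "(\<Sum>u\<in>A. g u) = 0"
proof -
  have "(\<Sum>u\<in>A. g u) = (\<Sum>u\<in>A. g (s u))"
    by (rule sum.reindex_bij_witness[of _ s s]) (auto simp: assms)
  also have "\<dots> = - (\<Sum>u\<in>A. g u)"
    using assms(3) by (simp add: sum_negf)
  finally have "2 *\<^sub>R (\<Sum>u\<in>A. g u) = 0"
    by (simp only: scaleR_2 eq_neg_iff_add_eq_0)
  then show ?thesis by simp
qed

section \<open>Branches of a finite tree paired with an independent copy\<close>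

definition branches :: "nat \<Rightarrow> (nat \<Rightarrow> 'l::finite) set" where
  "branches m = PiE {..<m} (\<lambda>_. UNIV)"

lemma finite_branches [simp]: "finite (branches m)"
  unfolding branches_def by (intro finite_PiE) auto

lemma branches_upd: "x \<in> branches m \<Longrightarrow> n < m \<Longrightarrow> x(n := i) \<in> branches m"
  unfolding branches_def by (auto simp: PiE_def extensional_def)

definition branch_pairs :: "nat \<Rightarrow> ((nat \<Rightarrow> 'l::finite) \<times> (nat \<Rightarrow> 'l)) set" where
  "branch_pairs m = branches m \<times> branches m"

definition agree :: "nat \<Rightarrow> (nat \<Rightarrow> 'l) \<times> (nat \<Rightarrow> 'l) \<Rightarrow> (nat \<Rightarrow> 'l) \<times> (nat \<Rightarrow> 'l) \<Rightarrow> bool" where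
  "agree n u v \<longleftrightarrow> (\<forall>k<n. fst u k = fst v k \<and> snd u k = snd v k)"

lemma agree_path: "agree n u v \<Longrightarrow> k \<le> n \<Longrightarrow> node (fst u) k = node (fst v) k"
  by (rule path_cong) (auto simp: agree_def)

lemma agree_sym: "agree n u v \<Longrightarrow> agree n v u"
  by (auto simp: agree_def)

lemma sum_update_fst:
  fixes g :: "(nat \<Rightarrow> 'l::finite) \<times> (nat \<Rightarrow> 'l) \<Rightarrow> 'b::real_vector"
  assumes "A \<subseteq> branch_pairs m" and "\<And>x y i. (x, y) \<in> A \<Longrightarrow> (x(n := i), y) \<in> A"
    and "\<And>x y. (x, y) \<in> A \<Longrightarrow> (\<Sum>i\<in>UNIV. g (x(n := i), y)) = 0"
  shows "(\<Sum>u\<in>A. g u) = 0"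
proof (rule sum_eq_0_by_update[where upd="\<lambda>(x, y) i. (x(n := i), y)" and get="\<lambda>(x, y). x n"])
  show "finite A" using assms(1) by (rule finite_subset) (simp add: branch_pairs_def)
qed (use assms in auto)

lemma sum_update_snd:
  fixes g :: "(nat \<Rightarrow> 'l::finite) \<times> (nat \<Rightarrow> 'l) \<Rightarrow> 'b::real_vector"
  assumes "A \<subseteq> branch_pairs m" and "\<And>x y i. (x, y) \<in> A \<Longrightarrow> (x, y(n := i)) \<in> A"
    and "\<And>x y. (x, y) \<in> A \<Longrightarrow> (\<Sum>i\<in>UNIV. g (x, y(n := i))) = 0"
  shows "(\<Sum>u\<in>A. g u) = 0"
proof (rule sum_eq_0_by_update[where upd="\<lambda>(x, y) i. (x, y(n := i))" and get="\<lambda>(x, y). y n"])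
  show "finite A" using assms(1) by (rule finite_subset) (simp add: branch_pairs_def)
qed (use assms in auto)

lemma saturated_update_fst:
  assumes "saturated (branch_pairs m) R A" "(x, y) \<in> A" "n < m" "R (x, y) (x(n := i), y)"
  shows "(x(n := i), y) \<in> A"
  using assms unfolding saturated_def branch_pairs_def by (blast intro: branches_upd)

lemma saturated_update_snd:
  assumes "saturated (branch_pairs m) R A" "(x, y) \<in> A" "n < m" "R (x, y) (x, y(n := i))"
  shows "(x, y(n := i)) \<in> A"
  using assms unfolding saturated_def branch_pairs_def by (blast intro: branches_upd)

text \<open>Splitting \<open>h w (x n)\<close> into its symmetric and its antisymmetric part under \<open>x n \<leftrightarrow> y n\<close>
  gives two consecutive martingale differences: first the unordered pair is revealed, then its order.
  Flipping the sign of the antisymmetric part replaces \<open>x n\<close> by \<open>y n\<close>. Nodes outside \<open>\<theta>\<close> do not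
  reveal anything before the last of the three steps.\<close>

lemma decoupling:
  fixes h :: "'l::finite list \<Rightarrow> 'l \<Rightarrow> 'b::real_normed_vector" and \<theta> :: "'l list \<Rightarrow> bool"
  assumes U: "UMD_bound p X C" and p: "1 \<le> p" and X: "subspace X"
    and h: "\<And>w. (\<Sum>i\<in>UNIV. h w i) = 0" "\<And>w i. h w i \<in> X" and \<sigma>: "\<sigma> \<in> {-1, 1}"
  defines "a \<equiv> \<lambda>n u. (of_bool (\<theta> (node (fst u) n)) / 2) *\<^sub>R (h (node (fst u) n) (fst u n) + h (node (fst u) n) (snd u n))"
    and "b \<equiv> \<lambda>n u. (\<sigma> * of_bool (\<theta> (node (fst u) n)) / 2) *\<^sub>R (h (node (fst u) n) (fst u n) - h (node (fst u) n) (snd u n))"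
    and "c \<equiv> \<lambda>n u. (1 - of_bool (\<theta> (node (fst u) n))) *\<^sub>R h (node (fst u) n) (fst u n)"
  shows "(\<Sum>u\<in>branch_pairs m. norm (\<Sum>n<m. 1 *\<^sub>R a n u + (-1) *\<^sub>R b n u + 0 *\<^sub>R c n u) powr p)
    \<le> C powr p * (\<Sum>u\<in>branch_pairs m. norm (\<Sum>n<m. a n u + b n u + c n u) powr p)"
proof -
  define R1 where "R1 n u v \<longleftrightarrow> agree n u v \<and> (\<theta> (node (fst u) n) \<longrightarrow> {fst u n, snd u n} = {fst v n, snd v n})" for n u v
  define R2 where "R2 n u v \<longleftrightarrow> agree n u v \<and> (\<theta> (node (fst u) n) \<longrightarrow> fst u n = fst v n \<and> snd u n = snd v n)" for n u v
  show ?thesis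
  proof (rule UMD_bound_blocks[where R=agree and ?R1.0=R1 and ?R2.0=R2, OF U p])
    show "finite (branch_pairs m)" by (simp add: branch_pairs_def)
    show "agree n v u" if "agree n u v" for n u v using that by (rule agree_sym)
    show "R1 n v u" if "R1 n u v" for n u v
      using that agree_path[of n u v n] by (auto simp: R1_def agree_sym)
    show "R2 n v u" if "R2 n u v" for n u v
      using that agree_path[of n u v n] by (auto simp: R2_def agree_sym)
    show "agree n u v" if "R1 n u v" for n u v using that by (simp add: R1_def)
    show "R1 n u v" if "R2 n u v" for n u v using that by (simp add: R1_def R2_def)
    show "R2 n u v" if "agree (Suc n) u v" for n u v using that by (simp add: agree_def R2_def)
    show "a n u = a n v" if "R1 n u v" for n u v
      using that agree_path[of n u v n] by (auto simp: R1_def a_def doubleton_eq_iff add.commute)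
    show "b n u = b n v" if "R2 n u v" for n u v
      using that agree_path[of n u v n] by (auto simp: R2_def b_def)
    show "c n u = c n v" if "agree (Suc n) u v" for n u v
      using that agree_path[of "Suc n" u v n] by (auto simp: agree_def c_def)
  next
    fix n and A :: "((nat \<Rightarrow> 'l) \<times> (nat \<Rightarrow> 'l)) set" assume n: "n < m" and A: "saturated (branch_pairs m) (agree n) A"
    have sub: "A \<subseteq> branch_pairs m" using A by (simp add: saturated_def)
    have "(\<Sum>u\<in>A. (of_bool (\<theta> (node (fst u) n)) / 2) *\<^sub>R h (node (fst u) n) (fst u n)) = 0"
      by (rule sum_update_fst[OF sub, of n])
        (auto intro!: saturated_update_fst[OF A _ n] simp: agree_def scaleR_sum_right[symmetric] h)
    moreover have "(\<Sum>u\<in>A. (of_bool (\<theta> (node (fst u) n)) / 2) *\<^sub>R h (node (fst u) n) (snd u n)) = 0"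
      by (rule sum_update_snd[OF sub, of n])
        (auto intro!: saturated_update_snd[OF A _ n] simp: agree_def scaleR_sum_right[symmetric] h)
    ultimately show "(\<Sum>u\<in>A. a n u) = 0"
      by (simp add: a_def scaleR_add_right sum.distrib)
  next
    fix n and A :: "((nat \<Rightarrow> 'l) \<times> (nat \<Rightarrow> 'l)) set" assume n: "n < m" and A: "saturated (branch_pairs m) (R1 n) A"
    show "(\<Sum>u\<in>A. b n u) = 0"
    \<comment> \<open>Exchanging \<open>x n\<close> and \<open>y n\<close> is invisible to
      \<open>R1 n\<close>, hence maps \<open>A\<close> to itself, and it reverses the sign of
      \<open>b n\<close>.\<close>
    proof (rule sum_eq_0_by_involution[where s="\<lambda>(x, y). (x(n := y n), y(n := x n))"])
      fix u assume u: "u \<in> A"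
      obtain x y where [simp]: "u = (x, y)" by (cases u)
      have "(x, y) \<in> branch_pairs m" using A u by (auto simp: saturated_def)
      then have "(x(n := y n), y(n := x n)) \<in> branch_pairs m"
        using n by (auto simp: branch_pairs_def intro: branches_upd)
      moreover have "R1 n (x, y) (x(n := y n), y(n := x n))"
        by (auto simp: R1_def agree_def)
      ultimately show "(case u of (x, y) \<Rightarrow> (x(n := y n), y(n := x n))) \<in> A"
        using A u unfolding saturated_def by auto
      show "b n (case u of (x, y) \<Rightarrow> (x(n := y n), y(n := x n))) = - b n u"
        by (simp add: b_def flip: scaleR_minus_right)
    qed auto
  next
    fix n and A :: "((nat \<Rightarrow> 'l) \<times> (nat \<Rightarrow> 'l)) set" assume n: "n < m" and A: "saturated (branch_pairs m) (R2 n) A"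
    have fin: "finite A" using A by (auto simp: saturated_def branch_pairs_def intro: finite_subset)
    \<comment> \<open>At nodes in \<open>\<theta>\<close> the difference \<open>c n\<close> is 0. At
      the others \<open>R2 n\<close> has not revealed \<open>x n\<close>, so \<open>A'\<close> is
      closed under resampling it.\<close>
    define A' where "A' = {u\<in>A. \<not> \<theta> (node (fst u) n)}"
    have "(\<Sum>u\<in>A'. h (node (fst u) n) (fst u n)) = 0"
    proof (rule sum_update_fst[of _ m n])
      show "A' \<subseteq> branch_pairs m" using A by (auto simp: saturated_def A'_def)
      show "(x(n := i), y) \<in> A'" if "(x, y) \<in> A'" for x y i
        using that saturated_update_fst[OF A _ n, of x y i] by (auto simp: A'_def R2_def agree_def)
    qed (simp add: h)
    moreover have "(\<Sum>u\<in>A. c n u) = (\<Sum>u\<in>A'. h (node (fst u) n) (fst u n))"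
      using fin by (intro sum.mono_neutral_cong_right) (auto simp: A'_def c_def)
    ultimately show "(\<Sum>u\<in>A. c n u) = 0" by simp
  next
    show "a n u \<in> X" "b n u \<in> X" "c n u \<in> X" for n u
      unfolding a_def b_def c_def using h(2) X
      by (auto intro!: subspace_scale subspace_add subspace_diff intro: subspace_0)
  qed auto
qed

text \<open>With \<open>\<sigma> = -1\<close> and \<open>\<theta>\<close> true everywhere,
  \<open>a + b\<close> is the increment at \<open>y n\<close> and \<open>a - b\<close> the increment
  at \<open>x n\<close>.\<close>

lemma decoupling_le:
  fixes h :: "'l::finite list \<Rightarrow> 'l \<Rightarrow> 'b::real_normed_vector"
  assumes "UMD_bound p X C" "1 \<le> p" "subspace X" "\<And>w. (\<Sum>i\<in>UNIV. h w i) = 0" "\<And>w i. h w i \<in> X"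
  shows "(\<Sum>(x, y)\<in>branch_pairs m. norm (\<Sum>n<m. h (node x n) (x n)) powr p)
    \<le> C powr p * (\<Sum>(x, y)\<in>branch_pairs m. norm (\<Sum>n<m. h (node x n) (y n)) powr p)"
  using decoupling[OF assms, where \<sigma>="-1" and \<theta>="\<lambda>_. True" and m=m]
  by (simp add: case_prod_unfold scaleR_add_right scaleR_diff_right flip: scaleR_add_left)

text \<open>With \<open>\<sigma> = 1\<close>, \<open>a + b + c\<close> is the increment at
  \<open>x n\<close> and \<open>a - b\<close> the increment at \<open>y n\<close> restricted to
  \<open>\<theta>\<close>. The multiplier 0 on \<open>c\<close> discards the other nodes, so
  decoupling and selection together cost a single constant.\<close>

lemma decoupling_ge:
  fixes h :: "'l::finite list \<Rightarrow> 'l \<Rightarrow> 'b::real_normed_vector"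
  assumes "UMD_bound p X C" "1 \<le> p" "subspace X" "\<And>w. (\<Sum>i\<in>UNIV. h w i) = 0" "\<And>w i. h w i \<in> X"
  shows "(\<Sum>(x, y)\<in>branch_pairs m. norm (\<Sum>n<m. of_bool (\<theta> (node x n)) *\<^sub>R h (node x n) (y n)) powr p)
    \<le> C powr p * (\<Sum>(x, y)\<in>branch_pairs m. norm (\<Sum>n<m. h (node x n) (x n)) powr p)"
proof -
  have 1: "1 *\<^sub>R (of_bool t / 2) *\<^sub>R (u + v) + (- 1) *\<^sub>R (1 * of_bool t / 2) *\<^sub>R (u - v) + 0 *\<^sub>R w = of_bool t *\<^sub>R v"
    for t and u v w :: 'b
    by (simp add: scaleR_add_right scaleR_diff_right flip: scaleR_add_left)
  have 2: "(of_bool t / 2) *\<^sub>R (u + v) + (1 * of_bool t / 2) *\<^sub>R (u - v) + (1 - of_bool t) *\<^sub>R u = u"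
    for t and u v :: 'b
    by (simp add: scaleR_add_right scaleR_diff_right flip: scaleR_add_left)
  show ?thesis
    using decoupling[OF assms, where \<sigma>=1 and \<theta>=\<theta> and m=m] unfolding 1 2 by (simp add: case_prod_unfold)
qed

text \<open>Stein's inequality: for \<open>F = (\<Sum>n<m. c n) (\<psi> (node x m))\<close>, with \<open>c n\<close> a function of \<open>y n\<close>,
  the sum on the left collects the martingale differences of \<open>F\<close> in which \<open>y n\<close> is revealed.\<close>

lemma Stein_branches:
  fixes h :: "'l::finite list \<Rightarrow> 'l \<Rightarrow> 'e::real_normed_vector \<Rightarrow>\<^sub>L 'e" and \<psi> :: "'l list \<Rightarrow> 'e"
  assumes U: "UMD_bound p (UNIV :: 'e set) C" and p: "1 \<le> p"
    and h: "\<And>w. (\<Sum>i\<in>UNIV. h w i) = 0" and \<psi>: "\<And>w. (\<Sum>i\<in>UNIV. \<psi> (i # w)) = real CARD('l) *\<^sub>R \<psi> w"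
  shows "(\<Sum>(x, y)\<in>branch_pairs m. norm (\<Sum>n<m. h (node x n) (y n) (\<psi> (node x n))) powr p)
    \<le> C powr p * (\<Sum>(x, y)\<in>branch_pairs m. norm ((\<Sum>n<m. h (node x n) (y n)) (\<psi> (node x m))) powr p)"
proof -
  define a where "a n u = blinfun_apply (h (node (fst u) n) (snd u n)) (\<psi> (node (fst u) n))" for n and u :: "(nat \<Rightarrow> 'l) \<times> (nat \<Rightarrow> 'l)"
  \<comment> \<open>Product rule: \<open>a n + b n\<close> is the increment, from \<open>n\<close>
    to \<open>Suc n\<close>, of the accumulated operator applied to the current value of
    \<open>\<psi>\<close>. The part \<open>a n\<close> has mean zero in \<open>y n\<close>, the part
    \<open>b n\<close> in \<open>x n\<close>.\<close>
  define b where "b n u = blinfun_apply (\<Sum>j\<le>n. h (node (fst u) j) (snd u j)) (\<psi> (node (fst u) (Suc n)) - \<psi> (node (fst u) n))"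
    for n and u :: "(nat \<Rightarrow> 'l) \<times> (nat \<Rightarrow> 'l)"
  define c where "c n u = (0::'e)" for n :: nat and u :: "(nat \<Rightarrow> 'l) \<times> (nat \<Rightarrow> 'l)"
  \<comment> \<open>Here \<open>y n\<close> is revealed before \<open>x n\<close>, so that
    \<open>a n\<close> is known while the next value of \<open>\<psi>\<close> is still
    random.\<close>
  define R1 where "R1 n u v \<longleftrightarrow> agree n u v \<and> snd u n = snd v n" for n and u v :: "(nat \<Rightarrow> 'l) \<times> (nat \<Rightarrow> 'l)"
  have "(\<Sum>u\<in>branch_pairs m. norm (\<Sum>n<m. 1 *\<^sub>R a n u + 0 *\<^sub>R b n u + 0 *\<^sub>R c n u) powr p)
    \<le> C powr p * (\<Sum>u\<in>branch_pairs m. norm (\<Sum>n<m. a n u + b n u + c n u) powr p)"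
  proof (rule UMD_bound_blocks[where R=agree and ?R1.0=R1 and ?R2.0="\<lambda>n. agree (Suc n)", OF U p])
    show "finite (branch_pairs m)" by (simp add: branch_pairs_def)
    show "agree n v u" if "agree n u v" for n u v using that by (rule agree_sym)
    show "agree (Suc n) v u" if "agree (Suc n) u v" for n u v using that by (rule agree_sym)
    show "R1 n v u" if "R1 n u v" for n u v using that by (auto simp: R1_def agree_sym)
    show "agree n u v" if "R1 n u v" for n u v using that by (simp add: R1_def)
    show "R1 n u v" if "agree (Suc n) u v" for n u v using that by (simp add: R1_def agree_def)
    show "a n u = a n v" if "R1 n u v" for n u v
      using that agree_path[of n u v n] by (auto simp: R1_def a_def)
    show "b n u = b n v" if R: "agree (Suc n) u v" for n u v
    proof -
      have "node (fst u) j = node (fst v) j" if "j \<le> Suc n" for j using agree_path[OF R that] .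
      moreover have "snd u j = snd v j" if "j \<le> n" for j using R that by (simp add: agree_def)
      ultimately show ?thesis unfolding b_def by (simp del: node.simps)
    qed
    show "c n u = c n v" for n u v by (simp add: c_def)
  next
    fix n and A :: "((nat \<Rightarrow> 'l) \<times> (nat \<Rightarrow> 'l)) set" assume n: "n < m" and A: "saturated (branch_pairs m) (agree n) A"
    show "(\<Sum>u\<in>A. a n u) = 0"
    proof (rule sum_update_snd[of _ m n])
      show "A \<subseteq> branch_pairs m" using A by (simp add: saturated_def)
      show "(x, y(n := i)) \<in> A" if "(x, y) \<in> A" for x y i
        using that by (auto intro!: saturated_update_snd[OF A _ n] simp: agree_def)
      show "(\<Sum>i\<in>UNIV. a n (x, y(n := i))) = 0" for x y
        using h by (simp add: a_def flip: blinfun.sum_left)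
    qed
  next
    fix n and A :: "((nat \<Rightarrow> 'l) \<times> (nat \<Rightarrow> 'l)) set" assume n: "n < m" and A: "saturated (branch_pairs m) (R1 n) A"
    show "(\<Sum>u\<in>A. b n u) = 0"
    proof (rule sum_update_fst[of _ m n])
      show "A \<subseteq> branch_pairs m" using A by (simp add: saturated_def)
      show "(x(n := i), y) \<in> A" if "(x, y) \<in> A" for x y i
        using that by (auto intro!: saturated_update_fst[OF A _ n] simp: agree_def R1_def)
      show "(\<Sum>i\<in>UNIV. b n (x(n := i), y)) = 0" for x y
        using \<psi> by (simp add: b_def sum_subtractf sum_constant_scaleR flip: blinfun.sum_right)
    qed
  qed (auto simp: c_def)
  moreover have "(\<Sum>n<m. a n u + b n u + c n u) = (\<Sum>n<m. h (node (fst u) n) (snd u n)) (\<psi> (node (fst u) m))" for u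
    unfolding c_def
  proof (induction m)
    case (Suc m)
    have "(\<Sum>j\<le>m. h (node (fst u) j) (snd u j)) = (\<Sum>j<m. h (node (fst u) j) (snd u j)) + h (node (fst u) m) (snd u m)"
      by (simp flip: lessThan_Suc_atMost)
    then have "b m u = ((\<Sum>j<m. h (node (fst u) j) (snd u j)) + h (node (fst u) m) (snd u m))
        (\<psi> (node (fst u) (Suc m)) - \<psi> (node (fst u) m))"
      by (simp only: b_def)
    with Suc show ?case
      by (simp add: a_def blinfun.diff_right blinfun.add_left del: node.simps)
  qed simp
  ultimately show ?thesis by (simp add: a_def case_prod_unfold)
qed

lemma sum_branch_pairs_fst:
  fixes g :: "(nat \<Rightarrow> 'l::finite) \<Rightarrow> real"
  shows "(\<Sum>(x, y)\<in>branch_pairs m. g x) = real (card (branches m :: (nat \<Rightarrow> 'l) set)) * (\<Sum>x\<in>branches m. g x)"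
  unfolding branch_pairs_def by (simp add: sum.cartesian_product[symmetric] sum_distrib_left)

lemma sum_path_telescope:
  fixes \<beta> :: "'l list \<Rightarrow> 'b::ab_group_add"
  shows "(\<Sum>n<m. \<beta> (x n # node x n) - \<beta> (node x n)) = \<beta> (node x m) - \<beta> []"
  by (induction m) auto

text \<open>Each constant enters once: \<open>C\<close> for decoupling in the vector space,
  \<open>C\<close> for Stein's inequality, \<open>C'\<close> for undoing the decoupling among the
  operators. The increments \<open>k\<close> keep the selection \<open>\<theta>\<close> through the
  first two stages; the last one drops it. In between, \<open>\<psi> (node x m)\<close> is a single
  vector of norm at most \<open>L\<close> and can be taken out pointwise.\<close>

lemma local_paraproduct_bound:
  fixes \<beta> :: "'l::finite list \<Rightarrow> 'e::real_normed_vector \<Rightarrow>\<^sub>L 'e" and \<psi> :: "'l list \<Rightarrow> 'e"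
  assumes UE: "UMD_bound p (UNIV :: 'e set) C" and UT: "UMD_bound p T C'" and p: "1 \<le> p" and T: "subspace T"
    and \<beta>: "\<And>w. (\<Sum>i\<in>UNIV. \<beta> (i # w)) = real CARD('l) *\<^sub>R \<beta> w" "\<And>w. \<beta> w \<in> T"
    and \<psi>: "\<And>w. (\<Sum>i\<in>UNIV. \<psi> (i # w)) = real CARD('l) *\<^sub>R \<psi> w" "\<And>w. norm (\<psi> w) \<le> L"
  shows "(\<Sum>x\<in>branches m. norm (\<Sum>n<m. of_bool (\<theta> (node x n)) *\<^sub>R (\<beta> (node x (Suc n)) - \<beta> (node x n)) (\<psi> (node x n))) powr p)
    \<le> (C\<^sup>2 * C' * L) powr p * (\<Sum>x\<in>branches m. norm (\<beta> (node x m) - \<beta> []) powr p)"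
proof -
  have C: "0 \<le> C" "0 \<le> C'" using UE UT by (auto simp: UMD_bound_def)
  have L: "0 \<le> L" using \<psi>(2)[of "[]"] norm_ge_zero[of "\<psi> []"] by linarith
  define h where "h w i = \<beta> (i # w) - \<beta> w" for w i
  define k where "k w i = of_bool (\<theta> w) *\<^sub>R h w i" for w i
  define g where "g w i = blinfun_apply (k w i) (\<psi> w)" for w i
  have h0: "(\<Sum>i\<in>UNIV. h w i) = 0" for w
    using \<beta>(1) by (simp add: h_def sum_subtractf sum_constant_scaleR)
  have k0: "(\<Sum>i\<in>UNIV. k w i) = 0" for w
    using h0 by (simp add: k_def flip: scaleR_sum_right)
  have g0: "(\<Sum>i\<in>UNIV. g w i) = 0" for w
    using k0 by (simp add: g_def flip: blinfun.sum_left)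
  have hT: "h w i \<in> T" for w i
    using \<beta>(2) T by (simp add: h_def subspace_diff)
  let ?B = "branch_pairs m :: ((nat \<Rightarrow> 'l) \<times> (nat \<Rightarrow> 'l)) set"
  have "(\<Sum>(x, y)\<in>?B. norm (\<Sum>n<m. g (node x n) (x n)) powr p)
      \<le> C powr p * (\<Sum>(x, y)\<in>?B. norm (\<Sum>n<m. g (node x n) (y n)) powr p)"
    by (rule decoupling_le[OF UE p _ g0]) auto
  also have "\<dots> \<le> C powr p * (C powr p * (\<Sum>(x, y)\<in>?B. norm ((\<Sum>n<m. k (node x n) (y n)) (\<psi> (node x m))) powr p))"
    unfolding g_def by (intro mult_left_mono Stein_branches[OF UE p k0 \<psi>(1)]) auto
  also have "\<dots> \<le> C powr p * (C powr p * (\<Sum>(x, y)\<in>?B. L powr p * norm (\<Sum>n<m. k (node x n) (y n)) powr p))"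
  proof (intro mult_left_mono sum_mono, clarify)
    fix x y :: "nat \<Rightarrow> 'l"
    have "norm ((\<Sum>n<m. k (node x n) (y n)) (\<psi> (node x m))) \<le> norm (\<Sum>n<m. k (node x n) (y n)) * norm (\<psi> (node x m))"
      by (rule norm_blinfun)
    also have "\<dots> \<le> norm (\<Sum>n<m. k (node x n) (y n)) * L"
      by (intro mult_left_mono \<psi>(2)) auto
    finally have "norm ((\<Sum>n<m. k (node x n) (y n)) (\<psi> (node x m))) powr p \<le> (norm (\<Sum>n<m. k (node x n) (y n)) * L) powr p"
      using p by (intro powr_mono2) auto
    then show "norm ((\<Sum>n<m. k (node x n) (y n)) (\<psi> (node x m))) powr p \<le> L powr p * norm (\<Sum>n<m. k (node x n) (y n)) powr p"
      using L by (simp add: powr_mult mult.commute)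
  qed auto
  also have "(\<Sum>(x, y)\<in>?B. L powr p * norm (\<Sum>n<m. k (node x n) (y n)) powr p)
      = L powr p * (\<Sum>(x, y)\<in>?B. norm (\<Sum>n<m. of_bool (\<theta> (node x n)) *\<^sub>R h (node x n) (y n)) powr p)"
    by (simp add: sum_distrib_left case_prod_unfold k_def)
  also have "C powr p * (C powr p * (L powr p * (\<Sum>(x, y)\<in>?B. norm (\<Sum>n<m. of_bool (\<theta> (node x n)) *\<^sub>R h (node x n) (y n)) powr p)))
      \<le> C powr p * (C powr p * (L powr p * (C' powr p * (\<Sum>(x, y)\<in>?B. norm (\<Sum>n<m. h (node x n) (x n)) powr p))))"
    by (intro mult_left_mono decoupling_ge[OF UT p T h0 hT]) auto
  also have "\<dots> = (C\<^sup>2 * C' * L) powr p * (\<Sum>(x, y)\<in>?B. norm (\<Sum>n<m. h (node x n) (x n)) powr p)"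
    using C L by (simp add: powr_mult power2_eq_square mult_ac)
  finally have "(\<Sum>(x, y)\<in>?B. norm (\<Sum>n<m. g (node x n) (x n)) powr p)
      \<le> (C\<^sup>2 * C' * L) powr p * (\<Sum>(x, y)\<in>?B. norm (\<Sum>n<m. h (node x n) (x n)) powr p)" .
  \<comment> \<open>Both sides depend on \<open>x\<close> alone, so summation over the copy
    \<open>y\<close> is a common factor, and it is positive.\<close>
  moreover have "branches m \<noteq> ({} :: (nat \<Rightarrow> 'l) set)"
    unfolding branches_def by (auto simp: PiE_eq_empty_iff)
  then have "0 < real (card (branches m :: (nat \<Rightarrow> 'l) set))"
    by (simp add: card_gt_0_iff)
  ultimately have "(\<Sum>x\<in>branches m. norm (\<Sum>n<m. g (node x n) (x n)) powr p)
      \<le> (C\<^sup>2 * C' * L) powr p * (\<Sum>x\<in>branches m. norm (\<Sum>n<m. h (node x n) (x n)) powr p)"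
    unfolding sum_branch_pairs_fst by (simp add: mult.left_commute)
  then show ?thesis
    unfolding g_def k_def h_def sum_path_telescope by (simp add: scaleR_blinfun.rep_eq)
qed

section \<open>Paraproducts on a tree\<close>

definition words :: "nat \<Rightarrow> 'l::finite list set" where
  "words m = {w. length w = m}"

lemma words_0 [simp]: "words 0 = {[]}"
  by (auto simp: words_def)

lemma finite_words [simp]: "finite (words m :: 'l::finite list set)"
  using finite_lists_length_eq[of "UNIV :: 'l set" m] by (simp add: words_def)

lemma sum_words_Cons: "(\<Sum>w\<in>words (Suc m). f w) = (\<Sum>w\<in>words m. \<Sum>i\<in>UNIV. f (i # w))"
  unfolding sum.cartesian_product
  by (rule sum.reindex_bij_witness[of _ "\<lambda>(w, i). i # w" "\<lambda>w. (tl w, hd w)"])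
    (auto simp: words_def length_Suc_conv)

lemma sum_words_snoc: "(\<Sum>w\<in>words (Suc m). f w) = (\<Sum>i\<in>UNIV. \<Sum>w\<in>words m. f (w @ [i]))"
  unfolding sum.cartesian_product
  by (rule sum.reindex_bij_witness[of _ "\<lambda>(i, w). w @ [i]" "\<lambda>w. (last w, butlast w)"])
    (auto simp: words_def length_Suc_conv_rev)

lemma sum_branches_words: "(\<Sum>x\<in>branches m. f (node x m)) = (\<Sum>w\<in>words m. f w)"
proof (induction m arbitrary: f)
  case 0
  then show ?case by (simp add: branches_def)
next
  case (Suc m)
  have "(\<Sum>x\<in>branches (Suc m). f (node x (Suc m))) = (\<Sum>(x, i)\<in>branches m \<times> UNIV. f (i # node x m))"
    by (rule sum.reindex_bij_witness[of _ "\<lambda>(x, i). x(m := i)" "\<lambda>x. (x(m := undefined), x m)"])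
      (auto simp: branches_def PiE_def extensional_def)
  also have "\<dots> = (\<Sum>x\<in>branches m. \<Sum>i\<in>UNIV. f (i # node x m))"
    by (simp add: sum.cartesian_product)
  also have "\<dots> = (\<Sum>w\<in>words (Suc m). f w)"
    unfolding sum_words_Cons by (rule Suc)
  finally show ?case .
qed

definition martingale :: "('l::finite list \<Rightarrow> 'b::real_vector) \<Rightarrow> bool" where
  "martingale h \<longleftrightarrow> (\<forall>w. (\<Sum>i\<in>UNIV. h (i # w)) = real CARD('l) *\<^sub>R h w)"

lemma martingaleD: "martingale (h :: 'l::finite list \<Rightarrow> 'b::real_vector) \<Longrightarrow> (\<Sum>i\<in>UNIV. h (i # w)) = real CARD('l) *\<^sub>R h w"
  by (simp add: martingale_def)

text \<open>The paraproduct as a function on the tree: the value at a node collects the terms of all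
  its proper ancestors satisfying \<open>\<theta>\<close>.\<close>

primrec para :: "('l list \<Rightarrow> bool) \<Rightarrow> ('l list \<Rightarrow> 'e::real_normed_vector \<Rightarrow>\<^sub>L 'e) \<Rightarrow> ('l list \<Rightarrow> 'e) \<Rightarrow> 'l list \<Rightarrow> 'e" where
  "para \<theta> \<beta> \<phi> [] = 0"
| "para \<theta> \<beta> \<phi> (i # w) = para \<theta> \<beta> \<phi> w + of_bool (\<theta> w) *\<^sub>R (\<beta> (i # w) - \<beta> w) (\<phi> w)"

lemma para_node: "para \<theta> \<beta> \<phi> (node x m) =
    (\<Sum>n<m. of_bool (\<theta> (node x n)) *\<^sub>R (\<beta> (node x (Suc n)) - \<beta> (node x n)) (\<phi> (node x n)))"
  by (induction m) auto

lemma local_para_bound: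
  fixes \<beta> :: "'l::finite list \<Rightarrow> 'e::real_normed_vector \<Rightarrow>\<^sub>L 'e" and \<psi> :: "'l list \<Rightarrow> 'e"
  assumes "UMD_bound p (UNIV :: 'e set) C" "UMD_bound p T C'" "1 \<le> p" "subspace T"
    "martingale \<beta>" "\<And>w. \<beta> w \<in> T" "martingale \<psi>" "\<And>w. norm (\<psi> w) \<le> L"
  shows "(\<Sum>w\<in>words m. norm (para \<theta> \<beta> \<psi> w) powr p)
    \<le> (C\<^sup>2 * C' * L) powr p * (\<Sum>w\<in>words m. norm (\<beta> w - \<beta> []) powr p)"
  using local_paraproduct_bound[OF assms(1-4) martingaleD[OF assms(5)] assms(6) martingaleD[OF assms(7)] assms(8), where m=m and \<theta>=\<theta>]
  unfolding para_node[symmetric] sum_branches_words[of "\<lambda>w. norm (para \<theta> \<beta> \<psi> w) powr p"]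
    sum_branches_words[of "\<lambda>w. norm (\<beta> w - \<beta> []) powr p"] .

section \<open>Carleson embedding on the tree\<close>

primrec mean :: "('l::finite list \<Rightarrow> real) \<Rightarrow> nat \<Rightarrow> 'l list \<Rightarrow> real" where
  "mean h 0 w = h w"
| "mean h (Suc k) w = (\<Sum>i\<in>UNIV. mean h k (i # w)) / real CARD('l)"

text \<open>For the indicator of a family of nodes this is the normalised Carleson mass: the total
  measure of the members in generations 0 to \<open>k\<close> below \<open>w\<close>, relative to
  the measure of \<open>w\<close>.\<close>

primrec acc :: "('l::finite list \<Rightarrow> real) \<Rightarrow> nat \<Rightarrow> 'l list \<Rightarrow> real" where
  "acc h 0 w = h w"
| "acc h (Suc k) w = h w + (\<Sum>i\<in>UNIV. acc h k (i # w)) / real CARD('l)"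

lemma mean_nonneg: "(\<And>w. 0 \<le> h w) \<Longrightarrow> 0 \<le> mean h k w"
  by (induction k arbitrary: w) (auto intro!: sum_nonneg divide_nonneg_nonneg)

lemma mean_eq: "mean (h :: 'l::finite list \<Rightarrow> real) k w = (\<Sum>u\<in>words k. h (u @ w)) / real CARD('l) ^ k"
proof (induction k arbitrary: w)
  case (Suc k)
  then show ?case
    by (simp add: sum_words_snoc sum_divide_distrib[symmetric])
qed simp

lemma acc_eq: "acc (h :: 'l::finite list \<Rightarrow> real) k w = (\<Sum>j\<le>k. mean h j w)"
proof (induction k arbitrary: w)
  case (Suc k)
  then show ?case
    unfolding sum.atMost_Suc_shift
    by (simp add: sum.swap[of "\<lambda>i j. mean h j (i # w)" "{..k}" UNIV] flip: sum_divide_distrib)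
qed simp

primrec psum :: "('l list \<Rightarrow> real) \<Rightarrow> 'l list \<Rightarrow> real" where
  "psum h [] = h []"
| "psum h (i # w) = psum h w + h (i # w)"

text \<open>A node at depth j lies above N^(m-j) of the N^m leaves, which is its relative measure
  times N^m.\<close>

lemma sum_words_psum: "(\<Sum>w\<in>words m. psum h w) = real CARD('l) ^ m * acc (h :: 'l::finite list \<Rightarrow> real) m []"
proof (induction m)
  case (Suc m)
  have "(\<Sum>w\<in>words (Suc m). psum h w) = real CARD('l) * (\<Sum>w\<in>words m. psum h w) + (\<Sum>w\<in>words (Suc m). h w)"
    unfolding sum_words_Cons by (simp add: sum.distrib sum_distrib_left)
  also have "\<dots> = real CARD('l) ^ Suc m * (acc h m [] + mean h (Suc m) [])"
    unfolding Suc mean_eq by (simp add: algebra_simps)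
  also have "acc h m [] + mean h (Suc m) [] = acc h (Suc m) []"
    unfolding acc_eq by simp
  finally show ?case .
qed simp

text \<open>Supporting plane of the jointly convex function t^q L^(1-q). By homogeneity it depends
  only on the ratio \<open>r\<close> at the contact point, and it is the tangent inequality for t /
  L multiplied by \<open>L\<close>.\<close>

lemma powr_perspective_tangent:
  fixes r t L q :: real
  assumes "0 \<le> r" "0 \<le> t" "0 < L" "1 < q"
  shows "q * r powr (q - 1) * t - (q - 1) * r powr q * L \<le> t powr q * L powr (1 - q)"
proof -
  have "q * r powr (q - 1) * (t / L) \<le> (t / L) powr q + (q - 1) * r powr q"
    using assms by (intro powr_tangent_le) auto
  then have "(q * r powr (q - 1) * (t / L)) * L \<le> ((t / L) powr q + (q - 1) * r powr q) * L"
    using assms by (intro mult_right_mono) auto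
  also have "\<dots> = t powr q * L powr (1 - q) + (q - 1) * r powr q * L"
    using assms by (simp add: powr_divide powr_diff field_simps)
  finally show ?thesis using assms by simp
qed

text \<open>Bellman function of the dyadic Carleson embedding theorem:
  \<open>2 q'\<^sup>q (G - g\<^sup>q L\<^sup>1\<^sup>-\<^sup>q)\<close>, where \<open>L\<close> is affine in the Carleson mass. Convexity of
  \<open>(g, L) \<mapsto> g\<^sup>q L\<^sup>1\<^sup>-\<^sup>q\<close> handles the averaging, and \<open>L \<le> q'\<close> handles the mass added at a node.\<close>

lemma Carleson_embedding_gain:
  fixes L q :: real
  assumes q: "1 < q" and L: "1 \<le> L" "L + 1 / (2 * (q - 1)) \<le> q / (q - 1)"
  shows "1 \<le> 2 * (q / (q - 1)) powr q * (L powr (1 - q) - (L + 1 / (2 * (q - 1))) powr (1 - q))"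
proof -
  define M where "M = L + 1 / (2 * (q - 1))"
  have M: "0 < M" using L q by (simp add: M_def add_pos_pos)
  \<comment> \<open>This is the tangent at \<open>M\<close> of the convex function L^(1-q), read off
    from the perspective with t = 1 and r = 1 / M.\<close>
  have "q * (1 / M) powr (q - 1) * 1 - (q - 1) * (1 / M) powr q * L \<le> 1 powr q * L powr (1 - q)"
    using q L M by (intro powr_perspective_tangent) auto
  moreover have "(1 / M) powr (q - 1) = M powr (1 - q)"
    using M by (simp add: powr_divide powr_diff)
  moreover have "(q - 1) * (1 / M) powr q * L = (q - 1) * M powr (1 - q) - (1 / M) powr q / 2"
  proof -
    have MM: "(1 / M) powr q * M = M powr (1 - q)"
      using M by (simp add: powr_divide powr_diff)
    have "(q - 1) * L = (q - 1) * M - 1 / 2"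
      using q by (simp add: M_def field_simps)
    then have "(q - 1) * L * (1 / M) powr q = ((q - 1) * M - 1 / 2) * (1 / M) powr q"
      by (simp only:)
    also have "\<dots> = (q - 1) * ((1 / M) powr q * M) - (1 / M) powr q / 2"
      by (simp add: algebra_simps)
    finally have "(q - 1) * L * (1 / M) powr q = (q - 1) * ((1 / M) powr q * M) - (1 / M) powr q / 2" .
    then show ?thesis unfolding MM by (simp add: mult_ac)
  qed
  ultimately have *: "M powr (1 - q) + (1 / M) powr q / 2 \<le> L powr (1 - q)"
    by (simp add: algebra_simps)
  \<comment> \<open>The gain is at least half of M^(-q), and M is at most q'. This is where the
    factor 2 q'^q of the Bellman function is determined.\<close>
  have "(1 / (q / (q - 1))) powr q \<le> (1 / M) powr q"
    using L(2) M q by (intro powr_mono2 divide_left_mono mult_pos_pos) (auto simp: M_def)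
  then have "1 / (q / (q - 1)) powr q \<le> (1 / M) powr q"
    using q by (simp add: powr_divide)
  then have "1 \<le> (q / (q - 1)) powr q * (1 / M) powr q"
    using q by (simp add: divide_le_eq mult.commute)
  also have "\<dots> \<le> (q / (q - 1)) powr q * (2 * (L powr (1 - q) - M powr (1 - q)))"
    using * by (intro mult_left_mono) auto
  finally show ?thesis by (simp only: M_def mult_ac)
qed

text \<open>Induction from the leaves towards the root. Averaging over the children is paid for by
  convexity, the mass at the node itself by \<open>Carleson_embedding_gain\<close>. Since the
  Carleson mass lies between 0 and 2, the slope 1 / (2 (q - 1)) keeps \<open>L\<close> between 1 and
  q'. The bound \<open>m\<close> on the depth is the range in which \<open>g\<close> is a
  martingale.\<close>

lemma Carleson_embedding_Bellman:
  fixes g :: "'l::finite list \<Rightarrow> real" and \<kappa> :: "'l list \<Rightarrow> bool"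
  assumes q: "1 < q" and g: "\<And>w. 0 \<le> g w" "\<And>w. length w < m \<Longrightarrow> (\<Sum>i\<in>UNIV. g (i # w)) = real CARD('l) * g w"
    and packing: "\<And>k w. acc (\<lambda>w. of_bool (\<kappa> w)) k w \<le> 2"
  shows "k + length w \<le> m \<Longrightarrow> acc (\<lambda>w. of_bool (\<kappa> w) * g w powr q) k w
    \<le> 2 * (q / (q - 1)) powr q * (mean (\<lambda>w. g w powr q) k w
        - g w powr q * (1 + acc (\<lambda>w. of_bool (\<kappa> w)) k w / (2 * (q - 1))) powr (1 - q))"
proof (induction k arbitrary: w)
  let ?Q = "2 * (q / (q - 1)) powr q"
  define c where "c = acc (\<lambda>w. of_bool (\<kappa> w))"
  define L where "L k w = 1 + c k w / (2 * (q - 1))" for k w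
  have c0: "0 \<le> c k w" for k w
    unfolding c_def by (induction k arbitrary: w) (auto intro!: add_nonneg_nonneg sum_nonneg divide_nonneg_nonneg)
  have L1: "1 \<le> L k w" for k w using c0 q by (simp add: L_def)
  have gain: "of_bool b * y \<le> ?Q * (y * M powr (1 - q) - y * (M + of_bool b / (2 * (q - 1))) powr (1 - q))"
    if "1 \<le> M" "M + of_bool b / (2 * (q - 1)) \<le> q / (q - 1)" "0 \<le> y" for b M y
  proof (cases b)
    case True
    have "y * 1 \<le> y * (?Q * (M powr (1 - q) - (M + 1 / (2 * (q - 1))) powr (1 - q)))"
      using that True by (intro mult_left_mono Carleson_embedding_gain[OF q]) auto
    then show ?thesis using True by (simp add: algebra_simps)
  qed simp
  have Lle: "L k w \<le> q / (q - 1)" for k w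
  proof -
    have "L k w \<le> 1 + 2 / (2 * (q - 1))"
      unfolding L_def c_def using packing[of k w] q by (intro add_left_mono divide_right_mono) auto
    also have "\<dots> = q / (q - 1)" using q by (simp add: field_simps)
    finally show ?thesis .
  qed
  {
    case 0
    show ?case
      using gain[of 1 "\<kappa> w" "g w powr q"] Lle[of 0 w] by (simp add: L_def c_def)
  next
    case (Suc k)
    let ?N = "real CARD('l)"
    let ?f = "acc (\<lambda>w. of_bool (\<kappa> w) * g w powr q)" and ?G = "mean (\<lambda>w. g w powr q)"
    define M where "M = (\<Sum>i\<in>UNIV. L k (i # w)) / ?N"
    have N: "0 < ?N" by simp
    have M_eq: "M = 1 + (\<Sum>i\<in>UNIV. c k (i # w)) / ?N / (2 * (q - 1))"
      using N q by (simp add: M_def L_def sum.distrib sum_divide_distrib add_divide_distrib mult.commute)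
    have LM: "L (Suc k) w = M + of_bool (\<kappa> w) / (2 * (q - 1))"
      unfolding L_def M_eq by (simp add: c_def add_divide_distrib)
    have M1: "1 \<le> M"
      unfolding M_eq using c0 q by (simp add: sum_nonneg)
    \<comment> \<open>At \<open>(g w, M)\<close>, the average of the pairs at the children, the
      plane with ratio \<open>r\<close> touches the perspective function, so averaging its values at
      the children gives convexity at the parent.\<close>
    define r where "r = g w / M"
    have r: "0 \<le> r" using g(1) M1 by (simp add: r_def)
    have gM: "g w = r * M" using M1 by (simp add: r_def)
    have "g w powr q * M powr (1 - q) = r powr q * M"
      using r M1 unfolding gM by (simp add: powr_mult powr_diff)
    also have "\<dots> = q * (r powr (q - 1) * r) * M - (q - 1) * r powr q * M"
      using r powr_mult_base[of r "q - 1"] by (simp add: algebra_simps)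
    also have "\<dots> = q * r powr (q - 1) * g w - (q - 1) * r powr q * M"
      unfolding gM by simp
    also have "\<dots> = (\<Sum>i\<in>UNIV. q * r powr (q - 1) * g (i # w) - (q - 1) * r powr q * L k (i # w)) / ?N"
      using g(2)[of w] Suc.prems N
      by (simp add: sum_subtractf sum_distrib_left[symmetric] M_def diff_divide_distrib)
    also have "\<dots> \<le> (\<Sum>i\<in>UNIV. g (i # w) powr q * L k (i # w) powr (1 - q)) / ?N"
    proof (intro divide_right_mono sum_mono powr_perspective_tangent)
      show "0 < L k (i # w)" for i using L1[of k "i # w"] by simp
    qed (use r g q in auto)
    finally have conv: "g w powr q * M powr (1 - q) \<le> (\<Sum>i\<in>UNIV. g (i # w) powr q * L k (i # w) powr (1 - q)) / ?N" .
    have "(\<Sum>i\<in>UNIV. ?f k (i # w)) / ?N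
        \<le> (\<Sum>i\<in>UNIV. ?Q * (?G k (i # w) - g (i # w) powr q * L k (i # w) powr (1 - q))) / ?N"
    proof (intro divide_right_mono sum_mono)
      show "?f k (i # w) \<le> ?Q * (?G k (i # w) - g (i # w) powr q * L k (i # w) powr (1 - q))" for i
        using Suc.IH[of "i # w"] Suc.prems by (simp add: L_def c_def)
    qed simp
    also have "\<dots> = ?Q * (?G (Suc k) w - (\<Sum>i\<in>UNIV. g (i # w) powr q * L k (i # w) powr (1 - q)) / ?N)"
      by (simp add: sum_distrib_left[symmetric] sum_subtractf diff_divide_distrib right_diff_distrib)
    also have "\<dots> \<le> ?Q * (?G (Suc k) w - g w powr q * M powr (1 - q))"
      using conv q by (intro mult_left_mono diff_left_mono) auto
    finally have "?f (Suc k) w \<le> of_bool (\<kappa> w) * g w powr q + ?Q * (?G (Suc k) w - g w powr q * M powr (1 - q))"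
      by simp
    also have "of_bool (\<kappa> w) * g w powr q
        \<le> ?Q * (g w powr q * M powr (1 - q) - g w powr q * (M + of_bool (\<kappa> w) / (2 * (q - 1))) powr (1 - q))"
      using M1 Lle[of "Suc k" w] LM by (intro gain) auto
    finally show ?case
      unfolding LM[symmetric] L_def c_def by (simp add: algebra_simps)
  }
qed

lemma Carleson_embedding:
  fixes g :: "'l::finite list \<Rightarrow> real" and \<kappa> :: "'l list \<Rightarrow> bool"
  assumes q: "1 < q" and g: "\<And>w. 0 \<le> g w" "\<And>w. length w < m \<Longrightarrow> (\<Sum>i\<in>UNIV. g (i # w)) = real CARD('l) * g w"
    and packing: "\<And>k w. acc (\<lambda>w. of_bool (\<kappa> w)) k w \<le> 2"
  shows "acc (\<lambda>w. of_bool (\<kappa> w) * g w powr q) m [] \<le> 2 * (q / (q - 1)) powr q * mean (\<lambda>w. g w powr q) m []"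
proof -
  have "acc (\<lambda>w. of_bool (\<kappa> w) * g w powr q) m [] \<le> 2 * (q / (q - 1)) powr q * (mean (\<lambda>w. g w powr q) m []
        - g [] powr q * (1 + acc (\<lambda>w. of_bool (\<kappa> w)) m [] / (2 * (q - 1))) powr (1 - q))"
    by (rule Carleson_embedding_Bellman[where m=m, OF q g packing]) auto
  also have "\<dots> \<le> 2 * (q / (q - 1)) powr q * mean (\<lambda>w. g w powr q) m []"
    by (intro mult_left_mono) auto
  finally show ?thesis .
qed

text \<open>\<open>prin a w\<close> is the principal (stopping) ancestor of \<open>w\<close>.\<close>

primrec prin :: "('l list \<Rightarrow> real) \<Rightarrow> 'l list \<Rightarrow> 'l list" where
  "prin a [] = []"
| "prin a (i # w) = (if a (i # w) > 2 * a (prin a w) then i # w else prin a w)"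

lemma suffix_prin: "suffix (prin a w) w"
  by (induction w) (auto simp: suffix_Cons)

lemma length_prin: "length (prin a w) \<le> length w"
  using suffix_prin suffix_length_le by blast

lemma prin_Cons_ne [simp]: "prin a w \<noteq> i # w"
  using length_prin[of a w] by auto

lemma prin_le:
  assumes "\<And>w. 0 \<le> a w" shows "a w \<le> 2 * a (prin a w)"
  using assms[of w] assms[of "[]"] by (cases w) auto

text \<open>The ratio to the principal average is the quantity that closes the induction. A stopping
  child carries mass at most 1 + 1, and by doubling its ratio to the old principal average is at
  least 2; averaging the ratios over the children reproduces that of the parent.\<close>

lemma prin_packing:
  fixes a :: "'l::finite list \<Rightarrow> real"
  assumes a: "martingale a" "\<And>w. 0 \<le> a w"
  shows "acc (\<lambda>w. of_bool (prin a w = w)) k w \<le> of_bool (prin a w = w) + a w / a (prin a w)"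
proof (induction k arbitrary: w)
  case 0
  then show ?case using a(2) by simp
next
  case (Suc k)
  let ?c = "acc (\<lambda>w. of_bool (prin a w = w)) k"
  have N: "0 < real CARD('l)" by simp
  have sum: "(\<Sum>i\<in>UNIV. a (i # w)) = real CARD('l) * a w"
    using martingaleD[OF a(1), of w] by simp
  have "?c (i # w) \<le> a (i # w) / a (prin a w)" for i
  proof (cases "a (i # w) > 2 * a (prin a w)")
    case False
    then show ?thesis using Suc[of "i # w"] by simp
  next
    case True
    have "?c (i # w) \<le> 1 + a (i # w) / a (i # w)" using Suc[of "i # w"] True by simp
    also have "\<dots> \<le> 2" by simp
    also have "2 \<le> a (i # w) / a (prin a w)"
    proof -
      \<comment> \<open>Division by 0 would spoil the ratio. But a vanishing principal average
        forces \<open>a\<close> to vanish at \<open>w\<close> and at its children, so no child could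
        stop.\<close>
      have "a (prin a w) \<noteq> 0"
      proof
        assume "a (prin a w) = 0"
        then have "a w = 0" using prin_le[of a w] a(2)[of w] a by simp
        then have "a (i # w) = 0"
          using sum a(2) by (simp add: sum_nonneg_eq_0_iff)
        then show False using True a(2)[of "prin a w"] by simp
      qed
      then have "0 < a (prin a w)" using a(2)[of "prin a w"] by simp
      then show ?thesis using True by (simp add: le_divide_eq)
    qed
    finally show ?thesis .
  qed
  then have "(\<Sum>i\<in>UNIV. ?c (i # w)) / real CARD('l) \<le> (\<Sum>i\<in>UNIV. a (i # w) / a (prin a w)) / real CARD('l)"
    by (intro divide_right_mono sum_mono) auto
  also have "\<dots> = a w / a (prin a w)"
    unfolding sum_divide_distrib[symmetric] sum by simp
  finally show ?case by simp
qed

text \<open>A principal node counts 1 and has ratio at most 1; at any other node the ratio is at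
  most 2, since stopping has not occurred.\<close>

lemma prin_packing_2:
  fixes a :: "'l::finite list \<Rightarrow> real"
  assumes a: "martingale a" "\<And>w. 0 \<le> a w"
  shows "acc (\<lambda>w. of_bool (prin a w = w)) k w \<le> 2"
proof (cases "prin a w = w")
  case True
  then show ?thesis using prin_packing[OF a, of k w] by (cases "a w = 0") auto
next
  case False
  have "a w / a (prin a w) \<le> 2"
    using prin_le[of a w] a(2) by (cases "a (prin a w) = 0") (auto simp: divide_le_eq less_le)
  then show ?thesis using prin_packing[OF a, of k w] False by simp
qed

text \<open>The martingale \<open>h\<close> started when the region \<open>P\<close> is entered and
  stopped at the first node outside it: constant \<open>c\<close> before, frozen afterwards. The
  value of \<open>h\<close> at the exit node is still taken, which preserves the martingale property
  at the last node of \<open>P\<close>.\<close>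

primrec graft :: "('l list \<Rightarrow> bool) \<Rightarrow> ('l list \<Rightarrow> 'b) \<Rightarrow> 'b \<Rightarrow> 'l list \<Rightarrow> 'b" where
  "graft P h c [] = c"
| "graft P h c (i # w) = (if P w then h (i # w) else graft P h c w)"

lemma graft_const:
  assumes "\<And>v. suffix v w \<Longrightarrow> v \<noteq> w \<Longrightarrow> \<not> P v" shows "graft P h c w = c"
  using assms
proof (induction w)
  case (Cons i w)
  have "\<not> P w" using Cons.prems[of w] by (simp add: suffix_Cons)
  moreover have "\<not> P v" if "suffix v w" "v \<noteq> w" for v
  proof -
    have "v \<noteq> i # w" using suffix_length_le[OF that(1)] by auto
    then show ?thesis using Cons.prems[of v] that(1) by (simp add: suffix_Cons)
  qed
  ultimately show ?case using Cons.IH by simp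
qed simp

text \<open>The hypotheses describe a region with the single entry node \<open>F\<close>, so the
  initial constant \<open>h F\<close> agrees with \<open>h\<close> there.\<close>

lemma graft_eq:
  assumes len: "\<And>v. P v \<Longrightarrow> length F \<le> length v" and entry: "\<And>i v. P (i # v) \<Longrightarrow> \<not> P v \<Longrightarrow> i # v = F"
    and root: "P [] \<Longrightarrow> F = []" and "P w"
  shows "graft P h (h F) w = h w"
proof (cases w)
  case Nil
  then show ?thesis using root \<open>P w\<close> by simp
next
  case (Cons i v)
  show ?thesis
  proof (cases "P v")
    case False
    then have F: "w = F" using entry \<open>P w\<close> Cons by simp
    have "graft P h (h F) w = h F"
    proof (rule graft_const)
      fix u assume "suffix u w" "u \<noteq> w"
      then have "length u < length F" using F suffix_length_less[of u w] by (simp add: strict_suffix_def)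
      then show "\<not> P u" using len[of u] by auto
    qed
    then show ?thesis using F by simp
  qed (simp add: Cons)
qed

text \<open>Outside \<open>P\<close> all children repeat the value of the parent; inside
  \<open>P\<close> the equation is that of \<open>h\<close>.\<close>

lemma martingale_graft:
  fixes h :: "'l::finite list \<Rightarrow> 'b::real_vector"
  assumes "martingale h" and "\<And>w. P w \<Longrightarrow> graft P h c w = h w"
  shows "martingale (graft P h c)"
  unfolding martingale_def
proof
  fix w
  show "(\<Sum>i\<in>UNIV. graft P h c (i # w)) = real CARD('l) *\<^sub>R graft P h c w"
    using martingaleD[OF assms(1), of w] assms(2)[of w] by (cases "P w") (simp_all add: sum_constant_scaleR)
qed

lemma prin_graft_eq: "prin a w = F \<Longrightarrow> graft (\<lambda>v. prin a v = F) h (h F) w = h w"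
proof (rule graft_eq)
  show "length F \<le> length v" if "prin a v = F" for v using that length_prin[of a v] by simp
  show "i # v = F" if "prin a (i # v) = F" "prin a v \<noteq> F" for i v using that by (auto split: if_splits)
qed auto

lemma suffix_graft_eq: "suffix F w \<Longrightarrow> graft (suffix F) h (h F) w = h w"
  by (rule graft_eq) (auto simp: suffix_Cons dest: suffix_length_le)

lemma not_suffix_graft: "\<not> suffix F w \<Longrightarrow> graft (suffix F) h c w = c"
  by (induction w) (auto simp: suffix_Cons)

lemma para_cong:
  assumes "\<And>w. \<theta> w \<Longrightarrow> \<beta> w = \<beta>' w \<and> \<phi> w = \<phi>' w \<and> (\<forall>i. \<beta> (i # w) = \<beta>' (i # w))"
  shows "para \<theta> \<beta> \<phi> w = para \<theta> \<beta>' \<phi>' w"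
  using assms by (induction w) auto

lemma sum_words_suffix:
  fixes f :: "'l::finite list \<Rightarrow> real"
  assumes "length F \<le> m"
  shows "(\<Sum>w\<in>{w\<in>words m. suffix F w}. f w) = (\<Sum>u\<in>words (m - length F). f (u @ F))"
  by (rule sum.reindex_bij_witness[of _ "\<lambda>u. u @ F" "\<lambda>w. take (length w - length F) w"])
    (use assms in \<open>auto simp: words_def suffix_def\<close>)

text \<open>The part of the paraproduct with principal node \<open>F\<close>: all averages \<open>\<phi>\<close> it involves are
  averages of the martingale \<open>\<phi>\<close> stopped below \<open>F\<close>, which is bounded by \<open>2 N a F\<close>.\<close>

lemma principal_para_bound:
  fixes \<beta> :: "'l::finite list \<Rightarrow> 'e::real_normed_vector \<Rightarrow>\<^sub>L 'e" and \<phi> :: "'l list \<Rightarrow> 'e"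
  assumes UE: "UMD_bound p (UNIV :: 'e set) C" and UT: "UMD_bound p T C'" and p: "1 \<le> p" and T: "subspace T"
    and \<beta>: "martingale \<beta>" "\<And>w. \<beta> w \<in> T" and \<phi>: "martingale \<phi>"
    and a: "martingale a" "\<And>w. norm (\<phi> w) \<le> a w"
    and B: "0 \<le> B" "\<And>k w. (\<Sum>u\<in>words k. norm (\<beta> (u @ w) - \<beta> w) powr p) \<le> B powr p * real CARD('l) ^ k"
    and F: "length F \<le> m"
  shows "(\<Sum>w\<in>words m. norm (para (\<lambda>w. prin a w = F \<and> \<theta> w) \<beta> \<phi> w) powr p)
    \<le> (C\<^sup>2 * C' * (2 * real CARD('l) * a F)) powr p * (B powr p * real CARD('l) ^ (m - length F))"
proof -
  define \<psi> where "\<psi> = graft (\<lambda>v. prin a v = F) \<phi> (\<phi> F)"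
  \<comment> \<open>\<open>\<beta>\<close> is kept on the whole subtree below \<open>F\<close>, not
    only on the stopping region, so that what remains of it is exactly its oscillation over
    \<open>F\<close>, to which the hypothesis on \<open>B\<close> applies.\<close>
  define \<gamma> where "\<gamma> = graft (suffix F) \<beta> (\<beta> F)"
  have N: "1 \<le> real CARD('l)" by (simp add: Suc_leI)
  have a0: "0 \<le> a w" for w using a(2)[of w] norm_ge_zero[of "\<phi> w"] by linarith
  have suf: "suffix F w" if "prin a w = F" for w using suffix_prin[of a w] that by simp
  have "para (\<lambda>w. prin a w = F \<and> \<theta> w) \<beta> \<phi> w = para (\<lambda>w. prin a w = F \<and> \<theta> w) \<gamma> \<psi> w" for w
    by (rule para_cong) (auto simp: \<gamma>_def \<psi>_def prin_graft_eq suffix_graft_eq suf suffix_Cons)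
  then have "(\<Sum>w\<in>words m. norm (para (\<lambda>w. prin a w = F \<and> \<theta> w) \<beta> \<phi> w) powr p)
      = (\<Sum>w\<in>words m. norm (para (\<lambda>w. prin a w = F \<and> \<theta> w) \<gamma> \<psi> w) powr p)" by simp
  also have "\<dots> \<le> (C\<^sup>2 * C' * (2 * real CARD('l) * a F)) powr p * (\<Sum>w\<in>words m. norm (\<gamma> w - \<gamma> []) powr p)"
  proof (rule local_para_bound[OF UE UT p T])
    show "martingale \<gamma>"
      unfolding \<gamma>_def by (intro martingale_graft \<beta> suffix_graft_eq)
    show "martingale \<psi>"
      unfolding \<psi>_def by (intro martingale_graft \<phi> prin_graft_eq)
    show "\<gamma> w \<in> T" for w
      using \<beta>(2) by (cases "suffix F w") (simp_all add: \<gamma>_def suffix_graft_eq not_suffix_graft)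
    show "norm (\<psi> w) \<le> 2 * real CARD('l) * a F" for w
      unfolding \<psi>_def
    proof (induction w)
      case Nil
      have "a F * 1 \<le> a F * (2 * real CARD('l))"
        using N a0 by (intro mult_left_mono) linarith+
      then show ?case using a(2)[of F] by (simp add: mult_ac)
    next
      case (Cons i w)
      show ?case
      proof (cases "prin a w = F")
        case True
        \<comment> \<open>The exit node may already have stopped; its average is at most N times
          that of its parent, which has not.\<close>
        have "norm (\<phi> (i # w)) \<le> a (i # w)" by (rule a(2))
        also have "\<dots> \<le> (\<Sum>i\<in>UNIV. a (i # w))"
          using a0 by (intro member_le_sum) auto
        also have "\<dots> = real CARD('l) * a w" using martingaleD[OF a(1)] by simp
        also have "\<dots> \<le> real CARD('l) * (2 * a (prin a w))"
          by (intro mult_left_mono prin_le a0) auto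
        finally show ?thesis using True by (simp add: mult_ac)
      qed (use Cons in simp)
    qed
  qed
  also have "(\<Sum>w\<in>words m. norm (\<gamma> w - \<gamma> []) powr p) = (\<Sum>w\<in>{w\<in>words m. suffix F w}. norm (\<beta> w - \<beta> F) powr p)"
  proof (rule sum.mono_neutral_cong_right)
    have "\<gamma> [] = \<beta> F" by (simp add: \<gamma>_def)
    then show "\<forall>w\<in>words m - {w\<in>words m. suffix F w}. norm (\<gamma> w - \<gamma> []) powr p = 0"
      "\<And>w. w \<in> {w\<in>words m. suffix F w} \<Longrightarrow> norm (\<gamma> w - \<gamma> []) powr p = norm (\<beta> w - \<beta> F) powr p"
      by (auto simp: \<gamma>_def suffix_graft_eq not_suffix_graft simp del: graft.simps)
  qed auto
  also have "\<dots> = (\<Sum>u\<in>words (m - length F). norm (\<beta> (u @ F) - \<beta> F) powr p)"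
    by (rule sum_words_suffix[OF F])
  also have "(C\<^sup>2 * C' * (2 * real CARD('l) * a F)) powr p * \<dots>
      \<le> (C\<^sup>2 * C' * (2 * real CARD('l) * a F)) powr p * (B powr p * real CARD('l) ^ (m - length F))"
    by (intro mult_left_mono B) auto
  finally show ?thesis .
qed

text \<open>\<open>g\<close> stopped at the first node outside the region of \<open>F\<close>, like
  \<open>graft\<close> with initial value 0. Starting from 0 is harmless because the part of the
  paraproduct belonging to \<open>F\<close> vanishes at \<open>F\<close>, and it makes the sum over
  all \<open>F\<close> small.\<close>

primrec gam :: "('l list \<Rightarrow> real) \<Rightarrow> ('l list \<Rightarrow> real) \<Rightarrow> 'l list \<Rightarrow> 'l list \<Rightarrow> real" where
  "gam a g F [] = 0"
| "gam a g F (i # w) = (if prin a w = F then g (i # w) else gam a g F w)"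

lemma gam_eq_0: "length w \<le> length F \<Longrightarrow> gam a g F w = 0"
proof (induction w)
  case (Cons i w)
  have "prin a w \<noteq> F" using length_prin[of a w] Cons.prems by auto
  then show ?case using Cons by simp
qed simp

lemma para_prin_eq_0: "length w \<le> length F \<Longrightarrow> para (\<lambda>w. prin a w = F \<and> \<theta> w) \<beta> \<phi> w = 0"
proof (induction w)
  case (Cons i w)
  have "prin a w \<noteq> F" using length_prin[of a w] Cons.prems by auto
  then show ?case using Cons by simp
qed simp

lemma gam_prin:
  assumes "prin a w = F"
  shows "gam a g F w = g w \<or> length w \<le> length F"
  using assms by (cases w) (auto split: if_splits)

lemma gam_nonneg: "(\<And>w. 0 \<le> g w) \<Longrightarrow> 0 \<le> gam a g F w"
  by (induction w) auto

text \<open>\<open>para\<close> restricted to the principal node \<open>F\<close> is constant below the next stopping nodes, so that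
  there \<open>g\<close> may be replaced by its averages.\<close>

lemma sum_words_gam:
  fixes g a :: "'l::finite list \<Rightarrow> real" and \<beta> :: "'l list \<Rightarrow> 'e::real_normed_vector \<Rightarrow>\<^sub>L 'e"
    and \<phi> :: "'l list \<Rightarrow> 'e" and F \<theta>
  assumes g: "\<And>w. length w < m \<Longrightarrow> (\<Sum>i\<in>UNIV. g (i # w)) = real CARD('l) * g w" and "n \<le> m"
  defines "s \<equiv> para (\<lambda>w. prin a w = F \<and> \<theta> w) \<beta> \<phi>"
  shows "(\<Sum>w\<in>words n. g w * norm (s w)) = (\<Sum>w\<in>words n. gam a g F w * norm (s w))"
  using \<open>n \<le> m\<close>
proof (induction n)
  case 0
  then show ?case by (simp add: s_def)
next
  case (Suc n)
  have "(\<Sum>i\<in>UNIV. (g (i # w) - gam a g F (i # w)) * norm (s (i # w)))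
      = real CARD('l) * ((g w - gam a g F w) * norm (s w))" if w: "w \<in> words n" for w
  proof (cases "prin a w = F")
    case True
    \<comment> \<open>At \<open>F\<close> itself \<open>gam\<close> is 0 instead of
      \<open>g F\<close>, but there \<open>s\<close> vanishes; elsewhere in the region
      \<open>gam\<close> is \<open>g\<close>.\<close>
    have "(g w - gam a g F w) * norm (s w) = 0"
      using gam_prin[OF True, of g] para_prin_eq_0[of w F] by (auto simp: s_def)
    then show ?thesis using True by simp
  next
    case False
    then have "(\<Sum>i\<in>UNIV. (g (i # w) - gam a g F (i # w)) * norm (s (i # w)))
        = (\<Sum>i\<in>UNIV. g (i # w) - gam a g F w) * norm (s w)"
      by (simp add: s_def sum_distrib_right)
    also have "(\<Sum>i\<in>UNIV. g (i # w) - gam a g F w) = real CARD('l) * (g w - gam a g F w)"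
      using g[of w] w Suc.prems by (simp add: sum_subtractf words_def right_diff_distrib)
    finally show ?thesis by simp
  qed
  then have "(\<Sum>w\<in>words (Suc n). (g w - gam a g F w) * norm (s w))
      = (\<Sum>w\<in>words n. real CARD('l) * ((g w - gam a g F w) * norm (s w)))"
    unfolding sum_words_Cons by (rule sum.cong[OF refl])
  also have "\<dots> = 0"
    using Suc by (simp add: sum_distrib_left[symmetric] left_diff_distrib sum_subtractf)
  finally show ?case by (simp add: left_diff_distrib sum_subtractf)
qed

text \<open>Along a branch, \<open>gam a g F\<close> is frozen at the node where the region of
  \<open>F\<close> is left, which is the next principal node. The regions already left therefore
  contribute \<open>g powr q\<close> at distinct principal nodes; the region still active is
  subtracted.\<close>

lemma sum_gam_le:
  fixes g :: "'l::finite list \<Rightarrow> real"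
  assumes q: "0 < q" and g: "\<And>w. 0 \<le> g w"
  shows "length w \<le> m \<Longrightarrow> (\<Sum>F\<in>{F. length F \<le> m}. gam a g F w powr q) - gam a g (prin a w) w powr q
    \<le> psum (\<lambda>w. of_bool (prin a w = w) * g w powr q) w"
proof (induction w)
  case (Cons i w)
  have fin: "finite {F :: 'l list. length F \<le> m}" using finite_lists_length_le[of "UNIV :: 'l set" m] by simp
  let ?M = "psum (\<lambda>w. of_bool (prin a w = w) * g w powr q)"
  have w: "prin a w \<in> {F. length F \<le> m}" using length_prin[of a w] Cons.prems by simp
  have "(\<Sum>F\<in>{F. length F \<le> m}. gam a g F (i # w) powr q)
      = g (i # w) powr q + (\<Sum>F\<in>{F. length F \<le> m} - {prin a w}. gam a g F w powr q)"
    by (subst sum.remove[OF fin w]) (auto intro!: sum.cong split: if_splits)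
  also have "(\<Sum>F\<in>{F. length F \<le> m} - {prin a w}. gam a g F w powr q)
      = (\<Sum>F\<in>{F. length F \<le> m}. gam a g F w powr q) - gam a g (prin a w) w powr q"
    by (subst sum.remove[OF fin w]) simp
  also have "\<dots> \<le> ?M w" using Cons by simp
  finally have le: "(\<Sum>F\<in>{F. length F \<le> m}. gam a g F (i # w) powr q) \<le> g (i # w) powr q + ?M w" by simp
  show ?case
  proof (cases "prin a (i # w) = i # w")
    case True
    have "gam a g (i # w) (i # w) = 0" by (rule gam_eq_0) simp
    then show ?thesis using le True q by simp
  next
    case False
    then have "prin a (i # w) = prin a w" by (auto split: if_splits)
    then show ?thesis using le False by simp
  qed
qed (simp add: assms)

lemma para_sum_principal:
  fixes \<beta> :: "'l::finite list \<Rightarrow> 'e::real_normed_vector \<Rightarrow>\<^sub>L 'e"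
  shows "length w \<le> m \<Longrightarrow> para \<theta> \<beta> \<phi> w = (\<Sum>F\<in>{F. length F \<le> m}. para (\<lambda>w. prin a w = F \<and> \<theta> w) \<beta> \<phi> w)"
proof (induction w)
  case (Cons i w)
  have fin: "finite {F :: 'l list. length F \<le> m}" using finite_lists_length_le[of "UNIV :: 'l set" m] by simp
  have w: "prin a w \<in> {F. length F \<le> m}" using length_prin[of a w] Cons.prems by simp
  let ?z = "(\<beta> (i # w) - \<beta> w) (\<phi> w)"
  have "(\<Sum>F\<in>{F. length F \<le> m}. of_bool (prin a w = F \<and> \<theta> w) *\<^sub>R ?z) = of_bool (\<theta> w) *\<^sub>R ?z"
    by (subst sum.remove[OF fin w]) (auto intro!: sum.neutral)
  then show ?case using Cons by (simp add: sum.distrib)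
qed simp

text \<open>The parts \<open>s F\<close> of different principal nodes overlap, so their p-th powers
  do not simply add. In the pairing with the dual function |S|^(p-1) each \<open>s F\<close> sees
  that function only through \<open>gam a g F\<close>, and these are q-summable over
  \<open>F\<close> by Carleson embedding. Young's inequality then leaves the sum of the p-th powers
  of the \<open>s F\<close>.\<close>

lemma tree_paraproduct_bound:
  fixes \<beta> :: "'l::finite list \<Rightarrow> 'e::real_normed_vector \<Rightarrow>\<^sub>L 'e" and \<phi> :: "'l list \<Rightarrow> 'e"
  assumes UE: "UMD_bound p (UNIV :: 'e set) C" and UT: "UMD_bound p T C'" and p: "1 < p" and T: "subspace T"
    and \<beta>: "martingale \<beta>" "\<And>w. \<beta> w \<in> T" and \<phi>: "martingale \<phi>"
    and a: "martingale a" "\<And>w. norm (\<phi> w) \<le> a w"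
    and B: "0 \<le> B" "\<And>k w. (\<Sum>u\<in>words k. norm (\<beta> (u @ w) - \<beta> w) powr p) \<le> B powr p * real CARD('l) ^ k"
  shows "(\<Sum>w\<in>words m. norm (para \<theta> \<beta> \<phi> w) powr p)
    \<le> (6 * real CARD('l) * p * (p / (p - 1)) * C\<^sup>2 * C' * B) powr p * (\<Sum>w\<in>words m. a w powr p)"
proof -
  define N where "N = real CARD('l)"
  have N: "1 \<le> N" by (simp add: N_def Suc_leI)
  have C: "0 \<le> C" "0 \<le> C'" using UE UT by (auto simp: UMD_bound_def)
  have a0: "0 \<le> a w" for w using a(2)[of w] norm_ge_zero[of "\<phi> w"] by linarith
  define q where "q = p / (p - 1)"
  have q: "1 < q" "q / (q - 1) = p" "(p - 1) * q = p" "1 / q = 1 - 1 / p"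
    using p by (auto simp: q_def field_simps)
  define s where "s F = para (\<lambda>w. prin a w = F \<and> \<theta> w) \<beta> \<phi>" for F
  define S where "S = para \<theta> \<beta> \<phi>"
  \<comment> \<open>The dual function |S|^(p-1), extended from the leaves to a martingale on the
    nodes of depth at most \<open>m\<close>.\<close>
  define g where "g w = mean (\<lambda>w. norm (S w) powr (p - 1)) (m - length w) w" for w
  define \<F> where "\<F> = {F :: 'l list. length F \<le> m}"
  have fin: "finite \<F>" unfolding \<F>_def using finite_lists_length_le[of "UNIV :: 'l set" m] by simp
  have g0: "0 \<le> g w" for w unfolding g_def by (rule mean_nonneg) simp
  have gm: "g w = norm (S w) powr (p - 1)" if "w \<in> words m" for w
    using that by (simp add: g_def words_def)
  have gmart: "(\<Sum>i\<in>UNIV. g (i # w)) = real CARD('l) * g w" if "length w < m" for w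
  proof -
    have "m - length w = Suc (m - length (i # w))" for i using that by simp
    then show ?thesis by (simp add: g_def)
  qed
  have packing: "acc (\<lambda>w. of_bool (prin a w = w)) k w \<le> 2" for k w
    by (rule prin_packing_2[OF a(1) a0])
  define P where "P = (\<Sum>w\<in>words m. norm (S w) powr p)"
  define X where "X = (\<Sum>F\<in>\<F>. \<Sum>w\<in>words m. norm (s F w) powr p)"
  have P_gq: "P = (\<Sum>w\<in>words m. g w powr q)"
    using q by (simp add: P_def gm powr_powr)
  \<comment> \<open>The 3 is 2 + 1: the embedding bounds the principal nodes passed by each branch,
    and the region active at the leaf adds at most \<open>P\<close> itself. The embedding constant
    contains p because p is conjugate to \<open>q\<close>.\<close>
  have gamma: "(\<Sum>F\<in>\<F>. \<Sum>w\<in>words m. gam a g F w powr q) \<le> 3 * p powr q * P"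
  proof -
    have "(\<Sum>F\<in>\<F>. \<Sum>w\<in>words m. gam a g F w powr q) = (\<Sum>w\<in>words m. \<Sum>F\<in>\<F>. gam a g F w powr q)"
      by (rule sum.swap)
    also have "\<dots> \<le> (\<Sum>w\<in>words m. psum (\<lambda>w. of_bool (prin a w = w) * g w powr q) w + g w powr q)"
    proof (rule sum_mono)
      fix w :: "'l list" assume w: "w \<in> words m"
      have "gam a g (prin a w) w powr q \<le> g w powr q"
        using gam_prin[where a=a and w=w and g=g, OF refl] gam_eq_0[of w "prin a w"] g0[of w] q by auto
      then show "(\<Sum>F\<in>\<F>. gam a g F w powr q) \<le> psum (\<lambda>w. of_bool (prin a w = w) * g w powr q) w + g w powr q"
        using sum_gam_le[where q=q and g=g and w=w and m=m and a=a] q g0 w by (simp add: \<F>_def words_def)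
    qed
    also have "\<dots> = real CARD('l) ^ m * acc (\<lambda>w. of_bool (prin a w = w) * g w powr q) m [] + P"
      by (simp only: sum.distrib sum_words_psum P_gq)
    also have "\<dots> \<le> real CARD('l) ^ m * (2 * (q / (q - 1)) powr q * mean (\<lambda>w. g w powr q) m []) + P"
      by (intro add_right_mono mult_left_mono Carleson_embedding[OF q(1) g0 gmart packing]) auto
    also have "\<dots> = 2 * p powr q * P + P"
      by (simp add: mean_eq q P_gq)
    also have "\<dots> \<le> 2 * p powr q * P + p powr q * P"
      using ge_one_powr_ge_zero[of p q] p q mult_right_mono[of 1 "p powr q" P]
      by (simp add: P_def sum_nonneg)
    finally show ?thesis by (simp add: algebra_simps)
  qed
  define t where "t = (3 * p powr q) powr (- 1 / q)"
  have t: "0 < t" "t powr q * (3 * p powr q) = 1"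
  proof -
    have "(- 1 / q) * q = - 1" using q(1) by simp
    then have tq: "t powr q = (3 * p powr q) powr (- 1)" by (simp only: t_def powr_powr)
    show "t powr q * (3 * p powr q) = 1" unfolding tq using p by (simp add: powr_minus)
    show "0 < t" using p by (simp add: t_def)
  qed
  have P_le: "P \<le> X / t powr p"
  proof -
    have "P = (\<Sum>w\<in>words m. g w * norm (S w))"
      unfolding P_def using p powr_mult_base[of "norm (S w)" "p - 1" for w]
      by (intro sum.cong refl) (simp add: gm mult.commute)
    also have "\<dots> \<le> (\<Sum>w\<in>words m. \<Sum>F\<in>\<F>. g w * norm (s F w))"
    proof (rule sum_mono)
      fix w :: "'l list" assume "w \<in> words m"
      then have "S w = (\<Sum>F\<in>\<F>. s F w)"
        unfolding S_def s_def \<F>_def by (intro para_sum_principal) (simp add: words_def)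
      then have "g w * norm (S w) \<le> g w * (\<Sum>F\<in>\<F>. norm (s F w))"
        using g0 by (intro mult_left_mono) (auto intro: norm_sum)
      then show "g w * norm (S w) \<le> (\<Sum>F\<in>\<F>. g w * norm (s F w))"
        by (simp add: sum_distrib_left)
    qed
    also have "\<dots> = (\<Sum>F\<in>\<F>. \<Sum>w\<in>words m. g w * norm (s F w))"
      by (rule sum.swap)
    also have "\<dots> = (\<Sum>F\<in>\<F>. \<Sum>w\<in>words m. gam a g F w * norm (s F w))"
      unfolding s_def by (rule sum.cong[OF refl], rule sum_words_gam[OF gmart order_refl])
    \<comment> \<open>Young's inequality, with \<open>t\<close> chosen so that the first term sums to \<open>P / q\<close>\<close>
    also have "\<dots> \<le> (\<Sum>F\<in>\<F>. \<Sum>w\<in>words m. t powr q * gam a g F w powr q / q + norm (s F w) powr p / (t powr p * p))"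
    proof (intro sum_mono)
      fix F w
      have "(t * gam a g F w) * (norm (s F w) / t) \<le> (t * gam a g F w) powr q / q + (norm (s F w) / t) powr p / p"
        using p q t(1) gam_nonneg[where g=g and a=a and F=F and w=w] g0 by (intro Youngs_inequality) (auto simp: divide_nonneg_pos)
      then show "gam a g F w * norm (s F w) \<le> t powr q * gam a g F w powr q / q + norm (s F w) powr p / (t powr p * p)"
        using t(1) gam_nonneg[where g=g and a=a and F=F and w=w] g0 by (simp add: powr_mult powr_divide)
    qed
    also have "\<dots> = t powr q * (\<Sum>F\<in>\<F>. \<Sum>w\<in>words m. gam a g F w powr q) / q + X / (t powr p * p)"
      by (simp add: sum.distrib X_def sum_distrib_left sum_divide_distrib)
    also have "\<dots> \<le> t powr q * (3 * p powr q * P) / q + X / (t powr p * p)"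
      using gamma q by (intro add_right_mono divide_right_mono mult_left_mono) auto
    also have "t powr q * (3 * p powr q * P) = P"
      using t(2) by (simp add: mult.assoc[symmetric])
    \<comment> \<open>\<open>P\<close> is a finite sum, so the term \<open>P / q\<close> can be
      absorbed.\<close>
    finally have "P - P / q \<le> X / (t powr p * p)" by simp
    moreover have "P - P / q = P / p"
    proof -
      have "P / q = P * (1 - 1 / p)" using arg_cong[OF q(4), of "\<lambda>r. P * r"] by simp
      then show ?thesis by (simp add: right_diff_distrib)
    qed
    ultimately have "p * (P / p) \<le> p * (X / (t powr p * p))"
      using p by (intro mult_left_mono) auto
    then show ?thesis using p by simp
  qed
  have tp: "1 / t powr p = 3 powr (p - 1) * p powr p"
  proof -
    have "1 / q * p = p - 1" unfolding q(4) using p by (simp add: left_diff_distrib)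
    then have e: "(- 1 / q) * p = - (p - 1)" by simp
    have "t powr p = (3 * p powr q) powr (- (p - 1))"
      unfolding t_def powr_powr e ..
    then have "1 / t powr p = (3 * p powr q) powr (p - 1)"
      by (simp only: powr_minus_divide) simp
    also have "\<dots> = 3 powr (p - 1) * p powr p"
      using p q(3) by (simp add: powr_mult powr_powr mult.commute)
    finally show ?thesis .
  qed
  define c where "c = C\<^sup>2 * C' * (2 * N) * B"
  have c0: "0 \<le> c" using C N B by (simp add: c_def)
  have "X \<le> (\<Sum>F\<in>\<F>. c powr p * N ^ m * (of_bool (prin a F = F) * a F powr p / N ^ length F))"
    unfolding X_def
  proof (rule sum_mono)
    fix F assume "F \<in> \<F>"
    then have F: "length F \<le> m" by (simp add: \<F>_def)
    show "(\<Sum>w\<in>words m. norm (s F w) powr p) \<le> c powr p * N ^ m * (of_bool (prin a F = F) * a F powr p / N ^ length F)"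
    proof (cases "prin a F = F")
      case True
      have "(\<Sum>w\<in>words m. norm (s F w) powr p)
          \<le> (C\<^sup>2 * C' * (2 * real CARD('l) * a F)) powr p * (B powr p * real CARD('l) ^ (m - length F))"
        unfolding s_def by (rule principal_para_bound[OF UE UT _ T \<beta> \<phi> a B F]) (use p in auto)
      also have "\<dots> = c powr p * a F powr p * N ^ (m - length F)"
        using C N B a0[of F] by (simp add: c_def powr_mult N_def mult_ac)
      also have "N ^ (m - length F) = N ^ m / N ^ length F"
        using N F by (simp add: power_diff)
      finally show ?thesis using True by (simp add: mult_ac)
    next
      case False
      \<comment> \<open>A node that is not principal is nobody's principal ancestor, since
        \<open>prin a\<close> is idempotent.\<close>
      have "s F w = 0" for w
      proof -
        have "prin a v \<noteq> F" for v
        proof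
          assume "prin a v = F"
          moreover have "prin a (prin a v) = prin a v" by (induction v) auto
          ultimately show False using False by simp
        qed
        then show ?thesis unfolding s_def by (induction w) auto
      qed
      then show ?thesis using False p by simp
    qed
  qed
  also have "\<dots> = c powr p * N ^ m * (\<Sum>F\<in>\<F>. of_bool (prin a F = F) * a F powr p / N ^ length F)"
    by (simp add: sum_distrib_left)
  also have "(\<Sum>F\<in>\<F>. of_bool (prin a F = F) * a F powr p / N ^ length F)
      = acc (\<lambda>F. of_bool (prin a F = F) * a F powr p) m []"
  proof -
    have "\<F> = (\<Union>j\<in>{..m}. words j)" by (auto simp: \<F>_def words_def)
    then have "(\<Sum>F\<in>\<F>. of_bool (prin a F = F) * a F powr p / N ^ length F)
        = (\<Sum>j\<le>m. \<Sum>F\<in>words j. of_bool (prin a F = F) * a F powr p / N ^ length F)"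
      by (simp only:) (rule sum.UNION_disjoint, simp, simp, auto simp: words_def)
    also have "\<dots> = (\<Sum>j\<le>m. mean (\<lambda>F. of_bool (prin a F = F) * a F powr p) j [])"
      unfolding mean_eq sum_divide_distrib by (intro sum.cong refl) (auto simp: words_def N_def)
    finally show ?thesis by (simp add: acc_eq)
  qed
  \<comment> \<open>Second use of the embedding, now for the averages \<open>a\<close> themselves
    with exponent p; it is the source of p' in the final constant.\<close>
  also have "c powr p * N ^ m * acc (\<lambda>F. of_bool (prin a F = F) * a F powr p) m []
      \<le> c powr p * N ^ m * (2 * (p / (p - 1)) powr p * mean (\<lambda>w. a w powr p) m [])"
    using N martingaleD[OF a(1)]
    by (intro mult_left_mono Carleson_embedding[OF p a0 _ packing]) auto
  also have "\<dots> = 2 * (c * q) powr p * (\<Sum>w\<in>words m. a w powr p)"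
    unfolding q_def[symmetric] using N c0 q(1) by (simp add: mean_eq N_def powr_mult)
  finally have X_le: "X \<le> 2 * (c * q) powr p * (\<Sum>w\<in>words m. a w powr p)" .
  have "P \<le> 3 powr (p - 1) * p powr p * X"
    using P_le tp by (simp add: divide_inverse mult.commute)
  also have "\<dots> \<le> 3 powr (p - 1) * p powr p * (2 * (c * q) powr p * (\<Sum>w\<in>words m. a w powr p))"
    by (intro mult_left_mono X_le) auto
  also have "\<dots> = (2 * 3 powr (p - 1)) * (p * (c * q)) powr p * (\<Sum>w\<in>words m. a w powr p)"
    using p c0 q(1) by (simp add: powr_mult)
  \<comment> \<open>The 3^(p-1) of the duality argument and the 2 of the embedding are merged into
    3^p.\<close>
  also have "\<dots> \<le> 3 powr p * (p * (c * q)) powr p * (\<Sum>w\<in>words m. a w powr p)"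
  proof (intro mult_right_mono)
    show "2 * 3 powr (p - 1) \<le> 3 powr p" by (simp add: powr_diff)
  qed (auto intro: sum_nonneg)
  also have "3 powr p * (p * (c * q)) powr p = (3 * (p * (c * q))) powr p"
    using p c0 q(1) by (simp add: powr_mult)
  also have "3 * (p * (c * q)) = 6 * real CARD('l) * p * (p / (p - 1)) * C\<^sup>2 * C' * B"
    by (simp add: c_def q_def N_def)
  finally show ?thesis by (simp add: P_def S_def)
qed

section \<open>Dyadic cubes and averages\<close>

lemma half_open_box_measure:
  fixes a :: "real^'n" and s :: real
  assumes "0 < s"
  defines "Q \<equiv> {x. \<forall>i. a $ i \<le> x $ i \<and> x $ i < a $ i + s}"
  shows "Q \<in> sets lborel" "emeasure lborel Q = ennreal (s ^ CARD('n))"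
proof -
  define b :: "real^'n" where "b = (\<chi> i. a $ i + s)"
  have "Q = (\<Inter>i. {x. a $ i \<le> x $ i} \<inter> {x. x $ i < a $ i + s})"
    by (auto simp: Q_def)
  also have "\<dots> \<in> sets borel"
    by (intro sets.finite_INT sets.Int borel_closed borel_open closed_Collect_le open_Collect_less continuous_intros) auto
  finally show sets: "Q \<in> sets lborel" by simp
  have cb: "cbox a b \<noteq> {}" using assms by (simp add: b_def interval_ne_empty_cart)
  have m: "measure lborel (cbox a b) = s ^ CARD('n)" "measure lborel (box a b) = s ^ CARD('n)"
  proof -
    show "measure lborel (cbox a b) = s ^ CARD('n)" using content_cbox_cart[OF cb] by (simp add: b_def)
    then show "measure lborel (box a b) = s ^ CARD('n)"
      by (simp add: measure_def emeasure_lborel_box_eq emeasure_lborel_cbox_eq)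
  qed
  have e: "emeasure lborel (cbox a b) = ennreal (s ^ CARD('n))" "emeasure lborel (box a b) = ennreal (s ^ CARD('n))"
    using m emeasure_eq_ennreal_measure[of lborel "cbox a b"] emeasure_eq_ennreal_measure[of lborel "box a b"]
      emeasure_lborel_cbox_finite[of a b] emeasure_lborel_box_finite[of a b] by auto
  have "box a b \<subseteq> Q" "Q \<subseteq> cbox a b"
    by (auto simp: Q_def b_def mem_box_cart less_imp_le)
  then have "emeasure lborel (box a b) \<le> emeasure lborel Q" "emeasure lborel Q \<le> emeasure lborel (cbox a b)"
    using sets by (auto intro!: emeasure_mono)
  then show "emeasure lborel Q = ennreal (s ^ CARD('n))" using e by (intro antisym) auto
qed

text \<open>The children of a cube are numbered by the subsets of the index set, as there are \<open>2\<^sup>d\<close> of them.\<close>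

definition kid :: "(int \<Rightarrow> (real^'n) set set) \<Rightarrow> (real^'n) set \<Rightarrow> 'n set \<Rightarrow> (real^'n) set" where
  "kid D Q = (SOME e. bij_betw e UNIV (children D Q))"

text \<open>The head of a word is the deepest choice: prefixing a label passes to a child, and
  suffixes are ancestors.\<close>

primrec subcube :: "(int \<Rightarrow> (real^'n) set set) \<Rightarrow> (real^'n) set \<Rightarrow> 'n set list \<Rightarrow> (real^'n) set" where
  "subcube D R [] = R"
| "subcube D R (i # w) = kid D (subcube D R w) i"

lemma subcube_append: "subcube D R (u @ w) = subcube D (subcube D R w) u"
  by (induction u) auto

locale dyadic_grid =
  fixes D :: "int \<Rightarrow> (real^'n) set set"
  assumes D: "dyadic_system D"
begin

lemma dyadic_measure:
  assumes "Q \<in> D k"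
  shows "Q \<in> sets lborel" "emeasure lborel Q = ennreal ((2 powi (- k)) ^ CARD('n))"
    "measure lborel Q = (2 powi (- k)) ^ CARD('n)"
proof -
  have pos: "0 < (2::real) powi (- k)" by simp
  obtain a where Q: "Q = {x. \<forall>i. a $ i \<le> x $ i \<and> x $ i < a $ i + 2 powi (- k)}"
    using D assms unfolding dyadic_system_def by blast
  show "Q \<in> sets lborel" "emeasure lborel Q = ennreal ((2 powi (- k)) ^ CARD('n))"
    unfolding Q using half_open_box_measure[OF pos] by auto
  then show "measure lborel Q = (2 powi (- k)) ^ CARD('n)"
    by (simp add: measure_def)
qed

lemma dyadic_measure_pos: "Q \<in> D k \<Longrightarrow> 0 < measure lborel Q"
  by (simp add: dyadic_measure(3))

lemma dyadic_emeasure: "Q \<in> D k \<Longrightarrow> emeasure lborel Q = ennreal (measure lborel Q)"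
  by (simp add: dyadic_measure)

lemma cubes_measure:
  assumes "Q \<in> cubes D"
  shows "Q \<in> sets lborel" "emeasure lborel Q = ennreal (measure lborel Q)" "0 < measure lborel Q"
  using assms dyadic_measure(1) dyadic_emeasure dyadic_measure_pos by (auto simp: cubes_def)

lemma dyadic_partition: "partition_on UNIV (D k)"
  using D unfolding dyadic_system_def by blast

lemma dyadic_eqI: "Q \<in> D k \<Longrightarrow> Q' \<in> D k \<Longrightarrow> x \<in> Q \<Longrightarrow> x \<in> Q' \<Longrightarrow> Q = Q'"
  using partition_onD2[OF dyadic_partition, of k] by (auto simp: disjoint_def)

lemma dyadic_cover: obtains Q where "Q \<in> D k" "x \<in> Q"
  using partition_onD1[OF dyadic_partition, of k] by blast

lemma dyadic_nonempty: "Q \<in> D k \<Longrightarrow> Q \<noteq> {}"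
  using partition_onD3[OF dyadic_partition, of k] by auto

lemma dyadic_ancestor: "Q' \<in> D (k + int m) \<Longrightarrow> \<exists>Q\<in>D k. Q' \<subseteq> Q"
proof (induction m arbitrary: Q')
  case (Suc m)
  then have "Q' \<in> D ((k + int m) + 1)" by (simp add: algebra_simps)
  then obtain Q'' where Q'': "Q'' \<in> D (k + int m)" "Q' \<subseteq> Q''"
    using D unfolding dyadic_system_def by blast
  from Suc.IH[OF Q''(1)] obtain Q where "Q \<in> D k" "Q'' \<subseteq> Q" ..
  then show ?case using Q''(2) by (intro bexI[of _ Q]) auto
qed auto

lemma dyadic_nested:
  assumes "Q \<in> D k" "Q' \<in> D k'" "k \<le> k'" "x \<in> Q" "x \<in> Q'"
  shows "Q' \<subseteq> Q"
proof -
  have "Q' \<in> D (k + int (nat (k' - k)))" using assms by simp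
  then obtain R where "R \<in> D k" "Q' \<subseteq> R" using dyadic_ancestor by blast
  then show ?thesis using dyadic_eqI[of Q k R x] assms by auto
qed

lemma dyadic_level_unique:
  assumes "Q \<in> D k" "Q \<in> D k'" shows "k = k'"
proof -
  have "((2::real) powi (- k)) ^ CARD('n) = (2 powi (- k')) ^ CARD('n)"
    using dyadic_measure(3)[OF assms(1)] dyadic_measure(3)[OF assms(2)] by simp
  then have eq: "(2::real) powi (- k) = 2 powi (- k')"
    by (rule power_eq_imp_eq_base[where n="CARD('n)"]) simp_all
  show ?thesis
  proof (rule ccontr)
    assume "k \<noteq> k'"
    then have "- k < - k' \<or> - k' < - k" by linarith
    then show False
      using power_int_strict_increasing[of "- k" "- k'" "2::real"] power_int_strict_increasing[of "- k'" "- k" "2::real"] eq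
      by (elim disjE) simp_all
  qed
qed

text \<open>Counting by volume: cubes of one generation are disjoint and have equal positive
  measure, so the measure of \<open>S\<close> bounds their number.\<close>

lemma finite_dyadic_in:
  assumes "\<Q> \<subseteq> D k" "\<And>Q. Q \<in> \<Q> \<Longrightarrow> Q \<subseteq> S" "S \<in> sets lborel" "emeasure lborel S < \<infinity>"
  shows "finite \<Q>" "real (card \<Q>) * (2 powi (- k)) ^ CARD('n) = measure lborel (\<Union>\<Q>)"
proof -
  let ?v = "(2 powi (- k)) ^ CARD('n) :: real"
  have v: "0 < ?v" by simp
  have sum: "measure lborel (\<Union>G) = real (card G) * ?v" if "G \<subseteq> D k" "finite G" for G
  proof -
    have "measure lborel (\<Union>Q\<in>G. Q) = (\<Sum>Q\<in>G. measure lborel Q)"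
    proof (rule measure_finite_Union[OF that(2)])
      show "(\<lambda>Q. Q) ` G \<subseteq> sets lborel" using that(1) dyadic_measure(1)[of _ k] by (auto simp: subset_iff)
      show "disjoint_family_on (\<lambda>Q. Q) G"
        unfolding disjoint_family_on_def
      proof (intro ballI impI)
        fix Q Q' assume Q: "Q \<in> G" "Q' \<in> G" "Q \<noteq> Q'"
        then have "Q \<in> D k" "Q' \<in> D k" using that(1) by blast+
        then show "Q \<inter> Q' = {}" using dyadic_eqI[of Q k Q'] Q(3) by fast
      qed
      show "emeasure lborel Q \<noteq> \<infinity>" if "Q \<in> G" for Q
        using dyadic_measure(2)[of Q k] that \<open>G \<subseteq> D k\<close> by auto
    qed
    also have "\<dots> = (\<Sum>Q\<in>G. ?v)" using that dyadic_measure(3) by (intro sum.cong) auto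
    finally show ?thesis by simp
  qed
  have card: "card G \<le> nat \<lceil>measure lborel S / ?v\<rceil>" if "G \<subseteq> \<Q>" "finite G" for G
  proof -
    have "real (card G) * ?v = measure lborel (\<Union>G)" using sum[of G] that assms(1) by auto
    also have "\<dots> \<le> measure lborel S"
    proof (rule measure_mono_fmeasurable)
      show "\<Union>G \<subseteq> S" using that assms(2) by blast
      have "G \<subseteq> sets lborel" using that(1) assms(1) dyadic_measure(1)[of _ k] by (auto simp: subset_iff)
      then show "\<Union>G \<in> sets lborel" by (rule sets.finite_Union[OF that(2)])
      show "S \<in> fmeasurable lborel" using assms(3,4) by (intro fmeasurableI) auto
    qed
    finally have "real (card G) \<le> measure lborel S / ?v" using v by (simp add: le_divide_eq)
    then show ?thesis by linarith
  qed
  show "finite \<Q>" using finite_if_finite_subsets_card_bdd[of \<Q>] card by blast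
  then show "real (card \<Q>) * ?v = measure lborel (\<Union>\<Q>)" using sum[OF assms(1)] by simp
qed

lemma children_eq: "Q \<in> D k \<Longrightarrow> children D Q = {Q' \<in> D (k + 1). Q' \<subseteq> Q}"
  unfolding children_def using dyadic_level_unique by blast

lemma Union_children:
  assumes "Q \<in> D k" shows "\<Union>(children D Q) = Q"
proof -
  have "x \<in> \<Union>(children D Q)" if "x \<in> Q" for x
  proof -
    obtain Q' where "Q' \<in> D (k + 1)" "x \<in> Q'" by (rule dyadic_cover)
    then show ?thesis using dyadic_nested[of Q k Q' "k + 1" x] that assms by (auto simp: children_eq[OF assms])
  qed
  then show ?thesis by (auto simp: children_def)
qed

text \<open>The axioms of a dyadic system do not mention the number of children; it follows by
  comparing the volume of \<open>Q\<close> with that of its partition into cubes of half the side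
  length.\<close>

lemma card_children:
  assumes "Q \<in> D k" shows "finite (children D Q)" "card (children D Q) = 2 ^ CARD('n)"
proof -
  have sub: "children D Q \<subseteq> D (k + 1)" "\<And>Q'. Q' \<in> children D Q \<Longrightarrow> Q' \<subseteq> Q"
    using children_eq[OF assms] by auto
  have Q: "Q \<in> sets lborel" "emeasure lborel Q < \<infinity>" using dyadic_measure(1,2)[OF assms] by auto
  show "finite (children D Q)" using finite_dyadic_in[OF sub Q] by simp
  have "real (card (children D Q)) * (2 powi (- (k + 1))) ^ CARD('n) = (2 powi (- k)) ^ CARD('n)"
    using finite_dyadic_in(2)[OF sub Q] Union_children[OF assms] dyadic_measure(3)[OF assms] by simp
  also have "(2::real) powi (- k) = 2 * 2 powi (- (k + 1))"
    by (simp add: power_int_diff)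
  finally have "real (card (children D Q)) = 2 ^ CARD('n)"
    by (simp add: power_mult_distrib)
  then show "card (children D Q) = 2 ^ CARD('n)"
    by (metis of_nat_eq_iff of_nat_numeral of_nat_power)
qed

lemma child_measure:
  assumes "Q \<in> D k" "Q' \<in> children D Q"
  shows "measure lborel Q = 2 ^ CARD('n) * measure lborel Q'"
proof -
  have "Q' \<in> D (k + 1)" using assms children_eq by auto
  moreover have "(2::real) powi (- k) = 2 * 2 powi (- (k + 1))"
    by (simp add: power_int_diff)
  ultimately show ?thesis
    using assms by (simp add: dyadic_measure(3) power_mult_distrib)
qed

lemma indicator_children:
  assumes "Q \<in> D k" shows "(\<Sum>Q'\<in>children D Q. indicator Q' x) = (indicator Q x :: 'z::semiring_1)"
proof (cases "x \<in> Q")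
  case True
  then obtain Q' where Q': "Q' \<in> children D Q" "x \<in> Q'" using Union_children[OF assms] by blast
  have "x \<notin> Q''" if "Q'' \<in> children D Q - {Q'}" for Q''
    using that Q' dyadic_eqI[of Q' "k + 1" Q'' x] by (auto simp: children_eq[OF assms])
  then show ?thesis
    using True Q' by (subst sum.remove[OF card_children(1)[OF assms] Q'(1)]) (auto intro!: sum.neutral)
next
  case False
  then have "x \<notin> Q'" if "Q' \<in> children D Q" for Q' using that by (auto simp: children_def)
  then show ?thesis using False by (auto intro!: sum.neutral)
qed

lemma bij_betw_kid:
  assumes "Q \<in> D k" shows "bij_betw (kid D Q) UNIV (children D Q)"
proof -
  have "card (UNIV :: 'n set set) = card (children D Q)"
    using card_children(2)[OF assms] by (simp add: card_UNIV_set)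
  then have "\<exists>e. bij_betw e (UNIV :: 'n set set) (children D Q)"
    using card_children(1)[OF assms] by (intro finite_same_card_bij) auto
  then show ?thesis unfolding kid_def by (rule someI_ex)
qed

lemma kid_in_children: "Q \<in> D k \<Longrightarrow> kid D Q i \<in> children D Q"
  using bij_betw_kid[of Q k] by (auto simp: bij_betw_def)

lemma kid_level: "Q \<in> D k \<Longrightarrow> kid D Q i \<in> D (k + 1)"
  using kid_in_children[of Q k i] children_eq[of Q k] by auto

lemma kid_subset: "Q \<in> D k \<Longrightarrow> kid D Q i \<subseteq> Q"
  using kid_in_children[of Q k i] children_eq[of Q k] by auto

lemma sum_kid: "Q \<in> D k \<Longrightarrow> (\<Sum>i\<in>UNIV. f (kid D Q i)) = (\<Sum>Q'\<in>children D Q. f Q')"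
  by (rule sum.reindex_bij_betw[OF bij_betw_kid])

lemma subcube_level: "R \<in> D k \<Longrightarrow> subcube D R w \<in> D (k + int (length w))"
proof (induction w)
  case (Cons i w)
  then show ?case using kid_level[of "subcube D R w" "k + int (length w)" i] by (simp add: add_ac)
qed simp

lemma subcube_cubes: "R \<in> D k \<Longrightarrow> subcube D R w \<in> cubes D"
  using subcube_level unfolding cubes_def by blast

lemma subcube_subset: "R \<in> D k \<Longrightarrow> subcube D R w \<subseteq> R"
proof (induction w)
  case (Cons i w)
  then show ?case using kid_subset[OF subcube_level[OF Cons.prems], of w i] by auto
qed simp

lemma measure_subcube:
  "R \<in> D k \<Longrightarrow> measure lborel R = (2 ^ CARD('n)) ^ length w * measure lborel (subcube D R w)"
proof (induction w)
  case (Cons i w)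
  then show ?case
    using child_measure[OF subcube_level[OF Cons.prems] kid_in_children[OF subcube_level[OF Cons.prems]], of w i] by simp
qed simp

lemma sum_indicator_subcube:
  "R \<in> D k \<Longrightarrow> (\<Sum>w\<in>words m. indicator (subcube D R w) x) = (indicator R x :: 'z::semiring_1)"
proof (induction m)
  case (Suc m)
  have "(\<Sum>i\<in>UNIV. indicator (kid D (subcube D R w) i) x) = (indicator (subcube D R w) x :: 'z)" for w
    unfolding sum_kid[OF subcube_level[OF Suc.prems], where f="\<lambda>Q. indicator Q x"]
    by (rule indicator_children[OF subcube_level[OF Suc.prems]])
  then show ?case using Suc by (simp add: sum_words_Cons)
qed simp

lemma nn_integral_subcubes:
  assumes "R \<in> D k" "h \<in> borel_measurable lborel"
  shows "(\<integral>\<^sup>+x\<in>R. h x \<partial>lborel) = (\<Sum>w\<in>words m. \<integral>\<^sup>+x\<in>subcube D R w. h x \<partial>lborel)"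
proof -
  have [measurable]: "subcube D R w \<in> sets lborel" for w
    using dyadic_measure(1)[OF subcube_level[OF assms(1)]] .
  have "(\<integral>\<^sup>+x\<in>R. h x \<partial>lborel) = (\<integral>\<^sup>+x. (\<Sum>w\<in>words m. h x * indicator (subcube D R w) x) \<partial>lborel)"
    by (simp add: sum_indicator_subcube[OF assms(1)] flip: sum_distrib_left)
  also have "\<dots> = (\<Sum>w\<in>words m. \<integral>\<^sup>+x\<in>subcube D R w. h x \<partial>lborel)"
    using assms(2) by (intro nn_integral_sum) auto
  finally show ?thesis .
qed

section \<open>Local integrability and averages over dyadic cubes\<close>

definition loc_int :: "(real^'n \<Rightarrow> 'b::real_normed_vector) \<Rightarrow> bool" where
  "loc_int f \<longleftrightarrow> smeas lborel f \<and> (\<forall>Q\<in>cubes D. (\<integral>\<^sup>+x\<in>Q. ennreal (norm (f x)) \<partial>lborel) < \<infinity>)"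

lemma loc_int_smeas: "loc_int f \<Longrightarrow> smeas lborel f"
  by (simp add: loc_int_def)

lemma loc_int_norm_measurable: "loc_int f \<Longrightarrow> (\<lambda>x. norm (f x)) \<in> borel_measurable lborel"
  by (rule smeas_norm[OF loc_int_smeas])

lemma loc_int_add:
  assumes "loc_int f" "loc_int g" shows "loc_int (\<lambda>x. f x + g x)"
  unfolding loc_int_def
proof (intro conjI ballI)
  show "smeas lborel (\<lambda>x. f x + g x)" using assms by (auto simp: loc_int_def intro: smeas_add)
  fix Q assume Q: "Q \<in> cubes D"
  note [measurable] = loc_int_norm_measurable[OF assms(1)] loc_int_norm_measurable[OF assms(2)] cubes_measure(1)[OF Q]
  have "(\<integral>\<^sup>+x\<in>Q. ennreal (norm (f x + g x)) \<partial>lborel) \<le> (\<integral>\<^sup>+x. ennreal (norm (f x)) * indicator Q x + ennreal (norm (g x)) * indicator Q x \<partial>lborel)"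
    by (intro nn_integral_mono)
      (auto simp: indicator_def norm_triangle_ineq simp flip: ennreal_plus)
  also have "\<dots> = (\<integral>\<^sup>+x\<in>Q. ennreal (norm (f x)) \<partial>lborel) + (\<integral>\<^sup>+x\<in>Q. ennreal (norm (g x)) \<partial>lborel)"
    by (rule nn_integral_add) auto
  also have "\<dots> < \<infinity>" using assms Q by (auto simp: loc_int_def)
  finally show "(\<integral>\<^sup>+x\<in>Q. ennreal (norm (f x + g x)) \<partial>lborel) < \<infinity>" .
qed

lemma loc_int_scaleR:
  assumes "loc_int f" shows "loc_int (\<lambda>x. c *\<^sub>R f x)"
  unfolding loc_int_def
proof (intro conjI ballI)
  show "smeas lborel (\<lambda>x. c *\<^sub>R f x)" using assms by (auto simp: loc_int_def intro: smeas_scaleR)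
  fix Q assume Q: "Q \<in> cubes D"
  note [measurable] = loc_int_norm_measurable[OF assms(1)] cubes_measure(1)[OF Q]
  have "(\<integral>\<^sup>+x\<in>Q. ennreal (norm (c *\<^sub>R f x)) \<partial>lborel) = (\<integral>\<^sup>+x. ennreal \<bar>c\<bar> * (ennreal (norm (f x)) * indicator Q x) \<partial>lborel)"
    by (simp add: ennreal_mult mult.assoc)
  also have "\<dots> = ennreal \<bar>c\<bar> * (\<integral>\<^sup>+x\<in>Q. ennreal (norm (f x)) \<partial>lborel)"
    by (rule nn_integral_cmult) auto
  also have "\<dots> < \<infinity>" using assms Q by (auto simp: loc_int_def ennreal_mult_less_top)
  finally show "(\<integral>\<^sup>+x\<in>Q. ennreal (norm (c *\<^sub>R f x)) \<partial>lborel) < \<infinity>" .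
qed

lemma loc_int_const: "loc_int (\<lambda>_. c)"
  unfolding loc_int_def using cubes_measure
  by (auto intro!: smeas_simple simp: nn_integral_cmult_indicator ennreal_mult_less_top)

lemma loc_int_indicator:
  assumes "loc_int f" "A \<in> sets lborel" shows "loc_int (\<lambda>x. indicator A x *\<^sub>R f x)"
  unfolding loc_int_def
proof (intro conjI ballI)
  show "smeas lborel (\<lambda>x. indicator A x *\<^sub>R f x)" using assms by (auto simp: loc_int_def intro: smeas_scaleR_indicator)
  fix Q assume Q: "Q \<in> cubes D"
  have "(\<integral>\<^sup>+x\<in>Q. ennreal (norm (indicator A x *\<^sub>R f x)) \<partial>lborel) \<le> (\<integral>\<^sup>+x\<in>Q. ennreal (norm (f x)) \<partial>lborel)"
    by (intro nn_integral_mono) (auto simp: indicator_def)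
  also have "\<dots> < \<infinity>" using assms Q by (auto simp: loc_int_def)
  finally show "(\<integral>\<^sup>+x\<in>Q. ennreal (norm (indicator A x *\<^sub>R f x)) \<partial>lborel) < \<infinity>" .
qed

lemma nn_integral_norm_indicator:
  "(\<integral>\<^sup>+x. ennreal (norm (indicator Q x *\<^sub>R f x)) \<partial>M) = (\<integral>\<^sup>+x\<in>Q. ennreal (norm (f x)) \<partial>M)"
  by (intro nn_integral_cong) (auto simp: indicator_def)

lemma has_bint_average:
  fixes f :: "real^'n \<Rightarrow> 'b::banach"
  assumes "loc_int f" "Q \<in> cubes D"
  shows "has_bint lborel (\<lambda>x. indicator Q x *\<^sub>R f x) (measure lborel Q *\<^sub>R average f Q)"
proof -
  have "\<exists>v. has_bint lborel (\<lambda>x. indicator Q x *\<^sub>R f x) v"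
  proof (rule has_bint_exists)
    show "smeas lborel (\<lambda>x. indicator Q x *\<^sub>R f x)"
      by (rule smeas_scaleR_indicator[OF loc_int_smeas[OF assms(1)] cubes_measure(1)[OF assms(2)]])
    show "(\<integral>\<^sup>+x. ennreal (norm (indicator Q x *\<^sub>R f x)) \<partial>lborel) < \<infinity>"
      using assms unfolding nn_integral_norm_indicator by (auto simp: loc_int_def)
  qed
  then show ?thesis
    using cubes_measure(3)[OF assms(2)] has_bint_bint_eq by (force simp: average_def)
qed

lemma average_eqI:
  assumes "has_bint lborel (\<lambda>x. indicator Q x *\<^sub>R f x) (measure lborel Q *\<^sub>R v)" "Q \<in> cubes D"
  shows "average f Q = v"
  using has_bint_bint_eq[OF assms(1)] cubes_measure(3)[OF assms(2)] by (simp add: average_def)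

lemma average_add:
  fixes f g :: "real^'n \<Rightarrow> 'b::banach"
  assumes "loc_int f" "loc_int g" "Q \<in> cubes D"
  shows "average (\<lambda>x. f x + g x) Q = average f Q + average g Q"
  using has_bint_add[OF has_bint_average[OF assms(1,3)] has_bint_average[OF assms(2,3)]] assms(3)
  by (intro average_eqI) (simp_all add: scaleR_add_right)

lemma average_const: "Q \<in> cubes D \<Longrightarrow> average (\<lambda>_. c) Q = c"
  using has_bint_indicator[of Q lborel c] cubes_measure[of Q] by (intro average_eqI) auto

lemma average_cong_on:
  assumes "\<And>x. x \<in> Q \<Longrightarrow> f x = g x" shows "average f Q = average g Q"
proof -
  have "(\<lambda>x. indicator Q x *\<^sub>R f x) = (\<lambda>x. indicator Q x *\<^sub>R g x)"
    using assms by (auto simp: indicator_def fun_eq_iff)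
  then show ?thesis by (simp add: average_def)
qed

lemma martingale_average:
  fixes f :: "real^'n \<Rightarrow> 'b::banach"
  assumes f: "loc_int f" and R: "R \<in> D k"
  shows "martingale (\<lambda>w. average f (subcube D R w))"
  unfolding martingale_def
proof
  fix w
  let ?Q = "subcube D R w"
  have Q: "?Q \<in> D (k + int (length w))" by (rule subcube_level[OF R])
  have sub: "Q' \<in> cubes D" if "Q' \<in> children D ?Q" for Q'
    using that children_eq[OF Q] by (auto simp: cubes_def)
  have "has_bint lborel (\<lambda>x. \<Sum>Q'\<in>children D ?Q. indicator Q' x *\<^sub>R f x) (\<Sum>Q'\<in>children D ?Q. measure lborel Q' *\<^sub>R average f Q')"
    by (intro has_bint_sum has_bint_average f sub)
  also have "(\<lambda>x. \<Sum>Q'\<in>children D ?Q. indicator Q' x *\<^sub>R f x) = (\<lambda>x. indicator ?Q x *\<^sub>R f x)"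
    by (simp add: scaleR_sum_left[symmetric] indicator_children[OF Q])
  also have "(\<Sum>Q'\<in>children D ?Q. measure lborel Q' *\<^sub>R average f Q')
      = measure lborel ?Q *\<^sub>R ((1 / 2 ^ CARD('n)) *\<^sub>R (\<Sum>Q'\<in>children D ?Q. average f Q'))"
    unfolding scaleR_sum_right using child_measure[OF Q] by (intro sum.cong) auto
  finally have "average f ?Q = (1 / 2 ^ CARD('n)) *\<^sub>R (\<Sum>Q'\<in>children D ?Q. average f Q')"
    by (rule average_eqI) (rule subcube_cubes[OF R])
  also have "(\<Sum>Q'\<in>children D ?Q. average f Q') = (\<Sum>i\<in>UNIV. average f (subcube D R (i # w)))"
    using sum_kid[OF Q, of "average f"] by simp
  finally show "(\<Sum>i\<in>UNIV. average f (subcube D R (i # w))) = real CARD('n set) *\<^sub>R average f ?Q"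
    by (simp add: card_UNIV_set)
qed

definition norm_average :: "(real^'n \<Rightarrow> 'b::real_normed_vector) \<Rightarrow> (real^'n) set \<Rightarrow> real" where
  "norm_average f Q = enn2real (\<integral>\<^sup>+x\<in>Q. ennreal (norm (f x)) \<partial>lborel) / measure lborel Q"

lemma norm_average_le:
  fixes f :: "real^'n \<Rightarrow> 'b::banach"
  assumes "loc_int f" "Q \<in> cubes D"
  shows "norm (average f Q) \<le> norm_average f Q"
proof -
  have fin: "(\<integral>\<^sup>+x\<in>Q. ennreal (norm (f x)) \<partial>lborel) < \<infinity>" using assms by (auto simp: loc_int_def)
  have "ennreal (norm (measure lborel Q *\<^sub>R average f Q)) \<le> (\<integral>\<^sup>+x\<in>Q. ennreal (norm (f x)) \<partial>lborel)"
    using has_bint_norm_le[OF has_bint_average[OF assms]] unfolding nn_integral_norm_indicator .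
  then have "norm (measure lborel Q *\<^sub>R average f Q) \<le> enn2real (\<integral>\<^sup>+x\<in>Q. ennreal (norm (f x)) \<partial>lborel)"
    using fin enn2real_mono[of "ennreal (norm (measure lborel Q *\<^sub>R average f Q))"] by fastforce
  then show ?thesis
    using cubes_measure(3)[OF assms(2)] by (simp add: norm_average_def le_divide_eq mult.commute)
qed

lemma martingale_norm_average:
  assumes f: "loc_int f" and R: "R \<in> D k"
  shows "martingale (\<lambda>w. norm_average f (subcube D R w))"
  unfolding martingale_def
proof
  fix w
  let ?Q = "subcube D R w"
  let ?J = "\<lambda>Q. \<integral>\<^sup>+x\<in>Q. ennreal (norm (f x)) \<partial>lborel"
  have Q: "?Q \<in> D (k + int (length w))" by (rule subcube_level[OF R])
  note [measurable] = loc_int_norm_measurable[OF f]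
  have "words (Suc 0) = (\<lambda>i. [i]) ` (UNIV :: 'n set set)"
    by (auto simp: words_def length_Suc_conv)
  then have "?J ?Q = (\<Sum>i\<in>UNIV. ?J (subcube D R (i # w)))"
    using nn_integral_subcubes[OF Q, where h="\<lambda>x. ennreal (norm (f x))" and m="Suc 0"] by (simp add: sum.reindex inj_on_def)
  moreover have "?J (subcube D R (i # w)) < \<infinity>" for i
    using f subcube_cubes[OF R] unfolding loc_int_def by blast
  ultimately have "enn2real (?J ?Q) = (\<Sum>i\<in>UNIV. enn2real (?J (subcube D R (i # w))))"
    by (simp add: enn2real_sum)
  moreover have "measure lborel (subcube D R (i # w)) = measure lborel ?Q / 2 ^ CARD('n)" for i
    unfolding child_measure[OF Q kid_in_children[OF Q, of i]] by simp
  moreover have "0 < measure lborel ?Q" using dyadic_measure_pos[OF Q] .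
  ultimately show "(\<Sum>i\<in>UNIV. norm_average f (subcube D R (i # w))) = real CARD('n set) *\<^sub>R norm_average f ?Q"
    by (simp add: norm_average_def card_UNIV_set sum_distrib_left sum_divide_distrib mult_ac del: subcube.simps)
qed

lemma norm_average_Jensen:
  assumes "loc_int f" "Q \<in> cubes D" "1 < p"
  shows "ennreal (norm_average f Q powr p * measure lborel Q) \<le> Lp_int_on Q p f"
  unfolding norm_average_def
  by (rule nn_integral_Jensen_powr[OF loc_int_norm_measurable[OF assms(1)]])
    (use assms cubes_measure[OF assms(2)] in auto)

lemma average_Jensen:
  fixes f :: "real^'n \<Rightarrow> 'b::banach"
  assumes "loc_int f" "Q \<in> cubes D" "1 < p"
  shows "ennreal (norm (average f Q) powr p * measure lborel Q) \<le> Lp_int_on Q p f"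
proof -
  have "norm (average f Q) powr p * measure lborel Q \<le> norm_average f Q powr p * measure lborel Q"
    using norm_average_le[OF assms(1,2)] assms(3) by (intro mult_right_mono powr_mono2) auto
  then show ?thesis using norm_average_Jensen[OF assms] by (meson ennreal_leI order_trans)
qed

text \<open>The averages at depth \<open>m\<close> are a conditional expectation, which contracts
  the L^p norm of \<open>f - c\<close>: Jensen's inequality on each subcube, summed over the
  partition.\<close>

lemma sum_average_diff_le:
  fixes f :: "real^'n \<Rightarrow> 'b::banach"
  assumes f: "loc_int f" and R: "R \<in> D k" and p: "1 < p"
  shows "ennreal (\<Sum>w\<in>words m. norm (average f (subcube D R w) - c) powr p * (measure lborel R / (2 ^ CARD('n)) ^ m))
    \<le> Lp_int_on R p (\<lambda>x. f x - c)"
proof -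
  have fc: "loc_int (\<lambda>x. f x + - c)" by (intro loc_int_add f loc_int_const)
  have fcm[measurable]: "(\<lambda>x. norm (f x - c)) \<in> borel_measurable lborel"
    using loc_int_norm_measurable[OF fc] by simp
  have "ennreal (\<Sum>w\<in>words m. norm (average f (subcube D R w) - c) powr p * (measure lborel R / (2 ^ CARD('n)) ^ m))
      = (\<Sum>w\<in>words m. ennreal (norm (average f (subcube D R w) - c) powr p * (measure lborel R / (2 ^ CARD('n)) ^ m)))"
    by (rule sum_ennreal[symmetric]) simp
  also have "\<dots> \<le> (\<Sum>w\<in>words m. Lp_int_on (subcube D R w) p (\<lambda>x. f x - c))"
  proof (rule sum_mono)
    fix w :: "'n set list" assume w: "w \<in> words m"
    have Q: "subcube D R w \<in> cubes D" by (rule subcube_cubes[OF R])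
    have "average (\<lambda>x. f x + - c) (subcube D R w) = average f (subcube D R w) - c"
      using average_add[OF f loc_int_const Q, of "- c"] average_const[OF Q] by simp
    moreover have "measure lborel R / (2 ^ CARD('n)) ^ m = measure lborel (subcube D R w)"
      using measure_subcube[OF R, of w] w by (simp add: words_def)
    ultimately show "ennreal (norm (average f (subcube D R w) - c) powr p * (measure lborel R / (2 ^ CARD('n)) ^ m))
        \<le> Lp_int_on (subcube D R w) p (\<lambda>x. f x - c)"
      using average_Jensen[OF fc Q p] by simp
  qed
  also have "\<dots> = Lp_int_on R p (\<lambda>x. f x - c)"
    by (rule nn_integral_subcubes[OF R, symmetric]) auto
  finally show ?thesis .
qed

end

section \<open>Density of dyadic step functions\<close>

lemma nn_integral_powr_add_weighted:
  assumes "smeas M f" "smeas M g" "1 \<le> p" "0 < c" "c < 1"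
  shows "Lp_int M p (\<lambda>x. f x + g x)
    \<le> ennreal (c powr (1 - p)) * Lp_int M p f
      + ennreal ((1 - c) powr (1 - p)) * Lp_int M p g"
proof -
  note [measurable] = smeas_norm[OF assms(1)] smeas_norm[OF assms(2)]
  have "Lp_int M p (\<lambda>x. f x + g x)
      \<le> (\<integral>\<^sup>+x. ennreal (c powr (1 - p)) * ennreal (norm (f x) powr p) + ennreal ((1 - c) powr (1 - p)) * ennreal (norm (g x) powr p) \<partial>M)"
  proof (rule nn_integral_mono)
    fix x
    have "norm (f x + g x) powr p \<le> (norm (f x) + norm (g x)) powr p"
      using norm_triangle_ineq assms(3) by (intro powr_mono2) auto
    also have "\<dots> \<le> c powr (1 - p) * norm (f x) powr p + (1 - c) powr (1 - p) * norm (g x) powr p"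
      using assms by (intro powr_add_le_weighted) auto
    finally show "ennreal (norm (f x + g x) powr p)
        \<le> ennreal (c powr (1 - p)) * ennreal (norm (f x) powr p) + ennreal ((1 - c) powr (1 - p)) * ennreal (norm (g x) powr p)"
      by (simp add: ennreal_leI flip: ennreal_mult ennreal_plus)
  qed
  also have "\<dots> = ennreal (c powr (1 - p)) * Lp_int M p f
      + ennreal ((1 - c) powr (1 - p)) * Lp_int M p g"
    by (subst nn_integral_add) (auto simp: nn_integral_cmult)
  finally show ?thesis .
qed

lemma nn_integral_powr_add_le:
  assumes "smeas M f" "smeas M g" "1 \<le> p"
  shows "Lp_int M p (\<lambda>x. f x + g x)
    \<le> ennreal (2 powr p) * (Lp_int M p f + Lp_int M p g)"
proof -
  note [measurable] = smeas_norm[OF assms(1)] smeas_norm[OF assms(2)]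
  have "Lp_int M p (\<lambda>x. f x + g x)
      \<le> (\<integral>\<^sup>+x. ennreal (2 powr p) * (ennreal (norm (f x) powr p) + ennreal (norm (g x) powr p)) \<partial>M)"
  proof (rule nn_integral_mono)
    fix x
    have "norm (f x + g x) powr p \<le> (norm (f x) + norm (g x)) powr p"
      using norm_triangle_ineq assms(3) by (intro powr_mono2) auto
    also have "\<dots> \<le> 2 powr p * (norm (f x) powr p + norm (g x) powr p)"
      using assms by (intro powr_add_le) auto
    finally show "ennreal (norm (f x + g x) powr p)
        \<le> ennreal (2 powr p) * (ennreal (norm (f x) powr p) + ennreal (norm (g x) powr p))"
      by (simp add: ennreal_leI flip: ennreal_mult ennreal_plus)
  qed
  also have "\<dots> = ennreal (2 powr p) * (Lp_int M p f + Lp_int M p g)"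
    by (subst nn_integral_cmult) (auto simp: nn_integral_add)
  finally show ?thesis .
qed

context dyadic_grid
begin

inductive step :: "(real^'n \<Rightarrow> 'b::real_normed_vector) \<Rightarrow> bool" where
  step_0: "step (\<lambda>_. 0)"
| step_add: "step s \<Longrightarrow> Q \<in> cubes D \<Longrightarrow> step (\<lambda>x. s x + indicator Q x *\<^sub>R c)"

lemma step_plus: "step t \<Longrightarrow> step s \<Longrightarrow> step (\<lambda>x. s x + t x)"
proof (induction rule: step.induct)
  case (step_add t Q c)
  then have "step (\<lambda>x. (s x + t x) + indicator Q x *\<^sub>R c)" by (intro step.step_add) auto
  then show ?case by (simp add: add.assoc)
qed simp

lemma step_sum: "(\<And>i. i \<in> I \<Longrightarrow> step (s i)) \<Longrightarrow> step (\<lambda>x. \<Sum>i\<in>I. s i x)"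
proof (induction I rule: infinite_finite_induct)
  case (insert i I)
  then have "step (\<lambda>x. s i x + (\<Sum>i\<in>I. s i x))" by (intro step_plus) auto
  then show ?case using insert by simp
qed (auto intro: step_0)

lemma step_indicator: "Q \<in> cubes D \<Longrightarrow> step (\<lambda>x. indicator Q x *\<^sub>R c)"
  using step_add[OF step_0] by fastforce

lemma smeas_step: "step s \<Longrightarrow> smeas lborel s"
proof (induction rule: step.induct)
  case (step_add s Q c)
  then show ?case
    using smeas_scaleR_indicator[OF smeas_simple[OF simple_function_const[of lborel c]] cubes_measure(1)]
    by (intro smeas_add) auto
qed (auto intro: smeas_simple)

lemma step_const_on_small:
  "step s \<Longrightarrow> \<exists>K. \<forall>k\<ge>K. \<forall>Q\<in>D k. \<exists>v. \<forall>x\<in>Q. s x = v"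
proof (induction rule: step.induct)
  case (step_add s Q c)
  obtain K where K: "\<And>k Q. k \<ge> K \<Longrightarrow> Q \<in> D k \<Longrightarrow> \<exists>v. \<forall>x\<in>Q. s x = v" using step_add by blast
  obtain j where j: "Q \<in> D j" using step_add(2) by (auto simp: cubes_def)
  have "\<exists>v. \<forall>x\<in>Q'. s x + indicator Q x *\<^sub>R c = v" if k: "k \<ge> max K j" and Q': "Q' \<in> D k" for k Q'
  proof -
    obtain v where v: "\<And>x. x \<in> Q' \<Longrightarrow> s x = v" using K[of k Q'] k Q' by auto
    show ?thesis
    proof (cases "Q \<inter> Q' = {}")
      case True
      then have "\<forall>x\<in>Q'. s x + indicator Q x *\<^sub>R c = v" using v by (auto simp: indicator_def)
      then show ?thesis by blast
    next
      case False
      then have "Q' \<subseteq> Q" using dyadic_nested[OF j Q'] k by auto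
      then have "\<forall>x\<in>Q'. s x + indicator Q x *\<^sub>R c = v + c" using v by (auto simp: indicator_def)
      then show ?thesis by blast
    qed
  qed
  then show ?case by blast
qed auto

definition step_approx :: "real \<Rightarrow> (real^'n \<Rightarrow> 'b::real_normed_vector) \<Rightarrow> bool" where
  "step_approx p h \<longleftrightarrow> (\<forall>e>0. \<exists>s. step s \<and> Lp_int lborel p (\<lambda>x. h x - s x) \<le> ennreal e)"

lemma step_approx_add:
  assumes "smeas lborel f" "smeas lborel g" "step_approx p f" "step_approx p g" "1 \<le> p"
  shows "step_approx p (\<lambda>x. f x + g x)"
  unfolding step_approx_def
proof (intro allI impI)
  fix e :: real assume e: "0 < e"
  let ?e = "e / (2 powr p * 2)"
  have e': "0 < ?e" using e by simp
  obtain s where s: "step s" "Lp_int lborel p (\<lambda>x. f x - s x) \<le> ennreal ?e"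
    using assms(3) e' unfolding step_approx_def by blast
  obtain t where t: "step t" "Lp_int lborel p (\<lambda>x. g x - t x) \<le> ennreal ?e"
    using assms(4) e' unfolding step_approx_def by blast
  have "Lp_int lborel p (\<lambda>x. f x + g x - (s x + t x))
      = Lp_int lborel p (\<lambda>x. (f x - s x) + (g x - t x))"
    by (simp add: algebra_simps)
  also have "\<dots> \<le> ennreal (2 powr p) * (Lp_int lborel p (\<lambda>x. f x - s x) + Lp_int lborel p (\<lambda>x. g x - t x))"
    by (intro nn_integral_powr_add_le smeas_diff assms(1,2,5) smeas_step s(1) t(1))
  also have "\<dots> \<le> ennreal (2 powr p) * (ennreal ?e + ennreal ?e)"
    using s t by (intro mult_left_mono add_mono) auto
  also have "\<dots> = ennreal e"
    using e' by (simp flip: ennreal_plus ennreal_mult)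
  finally show "\<exists>s. step s \<and> Lp_int lborel p (\<lambda>x. f x + g x - s x) \<le> ennreal e"
    using step_plus[OF t(1) s(1)] by blast
qed

lemma step_approx_0: "0 < p \<Longrightarrow> step_approx p (\<lambda>_. 0)"
  unfolding step_approx_def using step_0 by (auto intro!: exI[of _ "\<lambda>_. 0"])

lemma step_approx_sum:
  assumes "\<And>i. i \<in> I \<Longrightarrow> smeas lborel (f i)" "\<And>i. i \<in> I \<Longrightarrow> step_approx p (f i)" "1 \<le> p"
  shows "smeas lborel (\<lambda>x. \<Sum>i\<in>I. f i x) \<and> step_approx p (\<lambda>x. \<Sum>i\<in>I. f i x)"
  using assms(1,2)
proof (induction I rule: infinite_finite_induct)
  case (insert i I)
  then show ?case using assms(3) by (auto intro: smeas_add step_approx_add)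
qed (use assms(3) in \<open>auto intro: step_approx_0 smeas_simple\<close>)

lemma small_dyadic_cube:
  assumes "open U" "x \<in> U"
  obtains n where "\<And>k Q. n \<le> k \<Longrightarrow> Q \<in> D (int k) \<Longrightarrow> x \<in> Q \<Longrightarrow> Q \<subseteq> U"
proof -
  obtain r where r: "0 < r" "ball x r \<subseteq> U" using assms openE by blast
  \<comment> \<open>A cube of generation k has diameter at most d 2^(-k) in the l1 norm, which
    dominates the Euclidean one.\<close>
  obtain n where n: "(1/2) ^ n < r / CARD('n)"
    using real_arch_pow_inv[of "r / CARD('n)" "1/2"] r by auto
  have "Q \<subseteq> U" if k: "n \<le> k" and Q: "Q \<in> D (int k)" "x \<in> Q" for k Q
  proof
    fix y assume y: "y \<in> Q"
    obtain a where a: "Q = {x. \<forall>i. a $ i \<le> x $ i \<and> x $ i < a $ i + 2 powi (- int k)}"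
      using D Q(1) unfolding dyadic_system_def by blast
    have pw: "2 powi (- int k) = (1/2 :: real) ^ k"
      by (simp add: power_int_minus power_one_over inverse_eq_divide)
    have "\<bar>(x - y) $ i\<bar> \<le> (1/2) ^ k" for i
    proof -
      have "a $ i \<le> x $ i \<and> x $ i < a $ i + (1/2) ^ k" "a $ i \<le> y $ i \<and> y $ i < a $ i + (1/2) ^ k"
        using y Q(2) unfolding a pw by auto
      then show ?thesis by (simp add: abs_le_iff)
    qed
    then have "(\<Sum>i\<in>UNIV. \<bar>(x - y) $ i\<bar>) \<le> CARD('n) * (1/2) ^ k"
      by (intro sum_bounded_above[THEN order_trans]) auto
    also have "\<dots> \<le> CARD('n) * (1/2) ^ n"
      using k by (intro mult_left_mono power_decreasing) auto
    also have "\<dots> < r" using n by (simp add: field_simps)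
    finally have "dist x y < r" using norm_le_l1_cart[of "x - y"] by (simp add: dist_norm)
    then show "y \<in> U" using r by auto
  qed
  then show ?thesis by (rule that)
qed

text \<open>The sets \<open>W n\<close>, finite disjoint unions of cubes of one generation, increase
  to \<open>U\<close> because small cubes around a point of \<open>U\<close> stay in
  \<open>U\<close>. As \<open>U\<close> has finite measure, the measure of the remainder tends to
  0.\<close>

lemma open_approx_cubes:
  assumes "open U" "emeasure lborel U < \<infinity>" "0 < (e::real)"
  obtains W where "W \<subseteq> U" "W \<in> sets lborel" "emeasure lborel (U - W) < ennreal e" "\<And>c. step (\<lambda>x. indicator W x *\<^sub>R (c::'b::real_normed_vector))"
proof -
  define \<Q> where "\<Q> n = {Q \<in> D (int n). Q \<subseteq> U \<inter> ball 0 (real n)}" for n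
  define W where "W n = \<Union>(\<Q> n)" for n
  have U: "U \<in> sets lborel" using assms(1) by simp
  have fin: "finite (\<Q> n)" for n
    by (rule finite_dyadic_in(1)[of "\<Q> n" "int n" U]) (use assms(2) U in \<open>auto simp: \<Q>_def\<close>)
  have "\<Q> n \<subseteq> sets lborel" for n
    using dyadic_measure(1) by (auto simp: \<Q>_def)
  then have Ws: "W n \<in> sets lborel" for n
    unfolding W_def using fin by (intro sets.finite_Union)
  have inc: "W n \<subseteq> W (Suc n)" for n
  proof
    fix x assume "x \<in> W n"
    then obtain Q where Q: "Q \<in> D (int n)" "Q \<subseteq> U \<inter> ball 0 (real n)" "x \<in> Q" by (auto simp: W_def \<Q>_def)
    obtain Q' where Q': "Q' \<in> D (int (Suc n))" "x \<in> Q'" by (rule dyadic_cover)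
    have "Q' \<subseteq> Q" using dyadic_nested[OF Q(1) Q'(1) _ Q(3) Q'(2)] by simp
    moreover have "ball (0::real^'n) (real n) \<subseteq> ball 0 (real (Suc n))" by (rule subset_ball) simp
    ultimately have "Q' \<subseteq> U \<inter> ball 0 (real (Suc n))" using Q(2) by blast
    then show "x \<in> W (Suc n)" using Q' unfolding W_def \<Q>_def by blast
  qed
  have UW: "(\<Inter>n. U - W n) = {}"
  proof -
    have "\<exists>n. x \<in> W n" if x: "x \<in> U" for x
    proof -
      obtain m where m: "norm x < real m" using reals_Archimedean2 by blast
      have "open (U \<inter> ball 0 (real m))" using assms(1) by auto
      moreover have "x \<in> U \<inter> ball 0 (real m)" using x m by simp
      ultimately obtain n where n: "\<And>k Q. n \<le> k \<Longrightarrow> Q \<in> D (int k) \<Longrightarrow> x \<in> Q \<Longrightarrow> Q \<subseteq> U \<inter> ball 0 (real m)"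
        by (rule small_dyadic_cube) blast
      obtain Q where Q: "Q \<in> D (int (max m n))" "x \<in> Q" by (rule dyadic_cover)
      have "Q \<subseteq> U \<inter> ball 0 (real m)" using n[OF _ Q] by simp
      moreover have "ball (0::real^'n) (real m) \<subseteq> ball 0 (real (max m n))" by (rule subset_ball) simp
      ultimately have "Q \<in> \<Q> (max m n)" using Q(1) unfolding \<Q>_def by blast
      then show ?thesis using Q(2) by (auto simp: W_def)
    qed
    then show ?thesis by auto
  qed
  have "(\<lambda>n. emeasure lborel (U - W n)) \<longlonglongrightarrow> emeasure lborel (\<Inter>n. U - W n)"
  proof (rule Lim_emeasure_decseq)
    show "range (\<lambda>n. U - W n) \<subseteq> sets lborel" using U Ws by auto
    show "decseq (\<lambda>n. U - W n)" using inc by (intro decseq_SucI) auto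
    show "emeasure lborel (U - W n) \<noteq> \<infinity>" for n
    proof -
      have "emeasure lborel (U - W n) \<le> emeasure lborel U" using U by (intro emeasure_mono) auto
      then show ?thesis using assms(2) by (auto simp: top_unique)
    qed
  qed
  then have "(\<lambda>n. emeasure lborel (U - W n)) \<longlonglongrightarrow> 0" unfolding UW by simp
  then have "eventually (\<lambda>n. emeasure lborel (U - W n) < ennreal e) sequentially"
    using assms(3) by (intro order_tendstoD) auto
  then obtain n where n: "emeasure lborel (U - W n) < ennreal e"
    using eventually_happens'[OF sequentially_bot] by blast
  show ?thesis
  proof (rule that[OF _ Ws n])
    show "W n \<subseteq> U" by (auto simp: W_def \<Q>_def)
    fix c :: 'b
    have disj: "disjoint_family_on (\<lambda>Q. Q) (\<Q> n)"
      unfolding disjoint_family_on_def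
    proof (intro ballI impI)
      fix Q Q' assume "Q \<in> \<Q> n" "Q' \<in> \<Q> n" "Q \<noteq> Q'"
      then show "Q \<inter> Q' = {}" using dyadic_eqI[of Q "int n" Q'] by (auto simp: \<Q>_def)
    qed
    have "indicat_real (W n) x = (\<Sum>Q\<in>\<Q> n. indicator Q x)" for x
      using indicator_UN_disjoint[OF fin disj] by (simp add: W_def)
    then have "indicator (W n) x *\<^sub>R c = (\<Sum>Q\<in>\<Q> n. indicator Q x *\<^sub>R c)" for x
      by (simp add: scaleR_sum_left)
    moreover have "step (\<lambda>x. \<Sum>Q\<in>\<Q> n. indicator Q x *\<^sub>R c)"
      by (rule step_sum, rule step_indicator) (auto simp: \<Q>_def cubes_def)
    ultimately show "step (\<lambda>x. indicator (W n) x *\<^sub>R c)" by simp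
  qed
qed

lemma step_approx_indicator:
  fixes c :: "'b::real_normed_vector"
  assumes A: "A \<in> sets lborel" "emeasure lborel A < \<infinity>" and p: "0 < p"
  shows "step_approx p (\<lambda>x. indicator A x *\<^sub>R c)"
  unfolding step_approx_def
proof (intro allI impI)
  fix e :: real assume e: "0 < e"
  \<comment> \<open>Two errors of measure \<open>\<delta>\<close> occur, weighted by
    \<open>norm c powr p\<close>; the added 1 prevents division by 0.\<close>
  define \<delta> where "\<delta> = e / (2 * (norm c powr p + 1))"
  have np: "0 \<le> norm c powr p" by simp
  have \<delta>: "0 < \<delta>" using e np unfolding \<delta>_def by (intro divide_pos_pos mult_pos_pos add_nonneg_pos) auto
  obtain U where U: "open U" "A \<subseteq> U" "emeasure lborel (U - A) < \<delta>"
    using outer_regular_lborel[of A \<delta>] A(1) \<delta> by auto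
  have "emeasure lborel U \<le> emeasure lborel A + emeasure lborel (U - A)"
    using emeasure_subadditive[of A lborel "U - A"] A U by (simp add: Un_absorb1)
  also have "\<dots> < \<infinity>" using A(2) U(3) by (auto simp: less_top[symmetric])
  finally obtain W where W: "W \<subseteq> U" "W \<in> sets lborel" "emeasure lborel (U - W) < ennreal \<delta>"
      "\<And>c. step (\<lambda>x. indicator W x *\<^sub>R (c::'b))"
    using open_approx_cubes[OF U(1) _ \<delta>, where 'b='b] by blast
  \<comment> \<open>\<open>A\<close> and \<open>W\<close> both lie in \<open>U\<close>, so they
    differ only where one of them misses a point of \<open>U\<close>.\<close>
  have "Lp_int lborel p (\<lambda>x. indicator A x *\<^sub>R c - indicator W x *\<^sub>R c)
      \<le> (\<integral>\<^sup>+x. ennreal (norm c powr p) * indicator ((U - A) \<union> (U - W)) x \<partial>lborel)"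
    using U(2) W(1) p by (intro nn_integral_mono) (auto simp: indicator_def)
  also have "\<dots> = ennreal (norm c powr p) * emeasure lborel ((U - A) \<union> (U - W))"
    using A U W by (intro nn_integral_cmult_indicator) auto
  also have "\<dots> \<le> ennreal (norm c powr p) * (emeasure lborel (U - A) + emeasure lborel (U - W))"
    using A U W by (intro mult_left_mono emeasure_subadditive) auto
  also have "\<dots> \<le> ennreal (norm c powr p) * (ennreal \<delta> + ennreal \<delta>)"
    using U(3) W(3) by (intro mult_left_mono add_mono) auto
  also have "\<dots> = ennreal (norm c powr p * (2 * \<delta>))"
    using \<delta> by (simp flip: ennreal_plus ennreal_mult)
  also have "\<dots> \<le> ennreal e"
  proof (rule ennreal_leI)
    have "norm c powr p * (2 * \<delta>) \<le> (norm c powr p + 1) * (2 * \<delta>)"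
      using \<delta> by (intro mult_right_mono) auto
    also have "\<dots> = e"
    proof -
      have "M * (2 * (e / (2 * M))) = e" if "M \<noteq> 0" for M using that by simp
      then show ?thesis unfolding \<delta>_def using np by (metis add_nonneg_pos less_irrefl zero_less_one)
    qed
    finally show "norm c powr p * (2 * \<delta>) \<le> e" .
  qed
  finally show "\<exists>s. step s \<and> Lp_int lborel p (\<lambda>x. indicator A x *\<^sub>R c - s x) \<le> ennreal e"
    using W(4) by blast
qed

lemma step_approx_simple:
  assumes t: "Bochner_Integration.simple_bochner_integrable lborel t" and p: "1 \<le> p"
  shows "step_approx p t"
proof -
  have sf: "simple_function lborel t" and supp: "emeasure lborel {y. t y \<noteq> 0} \<noteq> \<infinity>"
    using t by (auto elim: Bochner_Integration.simple_bochner_integrable.cases)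
  have fin: "finite (range t)" using sf by (simp add: simple_function_def)
  have lev: "t -` {c} \<in> sets lborel" for c
  proof (cases "c \<in> range t")
    case True
    then show ?thesis using sf by (auto simp: simple_function_def)
  next
    case False
    then have "t -` {c} = {}" by auto
    then show ?thesis by simp
  qed
  have supp_eq: "{y. t y \<noteq> 0} = (\<Union>c\<in>range t - {0}. t -` {c})" by auto
  have "{y. t y \<noteq> 0} \<in> sets lborel"
    unfolding supp_eq using fin lev by (intro sets.finite_UN) auto
  then have "emeasure lborel (t -` {c}) \<le> emeasure lborel {y. t y \<noteq> 0}" if "c \<noteq> 0" for c
    using that by (intro emeasure_mono) auto
  then have levfin: "emeasure lborel (t -` {c}) < \<infinity>" if "c \<noteq> 0" for c
    using supp that by (metis infinity_ennreal_def less_top top_unique)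
  have "step_approx p (\<lambda>x. \<Sum>c\<in>range t - {0}. indicator (t -` {c}) x *\<^sub>R c)"
  proof (rule step_approx_sum[THEN conjunct2, OF _ _ p])
    show "smeas lborel (\<lambda>x. indicator (t -` {c}) x *\<^sub>R c)" for c
      by (rule smeas_scaleR_indicator[OF smeas_simple[OF simple_function_const] lev])
    show "step_approx p (\<lambda>x. indicator (t -` {c}) x *\<^sub>R c)" if "c \<in> range t - {0}" for c
      using that p by (intro step_approx_indicator lev levfin) auto
  qed
  moreover have "(\<Sum>c\<in>range t - {0}. indicator (t -` {c}) x *\<^sub>R c) = t x" for x
  proof (cases "t x = 0")
    case False
    then show ?thesis using fin by (subst sum.remove[of _ "t x"]) (auto intro!: sum.neutral)
  qed (auto intro!: sum.neutral simp: indicator_def)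
  ultimately show ?thesis by simp
qed

lemma step_dense:
  assumes h: "smeas lborel h" "Lp_int lborel p h < \<infinity>" and p: "1 \<le> p" and e: "0 < e"
  obtains s where "step s" "Lp_int lborel p (\<lambda>x. h x - s x) \<le> ennreal e"
proof -
  obtain t where t: "\<And>i. Bochner_Integration.simple_bochner_integrable lborel (t i)"
    "(\<lambda>i::nat. Lp_int lborel p (\<lambda>x. h x - t i x)) \<longlonglongrightarrow> 0"
    by (rule smeas_approx_simple_Lp[OF h(1) _ h(2)]) (use p in auto)
  let ?e = "e / (2 powr p * 2)"
  have e': "0 < ?e" using e by simp
  then have "eventually (\<lambda>i. (Lp_int lborel p (\<lambda>x. h x - t i x)) < ennreal ?e) sequentially"
    by (intro order_tendstoD(2)[OF t(2)]) (simp add: ennreal_less_zero_iff)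
  then obtain i where i: "Lp_int lborel p (\<lambda>x. h x - t i x) < ennreal ?e"
    using eventually_happens'[OF sequentially_bot] by blast
  obtain s where s: "step s" "Lp_int lborel p (\<lambda>x. t i x - s x) \<le> ennreal ?e"
    using step_approx_simple[OF t(1) p, of i] e' unfolding step_approx_def by blast
  have tm: "smeas lborel (t i)" by (rule smeas_simple[OF simple_bochner_integrable_simple[OF t(1)]])
  have "Lp_int lborel p (\<lambda>x. h x - s x)
      = Lp_int lborel p (\<lambda>x. (h x - t i x) + (t i x - s x))"
    by simp
  also have "\<dots> \<le> ennreal (2 powr p) * (Lp_int lborel p (\<lambda>x. h x - t i x) + Lp_int lborel p (\<lambda>x. t i x - s x))"
    by (intro nn_integral_powr_add_le smeas_diff h(1) tm smeas_step s p)
  also have "\<dots> \<le> ennreal (2 powr p) * (ennreal ?e + ennreal ?e)"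
    using i s by (intro mult_left_mono add_mono) auto
  also have "\<dots> = ennreal e"
    using e' by (simp flip: ennreal_plus ennreal_mult)
  finally show ?thesis using s(1) that by blast
qed

end

section \<open>Partial sums of the paraproduct\<close>

lemma simple_function_sum_vector:
  fixes f :: "'i \<Rightarrow> 'a \<Rightarrow> 'b::comm_monoid_add"
  shows "(\<And>i. i \<in> I \<Longrightarrow> simple_function M (f i)) \<Longrightarrow> simple_function M (\<lambda>x. \<Sum>i\<in>I. f i x)"
proof (induction I rule: infinite_finite_induct)
  case (insert i I)
  then show ?case using simple_function_compose2[of M "f i" "\<lambda>x. \<Sum>i\<in>I. f i x" "(+)"] by simp
qed simp_all

context dyadic_grid
begin

definition partial_sum :: "(real^'n \<Rightarrow> 'e::real_normed_vector \<Rightarrow>\<^sub>L 'e) \<Rightarrow> (real^'n \<Rightarrow> 'e) \<Rightarrow> (real^'n) set set \<Rightarrow> real^'n \<Rightarrow> 'e" where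
  "partial_sum b f \<F> x = (\<Sum>Q\<in>\<F>. blinfun_apply (haar_proj D Q b x) (average f Q))"

lemma haar_proj_outside:
  assumes "x \<notin> Q" shows "haar_proj D Q b x = 0"
proof -
  have "x \<notin> Q'" if "Q' \<in> children D Q" for Q' using that assms by (auto simp: children_def)
  then have "(\<Sum>Q'\<in>children D Q. indicator Q' x *\<^sub>R average b Q') = 0" by (intro sum.neutral) auto
  then show ?thesis using assms by (simp add: haar_proj_def)
qed

lemma haar_proj_child:
  assumes Q: "Q \<in> D k" and Q': "Q' \<in> children D Q" "x \<in> Q'"
  shows "haar_proj D Q b x = average b Q' - average b Q"
proof -
  have "x \<in> Q" using Q' by (auto simp: children_def)
  moreover have "x \<notin> Q''" if "Q'' \<in> children D Q - {Q'}" for Q''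
    using that Q' dyadic_eqI[of Q' "k + 1" Q'' x] by (auto simp: children_eq[OF Q])
  then have "(\<Sum>Q''\<in>children D Q. indicator Q'' x *\<^sub>R average b Q'') = average b Q'"
    using Q' by (subst sum.remove[OF card_children(1)[OF Q] Q'(1)]) (auto intro!: sum.neutral)
  ultimately show ?thesis by (simp add: haar_proj_def)
qed

lemma simple_function_haar_proj:
  assumes "Q \<in> cubes D" shows "simple_function lborel (haar_proj D Q b)"
proof -
  obtain k where k: "Q \<in> D k" using assms by (auto simp: cubes_def)
  have ind: "simple_function lborel (\<lambda>x. indicator A x *\<^sub>R c)" if "A \<in> sets lborel" for A :: "(real^'n) set" and c :: 'a
    using simple_function_compose1[OF simple_function_indicator[OF that], of "\<lambda>r. r *\<^sub>R c"] .
  have "simple_function lborel (\<lambda>x. \<Sum>Q'\<in>children D Q. indicator Q' x *\<^sub>R average b Q')"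
  proof (rule simple_function_sum_vector, rule ind)
    show "Q' \<in> sets lborel" if "Q' \<in> children D Q" for Q'
      using that dyadic_measure(1)[of Q' "k + 1"] by (simp add: children_eq[OF k])
  qed
  then show ?thesis
    unfolding haar_proj_def[abs_def]
    by (rule simple_function_compose2[OF _ ind[OF cubes_measure(1)[OF assms]], of _ "(-)"])
qed

lemma simple_function_partial_sum:
  assumes "\<F> \<subseteq> cubes D" shows "simple_function lborel (partial_sum b f \<F>)"
  unfolding partial_sum_def[abs_def]
proof (rule simple_function_sum_vector)
  fix Q assume "Q \<in> \<F>"
  then have "Q \<in> cubes D" using assms by auto
  from simple_function_compose1[OF simple_function_haar_proj[OF this], of "\<lambda>A. blinfun_apply A (average f Q)"]
  show "simple_function lborel (\<lambda>x. blinfun_apply (haar_proj D Q b x) (average f Q))" .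
qed

lemma partial_sum_measurable:
  assumes "\<F> \<subseteq> cubes D" shows "(\<lambda>x. norm (partial_sum b f \<F> x)) \<in> borel_measurable lborel"
  by (rule smeas_norm[OF smeas_simple[OF simple_function_partial_sum[OF assms]]])

lemma partial_sum_Un:
  "finite \<F> \<Longrightarrow> finite \<G> \<Longrightarrow> \<F> \<inter> \<G> = {} \<Longrightarrow> partial_sum b f (\<F> \<union> \<G>) x = partial_sum b f \<F> x + partial_sum b f \<G> x"
  unfolding partial_sum_def by (rule sum.union_disjoint)

lemma partial_sum_outside: "(\<And>Q. Q \<in> \<F> \<Longrightarrow> x \<notin> Q) \<Longrightarrow> partial_sum b f \<F> x = 0"
  unfolding partial_sum_def by (auto intro!: sum.neutral simp: haar_proj_outside)

lemma partial_sum_cong: "(\<And>Q. Q \<in> \<F> \<Longrightarrow> average f Q = average g Q) \<Longrightarrow> partial_sum b f \<F> x = partial_sum b g \<F> x"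
  unfolding partial_sum_def by (auto intro!: sum.cong)

definition tree_para :: "(real^'n \<Rightarrow> 'e::real_normed_vector \<Rightarrow>\<^sub>L 'e) \<Rightarrow> (real^'n \<Rightarrow> 'e) \<Rightarrow> (real^'n) set set \<Rightarrow> (real^'n) set \<Rightarrow> 'n set list \<Rightarrow> 'e" where
  "tree_para b f \<F> R = para (\<lambda>w. subcube D R w \<in> \<F>) (\<lambda>w. average b (subcube D R w)) (\<lambda>w. average f (subcube D R w))"

text \<open>Of the cubes of one generation only the one containing \<open>x\<close> contributes, and
  on its child containing \<open>x\<close> the Haar projection is the difference of two averages.
  Each generation thus adds one term of \<open>para\<close>.\<close>

lemma partial_sum_tree:
  assumes R: "R \<in> D k" and fin: "finite \<F>"
  shows "x \<in> subcube D R w \<Longrightarrow>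
    partial_sum b f {Q\<in>\<F>. \<exists>j<length w. Q \<in> D (k + int j)} x = tree_para b f \<F> R w"
proof (induction w)
  case Nil
  then show ?case by (simp add: partial_sum_def tree_para_def)
next
  case (Cons i w)
  let ?Q = "subcube D R w"
  have Q: "?Q \<in> D (k + int (length w))" by (rule subcube_level[OF R])
  have x: "x \<in> kid D ?Q i" using Cons.prems by simp
  have xQ: "x \<in> ?Q" using kid_subset[OF Q] x by auto
  let ?A = "{Q\<in>\<F>. \<exists>j<length w. Q \<in> D (k + int j)}" and ?B = "{Q\<in>\<F>. Q \<in> D (k + int (length w))}"
  have "{Q\<in>\<F>. \<exists>j<length (i # w). Q \<in> D (k + int j)} = ?A \<union> ?B"
    by (auto simp: less_Suc_eq)
  moreover have "?A \<inter> ?B = {}" using dyadic_level_unique by fastforce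
  ultimately have "partial_sum b f {Q\<in>\<F>. \<exists>j<length (i # w). Q \<in> D (k + int j)} x
      = partial_sum b f ?A x + partial_sum b f ?B x"
    using partial_sum_Un[of ?A ?B b f x] fin by simp
  also have "partial_sum b f ?A x = tree_para b f \<F> R w"
    by (rule Cons.IH[OF xQ])
  also have "partial_sum b f ?B x = of_bool (?Q \<in> \<F>) *\<^sub>R blinfun_apply (haar_proj D ?Q b x) (average f ?Q)"
  proof -
    have zero: "blinfun_apply (haar_proj D Q' b x) (average f Q') = 0" if "Q' \<in> ?B" "Q' \<noteq> ?Q" for Q'
    proof -
      have "x \<notin> Q'" using that dyadic_eqI[OF Q, of Q' x] xQ by fast
      then show ?thesis by (simp add: haar_proj_outside)
    qed
    have "partial_sum b f ?B x = (\<Sum>Q'\<in>?B. if Q' = ?Q then blinfun_apply (haar_proj D ?Q b x) (average f ?Q) else 0)"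
      unfolding partial_sum_def by (rule sum.cong[OF refl]) (use zero in auto)
    also have "\<dots> = of_bool (?Q \<in> \<F>) *\<^sub>R blinfun_apply (haar_proj D ?Q b x) (average f ?Q)"
      using Q fin by simp
    finally show ?thesis .
  qed
  also have "haar_proj D ?Q b x = average b (subcube D R (i # w)) - average b ?Q"
    using haar_proj_child[OF Q kid_in_children[OF Q] x] by simp
  finally show ?case by (simp add: tree_para_def)
qed

text \<open>All cubes of the family lie in generations before \<open>k + m\<close>, so on
  \<open>R\<close> the partial sum is constant on each subcube of depth \<open>m\<close>, and these
  have equal measure.\<close>

lemma nn_integral_partial_sum_tree:
  assumes R: "R \<in> D k" and fin: "finite \<F>" and levels: "\<And>Q. Q \<in> \<F> \<Longrightarrow> \<exists>j<m. Q \<in> D (k + int j)"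
  shows "Lp_int_on R p (partial_sum b f \<F>)
    = ennreal ((\<Sum>w\<in>words m. norm (tree_para b f \<F> R w) powr p) * (measure lborel R / (2 ^ CARD('n)) ^ m))"
proof -
  have sub: "\<F> \<subseteq> cubes D" using levels by (auto simp: cubes_def)
  note [measurable] = partial_sum_measurable[OF sub]
  have "Lp_int_on R p (partial_sum b f \<F>)
      = (\<Sum>w\<in>words m. Lp_int_on (subcube D R w) p (partial_sum b f \<F>))"
    by (rule nn_integral_subcubes[OF R]) measurable
  also have "\<dots> = (\<Sum>w\<in>words m. ennreal (norm (tree_para b f \<F> R w) powr p * (measure lborel R / (2 ^ CARD('n)) ^ m)))"
  proof (rule sum.cong[OF refl])
    fix w :: "'n set list" assume w: "w \<in> words m"
    have Q: "subcube D R w \<in> D (k + int (length w))" by (rule subcube_level[OF R])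
    have eq: "partial_sum b f \<F> x = tree_para b f \<F> R w" if "x \<in> subcube D R w" for x
    proof -
      have "{Q\<in>\<F>. \<exists>j<length w. Q \<in> D (k + int j)} = \<F>" using levels w by (auto simp: words_def)
      then show ?thesis using partial_sum_tree[OF R fin that, of b f] by simp
    qed
    have "Lp_int_on (subcube D R w) p (partial_sum b f \<F>)
        = (\<integral>\<^sup>+x. ennreal (norm (tree_para b f \<F> R w) powr p) * indicator (subcube D R w) x \<partial>lborel)"
      by (intro nn_integral_cong) (auto simp: indicator_def eq)
    also have "\<dots> = ennreal (norm (tree_para b f \<F> R w) powr p) * emeasure lborel (subcube D R w)"
      by (rule nn_integral_cmult_indicator[OF dyadic_measure(1)[OF Q]])
    also have "\<dots> = ennreal (norm (tree_para b f \<F> R w) powr p * measure lborel (subcube D R w))"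
      by (simp add: dyadic_emeasure[OF Q] ennreal_mult)
    also have "measure lborel (subcube D R w) = measure lborel R / (2 ^ CARD('n)) ^ m"
      using measure_subcube[OF R, of w] w by (simp add: words_def)
    finally show "Lp_int_on (subcube D R w) p (partial_sum b f \<F>)
      = ennreal (norm (tree_para b f \<F> R w) powr p * (measure lborel R / (2 ^ CARD('n)) ^ m))" .
  qed
  also have "\<dots> = ennreal (\<Sum>w\<in>words m. norm (tree_para b f \<F> R w) powr p * (measure lborel R / (2 ^ CARD('n)) ^ m))"
    by (rule sum_ennreal) simp
  finally show ?thesis by (simp only: sum_distrib_right)
qed

lemma levels_bounded:
  assumes "finite \<F>" "\<F> \<subseteq> cubes D"
  obtains k m where "\<And>Q. Q \<in> \<F> \<Longrightarrow> \<exists>j<m. Q \<in> D (k + int j)"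
proof -
  have "\<exists>k m. \<forall>Q\<in>\<F>. \<exists>j<m. Q \<in> D (k + int j)"
    using assms
  proof (induction \<F>)
    case (insert Q \<F>)
    then obtain k m where km: "\<forall>Q\<in>\<F>. \<exists>j<m. Q \<in> D (k + int j)" by auto
    obtain l where l: "Q \<in> D l" using insert.prems by (auto simp: cubes_def)
    define k' where "k' = min k l"
    define m' where "m' = m + nat (k - k') + nat (l - k') + 1"
    have "\<exists>j<m'. Q' \<in> D (k' + int j)" if "Q' \<in> insert Q \<F>" for Q'
    proof (cases "Q' = Q")
      case True
      have "Q' \<in> D (k' + int (nat (l - k')))" using l True by (simp add: k'_def)
      moreover have "nat (l - k') < m'" by (simp add: m'_def)
      ultimately show ?thesis unfolding True by blast
    next
      case False
      then have "Q' \<in> \<F>" using that by simp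
      then have "\<exists>j<m. Q' \<in> D (k + int j)" by (rule bspec[OF km])
      then obtain j where j: "j < m" "Q' \<in> D (k + int j)" by (elim exE conjE)
      have "Q' \<in> D (k' + int (nat (k - k') + j))" using j by (simp add: k'_def)
      moreover have "nat (k - k') + j < m'" using j by (simp add: m'_def)
      ultimately show ?thesis by (intro exI[of _ "nat (k - k') + j"]) simp
    qed
    then show ?case by (intro exI[of _ k'] exI[of _ m']) simp
  qed auto
  then show ?thesis using that by blast
qed

lemma dyadic_sum_indicator:
  assumes "\<R> \<subseteq> D k" "finite \<R>"
  shows "(\<Sum>R\<in>\<R>. indicator R x :: ennreal) = indicator (\<Union>\<R>) x"
proof -
  have "disjoint_family_on (\<lambda>R. R) \<R>"
    unfolding disjoint_family_on_def
  proof (intro ballI impI)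
    fix Q Q' assume "Q \<in> \<R>" "Q' \<in> \<R>" "Q \<noteq> Q'"
    then show "Q \<inter> Q' = {}" using dyadic_eqI[of Q k Q'] assms(1) by blast
  qed
  from indicator_UN_disjoint[OF assms(2) this] show ?thesis by (metis image_ident)
qed

lemma nn_integral_dyadic_Union:
  assumes "\<R> \<subseteq> D k" "finite \<R>" "h \<in> borel_measurable lborel"
  shows "(\<Sum>R\<in>\<R>. \<integral>\<^sup>+x\<in>R. h x \<partial>lborel) = (\<integral>\<^sup>+x\<in>\<Union>\<R>. h x \<partial>lborel)"
proof -
  have "(\<Sum>R\<in>\<R>. \<integral>\<^sup>+x\<in>R. h x \<partial>lborel) = (\<integral>\<^sup>+x. (\<Sum>R\<in>\<R>. h x * indicator R x) \<partial>lborel)"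
    using assms dyadic_measure(1)[of _ k]
    by (intro nn_integral_sum[symmetric] borel_measurable_times_ennreal borel_measurable_indicator) auto
  then show ?thesis by (simp add: dyadic_sum_indicator[OF assms(1,2)] flip: sum_distrib_left)
qed

lemma card_UNIV_index_set: "real CARD('n set) = 2 ^ CARD('n)"
  by (simp add: card_UNIV_set)

end

section \<open>Uniform bounds for finite partial sums\<close>

locale paraproduct_setting = dyadic_grid D
  for D :: "int \<Rightarrow> (real^'n) set set" +
  fixes p C C' B :: real and T :: "('e::banach \<Rightarrow>\<^sub>L 'e) set" and b :: "real^'n \<Rightarrow> 'e \<Rightarrow>\<^sub>L 'e"
  assumes p: "1 < p" and UE: "UMD_bound p (UNIV :: 'e set) C" and UT: "UMD_bound p T C'" and T: "subspace T"
    and b: "loc_int b" and bT: "\<And>Q. Q \<in> cubes D \<Longrightarrow> average b Q \<in> T"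
    and B: "0 \<le> B" and osc: "\<And>Q. Q \<in> cubes D \<Longrightarrow>
      Lp_int_on Q p (\<lambda>x. b x - average b Q) \<le> ennreal (B powr p * measure lborel Q)"
begin

lemma local_partial_sum_bound:
  assumes R: "R \<in> D k" and fin: "finite \<F>" and levels: "\<And>Q. Q \<in> \<F> \<Longrightarrow> \<exists>j<m. Q \<in> D (k + int j)"
    and f: "\<And>Q. Q \<in> \<F> \<Longrightarrow> Q \<subseteq> R \<Longrightarrow> average f Q = v"
  shows "Lp_int_on R p (partial_sum b f \<F>)
    \<le> ennreal ((C\<^sup>2 * C' * norm v) powr p) * Lp_int_on R p (\<lambda>x. b x - average b R)"
proof -
  let ?\<beta> = "\<lambda>w. average b (subcube D R w)" and ?r = "measure lborel R / (2 ^ CARD('n)) ^ m"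
  have r: "0 \<le> ?r" by simp
  have "tree_para b f \<F> R w = para (\<lambda>w. subcube D R w \<in> \<F>) ?\<beta> (\<lambda>_. v) w" for w
    unfolding tree_para_def by (rule para_cong) (auto intro!: f subcube_subset[OF R])
  then have "(\<Sum>w\<in>words m. norm (tree_para b f \<F> R w) powr p)
      = (\<Sum>w\<in>words m. norm (para (\<lambda>w. subcube D R w \<in> \<F>) ?\<beta> (\<lambda>_. v) w) powr p)" by simp
  also have "\<dots> \<le> (C\<^sup>2 * C' * norm v) powr p * (\<Sum>w\<in>words m. norm (?\<beta> w - ?\<beta> []) powr p)"
    using p by (intro local_para_bound[OF UE UT _ T] martingale_average[OF b R] bT subcube_cubes[OF R])
      (auto simp: martingale_def sum_constant_scaleR)
  finally have "(\<Sum>w\<in>words m. norm (tree_para b f \<F> R w) powr p) * ?r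
      \<le> (C\<^sup>2 * C' * norm v) powr p * (\<Sum>w\<in>words m. norm (?\<beta> w - average b R) powr p * ?r)"
    using r unfolding sum_distrib_right[symmetric] mult.assoc[symmetric] by (intro mult_right_mono) auto
  then have "ennreal ((\<Sum>w\<in>words m. norm (tree_para b f \<F> R w) powr p) * ?r)
      \<le> ennreal ((C\<^sup>2 * C' * norm v) powr p) * ennreal (\<Sum>w\<in>words m. norm (?\<beta> w - average b R) powr p * ?r)"
    by (subst ennreal_mult[symmetric]) (auto intro!: ennreal_leI sum_nonneg)
  also have "\<dots> \<le> ennreal ((C\<^sup>2 * C' * norm v) powr p) * Lp_int_on R p (\<lambda>x. b x - average b R)"
    by (intro mult_left_mono sum_average_diff_le[OF b R p]) auto
  finally have "ennreal ((\<Sum>w\<in>words m. norm (tree_para b f \<F> R w) powr p) * ?r)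
      \<le> ennreal ((C\<^sup>2 * C' * norm v) powr p) * Lp_int_on R p (\<lambda>x. b x - average b R)" .
  moreover have "Lp_int_on R p (partial_sum b f \<F>)
      = ennreal ((\<Sum>w\<in>words m. norm (tree_para b f \<F> R w) powr p) * ?r)"
    by (rule nn_integral_partial_sum_tree[OF R fin levels])
  ultimately show ?thesis by (simp only:)
qed

lemma partial_sum_bound_cube:
  assumes R: "R \<in> D k" and fin: "finite \<F>" and levels: "\<And>Q. Q \<in> \<F> \<Longrightarrow> \<exists>j<m. Q \<in> D (k + int j)"
    and f: "loc_int f"
  shows "Lp_int_on R p (partial_sum b f \<F>)
    \<le> ennreal ((6 * 2 ^ CARD('n) * p * (p / (p - 1)) * C\<^sup>2 * C' * B) powr p) * Lp_int_on R p f"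
proof -
  let ?\<beta> = "\<lambda>w. average b (subcube D R w)" and ?a = "\<lambda>w. norm_average f (subcube D R w)"
  let ?r = "measure lborel R / (2 ^ CARD('n)) ^ m"
  define K where "K = 6 * 2 ^ CARD('n) * p * (p / (p - 1)) * C\<^sup>2 * C' * B"
  have r: "0 \<le> ?r" by simp
  have cubes: "subcube D R w \<in> cubes D" for w by (rule subcube_cubes[OF R])
  \<comment> \<open>The averages of \<open>b\<close> below any subcube oscillate in mean at most as
    much as \<open>b\<close> does on that subcube, so the BMO condition for all cubes supplies the
    tree hypothesis at all nodes.\<close>
  have oscw: "(\<Sum>u\<in>words k. norm (?\<beta> (u @ w) - ?\<beta> w) powr p) \<le> B powr p * real CARD('n set) ^ k" for k w
  proof -
    let ?Q = "subcube D R w"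
    have Q: "?Q \<in> D (k' + int (length w))" if "R \<in> D k'" for k' using subcube_level[OF that] .
    note QR = Q[OF R]
    have pos: "0 < measure lborel ?Q" by (rule dyadic_measure_pos[OF QR])
    have "ennreal (\<Sum>u\<in>words k. norm (average b (subcube D ?Q u) - average b ?Q) powr p * (measure lborel ?Q / (2 ^ CARD('n)) ^ k))
        \<le> ennreal (B powr p * measure lborel ?Q)"
      using sum_average_diff_le[OF b QR p] osc[OF cubes[of w]] by (rule order_trans)
    then have "(\<Sum>u\<in>words k. norm (average b (subcube D ?Q u) - average b ?Q) powr p * (measure lborel ?Q / (2 ^ CARD('n)) ^ k))
        \<le> B powr p * measure lborel ?Q"
      using pos by (subst (asm) ennreal_le_iff) auto
    also have "B powr p * measure lborel ?Q = (B powr p * (2 ^ CARD('n)) ^ k) * (measure lborel ?Q / (2 ^ CARD('n)) ^ k)"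
      by simp
    finally have "(\<Sum>u\<in>words k. norm (average b (subcube D ?Q u) - average b ?Q) powr p) * (measure lborel ?Q / (2 ^ CARD('n)) ^ k)
        \<le> (B powr p * (2 ^ CARD('n)) ^ k) * (measure lborel ?Q / (2 ^ CARD('n)) ^ k)"
      by (simp only: sum_distrib_right)
    then have "(\<Sum>u\<in>words k. norm (average b (subcube D ?Q u) - average b ?Q) powr p) \<le> B powr p * (2 ^ CARD('n)) ^ k"
      by (rule mult_right_le_imp_le) (use pos in simp)
    then show ?thesis unfolding card_UNIV_index_set subcube_append .
  qed
  have "(\<Sum>w\<in>words m. norm (tree_para b f \<F> R w) powr p)
      \<le> (6 * real CARD('n set) * p * (p / (p - 1)) * C\<^sup>2 * C' * B) powr p * (\<Sum>w\<in>words m. ?a w powr p)"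
    unfolding tree_para_def
    by (rule tree_paraproduct_bound[OF UE UT p T martingale_average[OF b R] bT[OF cubes]
          martingale_average[OF f R] martingale_norm_average[OF f R] norm_average_le[OF f cubes] B oscw])
  then have le: "(\<Sum>w\<in>words m. norm (tree_para b f \<F> R w) powr p) \<le> K powr p * (\<Sum>w\<in>words m. ?a w powr p)"
    unfolding card_UNIV_index_set K_def .
  have "Lp_int_on R p (partial_sum b f \<F>)
      = ennreal ((\<Sum>w\<in>words m. norm (tree_para b f \<F> R w) powr p) * ?r)"
    by (rule nn_integral_partial_sum_tree[OF R fin levels])
  also have "\<dots> \<le> ennreal (K powr p * (\<Sum>w\<in>words m. ?a w powr p * ?r))"
    using mult_right_mono[OF le r] by (intro ennreal_leI) (simp only: sum_distrib_right[symmetric] mult.assoc)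
  also have "\<dots> = ennreal (K powr p) * (\<Sum>w\<in>words m. ennreal (?a w powr p * ?r))"
    by (subst ennreal_mult) (auto intro!: sum_nonneg simp: sum_ennreal)
  also have "\<dots> \<le> ennreal (K powr p) * (\<Sum>w\<in>words m. Lp_int_on (subcube D R w) p f)"
  proof (intro mult_left_mono sum_mono)
    fix w :: "'n set list" assume w: "w \<in> words m"
    have "?r = measure lborel (subcube D R w)"
      using measure_subcube[OF R, of w] w by (simp add: words_def)
    then show "ennreal (?a w powr p * ?r) \<le> Lp_int_on (subcube D R w) p f"
      using norm_average_Jensen[OF f cubes p] by simp
  qed auto
  also have "(\<Sum>w\<in>words m. Lp_int_on (subcube D R w) p f)
      = Lp_int_on R p f"
  proof (rule nn_integral_subcubes[OF R, symmetric])
    note [measurable] = loc_int_norm_measurable[OF f]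
    show "(\<lambda>x. ennreal (norm (f x) powr p)) \<in> borel_measurable lborel" by measurable
  qed
  finally show ?thesis unfolding K_def .
qed

text \<open>No single cube need contain the whole family, as a dyadic system may split into several
  quadrants. The disjoint ancestors of one common generation \<open>k\<close> serve as roots; p-th
  powers of the norms add over them with the same constant.\<close>

lemma partial_sum_bound:
  assumes fin: "finite \<F>" and sub: "\<F> \<subseteq> cubes D" and f: "loc_int f"
  shows "Lp_int lborel p (partial_sum b f \<F>)
    \<le> ennreal ((6 * 2 ^ CARD('n) * p * (p / (p - 1)) * C\<^sup>2 * C' * B) powr p) * Lp_int lborel p f"
proof -
  let ?K = "ennreal ((6 * 2 ^ CARD('n) * p * (p / (p - 1)) * C\<^sup>2 * C' * B) powr p)"
  obtain k m where levels: "\<And>Q. Q \<in> \<F> \<Longrightarrow> \<exists>j<m. Q \<in> D (k + int j)"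
    using levels_bounded[OF fin sub] by blast
  define \<R> where "\<R> = (\<Union>Q\<in>\<F>. {R \<in> D k. Q \<subseteq> R})"
  have single: "finite {R \<in> D k. Q \<subseteq> R}" if "Q \<in> \<F>" for Q
  proof -
    obtain j where "Q \<in> D (k + int j)" using levels[OF \<open>Q \<in> \<F>\<close>] by blast
    then obtain x where x: "x \<in> Q" using dyadic_nonempty by fastforce
    obtain R0 where R0: "R0 \<in> D k" "x \<in> R0" by (rule dyadic_cover)
    have "R = R0" if "R \<in> D k" "Q \<subseteq> R" for R
      by (rule dyadic_eqI[OF that(1) R0(1) _ R0(2)]) (use that(2) x in blast)
    then have "{R \<in> D k. Q \<subseteq> R} \<subseteq> {R0}" by (intro subsetI) (simp only: mem_Collect_eq singleton_iff)
    then show ?thesis by (rule finite_subset) simp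
  qed
  have R: "\<R> \<subseteq> D k" "finite \<R>"
    unfolding \<R>_def using fin single by auto
  note [measurable] = partial_sum_measurable[OF sub, of b f] loc_int_norm_measurable[OF f]
  have "Lp_int lborel p (partial_sum b f \<F>)
      = Lp_int_on (\<Union>\<R>) p (partial_sum b f \<F>)"
  proof (rule nn_integral_cong)
    fix x
    show "ennreal (norm (partial_sum b f \<F> x) powr p) = ennreal (norm (partial_sum b f \<F> x) powr p) * indicator (\<Union>\<R>) x"
    proof (cases "x \<in> \<Union>\<R>")
      case False
      have "x \<notin> Q" if "Q \<in> \<F>" for Q
      proof
        assume "x \<in> Q"
        obtain j where "Q \<in> D (k + int j)" using levels[OF \<open>Q \<in> \<F>\<close>] by blast
        then obtain R where "R \<in> D k" "Q \<subseteq> R" using dyadic_ancestor[of Q k j] by blast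
        then have "R \<in> \<R>" using that unfolding \<R>_def by blast
        then show False using False \<open>Q \<subseteq> R\<close> \<open>x \<in> Q\<close> by blast
      qed
      then show ?thesis using p by (simp add: partial_sum_outside)
    qed simp
  qed
  also have "\<dots> = (\<Sum>R\<in>\<R>. Lp_int_on R p (partial_sum b f \<F>))"
    by (rule nn_integral_dyadic_Union[OF R, symmetric]) measurable
  also have "\<dots> \<le> (\<Sum>R\<in>\<R>. ?K * Lp_int_on R p f)"
    using R(1) by (intro sum_mono partial_sum_bound_cube[OF _ fin levels f]) auto
  also have "\<dots> = ?K * Lp_int_on (\<Union>\<R>) p f"
  proof -
    have "(\<Sum>R\<in>\<R>. Lp_int_on R p f) = Lp_int_on (\<Union>\<R>) p f"
      by (rule nn_integral_dyadic_Union[OF R]) measurable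
    then show ?thesis by (simp only: sum_distrib_left[symmetric])
  qed
  also have "\<dots> \<le> ?K * Lp_int lborel p f"
    by (intro mult_left_mono nn_integral_mono) (auto simp: indicator_def)
  finally show ?thesis .
qed

end

section \<open>Uniformly small tails\<close>

lemma norm_indicator_powr:
  "0 < p \<Longrightarrow> ennreal (norm (indicator A x *\<^sub>R v) powr p) = ennreal (norm v powr p) * indicator A x"
  by (auto simp: indicator_def)

context dyadic_grid
begin

lemma loc_int_Lp:
  assumes "smeas lborel f" "Lp_int lborel p f < \<infinity>" "1 \<le> p"
  shows "loc_int f"
  unfolding loc_int_def
proof (intro conjI ballI)
  show "smeas lborel f" by fact
  fix Q assume Q: "Q \<in> cubes D"
  note [measurable] = smeas_norm[OF assms(1)] cubes_measure(1)[OF Q]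
  have "(\<integral>\<^sup>+x\<in>Q. ennreal (norm (f x)) \<partial>lborel) \<le> (\<integral>\<^sup>+x. indicator Q x + ennreal (norm (f x) powr p) \<partial>lborel)"
  proof (rule nn_integral_mono)
    fix x
    have "ennreal (norm (f x)) \<le> 1 + ennreal (norm (f x) powr p)"
      using ennreal_leI[OF le_one_plus_powr[of "norm (f x)" p]] assms(3) by simp
    then show "ennreal (norm (f x)) * indicator Q x \<le> indicator Q x + ennreal (norm (f x) powr p)"
      by (auto simp: indicator_def)
  qed
  also have "\<dots> = emeasure lborel Q + Lp_int lborel p f"
    using cubes_measure(1)[OF Q] by (subst nn_integral_add) (auto simp: nn_integral_indicator)
  also have "\<dots> < \<infinity>" using assms(2) cubes_measure(2)[OF Q] by auto
  finally show "(\<integral>\<^sup>+x\<in>Q. ennreal (norm (f x)) \<partial>lborel) < \<infinity>" .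
qed

lemma loc_int_indicator_const: "A \<in> sets lborel \<Longrightarrow> loc_int (\<lambda>x. indicator A x *\<^sub>R v)"
  by (rule loc_int_indicator[OF loc_int_const])

lemma average_indicator_disjoint:
  assumes "Q \<in> cubes D" "Q \<inter> R = {}" shows "average (\<lambda>x. indicator R x *\<^sub>R v) Q = 0"
proof -
  have "average (\<lambda>x. indicator R x *\<^sub>R v) Q = average (\<lambda>_. 0) Q"
    using assms(2) by (intro average_cong_on) (auto simp: indicator_def)
  then show ?thesis by (simp add: average_const[OF assms(1)])
qed

lemma average_indicator_subset:
  assumes "Q \<in> cubes D" "Q \<subseteq> R" shows "average (\<lambda>x. indicator R x *\<^sub>R v) Q = v"
proof -
  have "average (\<lambda>x. indicator R x *\<^sub>R v) Q = average (\<lambda>_. v) Q"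
    using assms(2) by (intro average_cong_on) (auto simp: indicator_def)
  then show ?thesis by (simp add: average_const[OF assms(1)])
qed

lemma average_indicator_superset:
  assumes "Q \<in> cubes D" "R \<in> cubes D" "R \<subseteq> Q"
  shows "average (\<lambda>x. indicator R x *\<^sub>R v) Q = (measure lborel R / measure lborel Q) *\<^sub>R v"
proof (rule average_eqI[OF _ assms(1)])
  have "has_bint lborel (\<lambda>x. indicator R x *\<^sub>R v) (measure lborel R *\<^sub>R v)"
    using cubes_measure[OF assms(2)] by (intro has_bint_indicator) auto
  moreover have "(\<lambda>x. indicator Q x *\<^sub>R indicator R x *\<^sub>R v) = (\<lambda>x. indicator R x *\<^sub>R v)"
    using assms(3) by (auto simp: indicator_def fun_eq_iff)
  moreover have "measure lborel Q \<noteq> 0" using cubes_measure(3)[OF assms(1)] by simp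
  ultimately show "has_bint lborel (\<lambda>x. indicator Q x *\<^sub>R indicator R x *\<^sub>R v)
      (measure lborel Q *\<^sub>R (measure lborel R / measure lborel Q) *\<^sub>R v)"
    by simp
qed

lemma level_le_of_subset:
  assumes "Q \<in> D l" "Q' \<in> D l'" "Q' \<subseteq> Q" shows "l \<le> l'"
proof (rule ccontr)
  assume "\<not> l \<le> l'"
  then have l: "l' \<le> l" "l \<noteq> l'" by auto
  obtain x where x: "x \<in> Q'" using dyadic_nonempty[OF assms(2)] by blast
  then have "x \<in> Q" using assms(3) by blast
  then have "Q \<subseteq> Q'" using dyadic_nested[OF assms(2,1) l(1) x] by blast
  then have "Q = Q'" using assms(3) by simp
  then show False using dyadic_level_unique[of Q l l'] assms(1,2) l(2) by simp
qed

lemma ancestor_measure: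
  assumes "R \<in> D j" "P \<in> D (j - int J)"
  shows "measure lborel P = (2 ^ CARD('n)) ^ J * measure lborel R"
proof -
  have "(2::real) powi (- (j - int J)) = 2 ^ J * 2 powi (- j)"
    by (simp add: power_int_add[symmetric] add.commute flip: power_int_of_nat)
  then show ?thesis
    using dyadic_measure(3)[OF assms(1)] dyadic_measure(3)[OF assms(2)]
    by (simp add: power_mult_distrib power_mult[symmetric] mult.commute)
qed

lemma partial_sum_add:
  fixes f g :: "real^'n \<Rightarrow> 'e::banach"
  assumes "loc_int f" "loc_int g" "\<F> \<subseteq> cubes D"
  shows "partial_sum b (\<lambda>x. f x + g x) \<F> x = partial_sum b f \<F> x + partial_sum b g \<F> x"
  unfolding partial_sum_def sum.distrib[symmetric]
  by (rule sum.cong[OF refl])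
    (use assms(3) in \<open>auto simp: average_add[OF assms(1,2)] blinfun.add_right\<close>)

text \<open>The Cauchy criterion for unconditional summability in L^p, stated through finite
  families disjoint from a fixed one.\<close>

definition tail_small :: "real \<Rightarrow> (real^'n \<Rightarrow> 'e::real_normed_vector \<Rightarrow>\<^sub>L 'e) \<Rightarrow> (real^'n \<Rightarrow> 'e) \<Rightarrow> bool" where
  "tail_small p b f \<longleftrightarrow> (\<forall>e>0. \<exists>\<G>. finite \<G> \<and> \<G> \<subseteq> cubes D \<and>
     (\<forall>\<F>. finite \<F> \<and> \<F> \<subseteq> cubes D \<and> \<F> \<inter> \<G> = {} \<longrightarrow>
       Lp_int lborel p (partial_sum b f \<F>) \<le> ennreal e))"

lemma tail_small_add:
  fixes f g :: "real^'n \<Rightarrow> 'e::banach"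
  assumes f: "loc_int f" "tail_small p b f" and g: "loc_int g" "tail_small p b g" and p: "1 \<le> p"
  shows "tail_small p b (\<lambda>x. f x + g x)"
  unfolding tail_small_def
proof (intro allI impI)
  fix e :: real assume "0 < e"
  let ?e = "e / (2 powr p * 2)"
  have e': "0 < ?e" using \<open>0 < e\<close> by simp
  obtain \<G>1 where G1: "finite \<G>1" "\<G>1 \<subseteq> cubes D"
    "\<And>\<F>. finite \<F> \<Longrightarrow> \<F> \<subseteq> cubes D \<Longrightarrow> \<F> \<inter> \<G>1 = {} \<Longrightarrow>
       Lp_int lborel p (partial_sum b f \<F>) \<le> ennreal ?e"
    using f(2) e' unfolding tail_small_def by meson
  obtain \<G>2 where G2: "finite \<G>2" "\<G>2 \<subseteq> cubes D"
    "\<And>\<F>. finite \<F> \<Longrightarrow> \<F> \<subseteq> cubes D \<Longrightarrow> \<F> \<inter> \<G>2 = {} \<Longrightarrow>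
       Lp_int lborel p (partial_sum b g \<F>) \<le> ennreal ?e"
    using g(2) e' unfolding tail_small_def by meson
  have "Lp_int lborel p (\<lambda>x. partial_sum b (\<lambda>x. f x + g x) \<F> x) \<le> ennreal e"
    if F: "finite \<F>" "\<F> \<subseteq> cubes D" "\<F> \<inter> (\<G>1 \<union> \<G>2) = {}" for \<F>
  proof -
    have "Lp_int lborel p (\<lambda>x. partial_sum b (\<lambda>x. f x + g x) \<F> x)
        = Lp_int lborel p (\<lambda>x. partial_sum b f \<F> x + partial_sum b g \<F> x)"
      by (simp add: partial_sum_add[OF f(1) g(1) F(2)])
    also have "\<dots> \<le> ennreal (2 powr p) * (Lp_int lborel p (partial_sum b f \<F>)
        + Lp_int lborel p (partial_sum b g \<F>))"
      by (intro nn_integral_powr_add_le smeas_simple simple_function_partial_sum[OF F(2)] p)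
    also have "\<dots> \<le> ennreal (2 powr p) * (ennreal ?e + ennreal ?e)"
      using F by (intro mult_left_mono add_mono G1(3) G2(3)) auto
    also have "\<dots> = ennreal e"
      using e' by (simp flip: ennreal_plus ennreal_mult)
    finally show ?thesis .
  qed
  then show "\<exists>\<G>. finite \<G> \<and> \<G> \<subseteq> cubes D \<and> (\<forall>\<F>. finite \<F> \<and> \<F> \<subseteq> cubes D \<and> \<F> \<inter> \<G> = {} \<longrightarrow>
       Lp_int lborel p (\<lambda>x. partial_sum b (\<lambda>x. f x + g x) \<F> x) \<le> ennreal e)"
    using G1(1,2) G2(1,2) by (intro exI[of _ "\<G>1 \<union> \<G>2"]) simp
qed

end

context paraproduct_setting
begin

text \<open>For cubes containing the \<open>J\<close>-th ancestor \<open>P\<close> of \<open>R\<close>, the function \<open>v 1\<^sub>R\<close> has the same averages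
  as \<open>(|R| / |P|) v 1\<^sub>P\<close>, whose \<open>L\<^sup>p\<close> norm tends to \<open>0\<close> since \<open>p > 1\<close>.\<close>

lemma large_cubes_small:
  fixes v :: 'e
  assumes R: "R \<in> D j" and e: "0 < e"
  obtains J where "\<And>\<F>. finite \<F> \<Longrightarrow> (\<And>Q. Q \<in> \<F> \<Longrightarrow> R \<subseteq> Q \<and> (\<exists>l\<le>j - int J. Q \<in> D l)) \<Longrightarrow>
    Lp_int lborel p (\<lambda>x. partial_sum b (\<lambda>x. indicator R x *\<^sub>R v) \<F> x) \<le> ennreal e"
proof -
  define K where "K = (6 * 2 ^ CARD('n) * p * (p / (p - 1)) * C\<^sup>2 * C' * B) powr p"
  define A where "A = (2::real) ^ CARD('n)"
  have A: "1 < A" by (simp add: A_def)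
  have r: "0 < measure lborel R" by (rule dyadic_measure_pos[OF R])
  define W where "W = K * (norm v powr p * measure lborel R)"
  have W: "0 \<le> W" by (simp add: W_def K_def)
  have "0 < A powr (1 - p)" "A powr (1 - p) < 1"
    using A p powr_less_mono[of "1 - p" 0 A] by auto
  \<comment> \<open>Passing to the J-th ancestor multiplies the p-th power of the norm by the J-th
    power of \<open>A powr (1 - p)\<close>: the value scales by A^(-pJ), the measure by A^J.\<close>
  then obtain J where J: "(A powr (1 - p)) ^ J < e / (W + 1)"
    using real_arch_pow_inv[of "e / (W + 1)" "A powr (1 - p)"] e W by auto
  have "Lp_int lborel p (\<lambda>x. partial_sum b (\<lambda>x. indicator R x *\<^sub>R v) \<F> x) \<le> ennreal e"
    if fin: "finite \<F>" and big: "\<And>Q. Q \<in> \<F> \<Longrightarrow> R \<subseteq> Q \<and> (\<exists>l\<le>j - int J. Q \<in> D l)" for \<F>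
  proof -
    have sub: "\<F> \<subseteq> cubes D"
    proof
      fix Q assume "Q \<in> \<F>"
      with big[of Q] show "Q \<in> cubes D" by (auto simp: cubes_def)
    qed
    have "R \<in> D ((j - int J) + int J)" using R by simp
    then obtain P where P: "P \<in> D (j - int J)" "R \<subseteq> P" using dyadic_ancestor by blast
    have cubes: "R \<in> cubes D" "P \<in> cubes D" using R P by (auto simp: cubes_def)
    have mP: "measure lborel P = A ^ J * measure lborel R"
      using ancestor_measure[OF R P(1)] by (simp add: A_def)
    define t where "t = measure lborel R / measure lborel P"
    have t: "t = 1 / A ^ J" using r A by (simp add: t_def mP)
    have "partial_sum b (\<lambda>x. indicator R x *\<^sub>R v) \<F> x = partial_sum b (\<lambda>x. indicator P x *\<^sub>R (t *\<^sub>R v)) \<F> x" for x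
    proof (rule partial_sum_cong)
      fix Q assume Q: "Q \<in> \<F>"
      obtain l where l: "l \<le> j - int J" "Q \<in> D l" using big[OF Q] by blast
      obtain y where y: "y \<in> R" using dyadic_nonempty[OF R] by blast
      have "y \<in> Q" "y \<in> P" using y big[OF Q] P(2) by auto
      then have "P \<subseteq> Q" using dyadic_nested[OF l(2) P(1) l(1)] by blast
      moreover have "Q \<in> cubes D" using sub Q by auto
      moreover have "measure lborel P \<noteq> 0" using dyadic_measure_pos[OF P(1)] by simp
      ultimately show "average (\<lambda>x. indicator R x *\<^sub>R v) Q = average (\<lambda>x. indicator P x *\<^sub>R (t *\<^sub>R v)) Q"
        using average_indicator_superset[of Q R v] average_indicator_superset[of Q P "t *\<^sub>R v"] big[OF Q] cubes
        by (simp add: t_def)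
    qed
    then have "Lp_int lborel p (\<lambda>x. partial_sum b (\<lambda>x. indicator R x *\<^sub>R v) \<F> x)
        = Lp_int lborel p (\<lambda>x. partial_sum b (\<lambda>x. indicator P x *\<^sub>R (t *\<^sub>R v)) \<F> x)" by simp
    also have "\<dots> \<le> ennreal K * Lp_int lborel p (\<lambda>x. indicator P x *\<^sub>R (t *\<^sub>R v))"
      unfolding K_def
      by (rule partial_sum_bound[OF fin sub loc_int_indicator_const[OF cubes_measure(1)[OF cubes(2)]]])
    also have "Lp_int lborel p (\<lambda>x. indicator P x *\<^sub>R (t *\<^sub>R v))
        = ennreal (norm (t *\<^sub>R v) powr p) * emeasure lborel P"
      using p cubes_measure(1)[OF cubes(2)] by (subst norm_indicator_powr) (auto simp: nn_integral_cmult_indicator)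
    also have "\<dots> = ennreal (norm (t *\<^sub>R v) powr p * measure lborel P)"
      by (simp add: cubes_measure(2)[OF cubes(2)] ennreal_mult)
    also have "norm (t *\<^sub>R v) powr p * measure lborel P = (norm v powr p * measure lborel R) * (A powr (1 - p)) ^ J"
    proof -
      have AJ: "0 < A ^ J" using A by simp
      have "(A powr (1 - p)) ^ J = (A ^ J) powr (1 - p)"
        using A by (simp add: powr_power powr_realpow[symmetric] powr_powr mult.commute)
      then show ?thesis
        using AJ r by (simp add: t mP powr_mult powr_divide powr_diff field_simps)
    qed
    also have "ennreal K * ennreal ((norm v powr p * measure lborel R) * (A powr (1 - p)) ^ J) = ennreal (W * (A powr (1 - p)) ^ J)"
      by (subst ennreal_mult[symmetric]) (auto simp: W_def K_def mult.assoc)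
    also have "\<dots> \<le> ennreal e"
    proof (rule ennreal_leI)
      have "W * (A powr (1 - p)) ^ J \<le> (W + 1) * (A powr (1 - p)) ^ J" by (intro mult_right_mono) auto
      also have "\<dots> \<le> (W + 1) * (e / (W + 1))" using J W by (intro mult_left_mono) auto
      also have "\<dots> = e" using W by simp
      finally show "W * (A powr (1 - p)) ^ J \<le> e" .
    qed
    finally show ?thesis .
  qed
  then show ?thesis by (rule that)
qed

text \<open>The average is a best approximating constant up to a factor: by Jensen its distance to
  \<open>c\<close> is controlled by that of \<open>b\<close>. This allows comparison with the
  constant value of a step function.\<close>

lemma osc_le_const:
  assumes R: "R \<in> D k"
  shows "Lp_int_on R p (\<lambda>x. b x - average b R)
    \<le> ennreal (2 powr p * 2) * Lp_int_on R p (\<lambda>x. b x - c)"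
proof -
  have cube: "R \<in> cubes D" using R by (auto simp: cubes_def)
  have sets: "R \<in> sets lborel" by (rule cubes_measure(1)[OF cube])
  have bc: "loc_int (\<lambda>x. b x + - c)" by (intro loc_int_add b loc_int_const)
  let ?I = "Lp_int_on R p (\<lambda>x. b x - c)"
  have av: "average (\<lambda>x. b x + - c) R = average b R - c"
    using average_add[OF b loc_int_const cube, of "- c"] average_const[OF cube] by simp
  have sm1: "smeas lborel (\<lambda>x. indicator R x *\<^sub>R (b x + - c))"
    by (rule smeas_scaleR_indicator[OF loc_int_smeas[OF bc] sets])
  have sm2: "smeas lborel (\<lambda>x. indicator R x *\<^sub>R (c - average b R))"
    by (rule smeas_scaleR_indicator[OF smeas_simple[OF simple_function_const] sets])
  have "Lp_int_on R p (\<lambda>x. b x - average b R)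
      = Lp_int lborel p (\<lambda>x. indicator R x *\<^sub>R (b x + - c) + indicator R x *\<^sub>R (c - average b R))"
    using p by (intro nn_integral_cong) (auto simp: indicator_def)
  also have "\<dots> \<le> ennreal (2 powr p) * (Lp_int lborel p (\<lambda>x. indicator R x *\<^sub>R (b x + - c))
      + Lp_int lborel p (\<lambda>x. indicator R x *\<^sub>R (c - average b R)))"
    using p by (intro nn_integral_powr_add_le sm1 sm2) simp
  also have "Lp_int lborel p (\<lambda>x. indicator R x *\<^sub>R (b x + - c)) = ?I"
    using p by (subst norm_indicator_powr) auto
  also have "Lp_int lborel p (\<lambda>x. indicator R x *\<^sub>R (c - average b R))
      = ennreal (norm (c - average b R) powr p * measure lborel R)"
    using p sets by (subst norm_indicator_powr) (auto simp: nn_integral_cmult_indicator ennreal_mult cubes_measure(2)[OF cube])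
  also have "\<dots> \<le> ?I"
    using average_Jensen[OF bc cube p] unfolding av by (simp add: norm_minus_commute)
  finally have "Lp_int_on R p (\<lambda>x. b x - average b R) \<le> ennreal (2 powr p) * (?I + ?I)"
    by (simp add: mult_left_mono)
  also have "\<dots> = ennreal (2 powr p * 2) * ?I"
    by (simp add: ennreal_mult mult.assoc mult_2)
  finally show ?thesis .
qed

text \<open>On cubes inside \<open>R\<close> the averages of the indicator times \<open>v\<close>
  are all \<open>v\<close>, so \<open>local_partial_sum_bound\<close> applies on each cube of
  generation \<open>j + M\<close>. There the oscillation of \<open>b\<close> is bounded by its
  distance to a step function that is constant on these cubes, and the total distance is small by
  density.\<close>

lemma small_cubes_small:
  fixes v :: 'e
  assumes R: "R \<in> D j" and e: "0 < e"
  obtains M where "\<And>\<F>. finite \<F> \<Longrightarrow> (\<And>Q. Q \<in> \<F> \<Longrightarrow> Q \<subseteq> R \<and> (\<exists>l\<ge>j + int M. Q \<in> D l)) \<Longrightarrow>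
    Lp_int lborel p (\<lambda>x. partial_sum b (\<lambda>x. indicator R x *\<^sub>R v) \<F> x) \<le> ennreal e"
proof -
  have cube: "R \<in> cubes D" using R by (auto simp: cubes_def)
  have sets: "R \<in> sets lborel" by (rule cubes_measure(1)[OF cube])
  define h where "h x = indicator R x *\<^sub>R b x" for x
  have h: "smeas lborel h"
    unfolding h_def by (rule smeas_scaleR_indicator[OF loc_int_smeas[OF b] sets])
  have hLp: "Lp_int lborel p h < \<infinity>"
  proof -
    let ?a = "average b R"
    have sm1: "smeas lborel (\<lambda>x. indicator R x *\<^sub>R (b x + - ?a))"
      by (intro smeas_scaleR_indicator smeas_add loc_int_smeas[OF b] smeas_simple simple_function_const sets)
    have sm2: "smeas lborel (\<lambda>x. indicator R x *\<^sub>R ?a)"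
      by (rule smeas_scaleR_indicator[OF smeas_simple[OF simple_function_const] sets])
    have "Lp_int lborel p h
        = Lp_int lborel p (\<lambda>x. indicator R x *\<^sub>R (b x + - ?a) + indicator R x *\<^sub>R ?a)"
      unfolding h_def by (intro nn_integral_cong) (auto simp: indicator_def)
    also have "\<dots> \<le> ennreal (2 powr p) * (Lp_int lborel p (\<lambda>x. indicator R x *\<^sub>R (b x + - ?a))
        + Lp_int lborel p (\<lambda>x. indicator R x *\<^sub>R ?a))"
      using p by (intro nn_integral_powr_add_le sm1 sm2) simp
    also have "Lp_int lborel p (\<lambda>x. indicator R x *\<^sub>R (b x + - ?a))
        = Lp_int_on R p (\<lambda>x. b x - ?a)"
      using p by (subst norm_indicator_powr) auto
    also have "Lp_int lborel p (\<lambda>x. indicator R x *\<^sub>R ?a) = ennreal (norm ?a powr p * measure lborel R)"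
      using p sets by (subst norm_indicator_powr) (auto simp: nn_integral_cmult_indicator ennreal_mult cubes_measure(2)[OF cube])
    also have "ennreal (2 powr p) * (Lp_int_on R p (\<lambda>x. b x - ?a) + ennreal (norm ?a powr p * measure lborel R)) < \<infinity>"
      using osc[OF cube] by (auto simp: ennreal_mult_less_top intro: le_less_trans)
    finally show ?thesis .
  qed
  \<comment> \<open>The constant of \<open>local_partial_sum_bound\<close> times that of
    \<open>osc_le_const\<close>.\<close>
  define L where "L = (C\<^sup>2 * C' * norm v) powr p * (2 powr p * 2)"
  have L: "0 \<le> L" by (simp add: L_def)
  then have "0 < e / (L + 1)" using e by simp
  then obtain s where s: "step s" "Lp_int lborel p (\<lambda>x. h x - s x) \<le> ennreal (e / (L + 1))"
    by (rule step_dense[OF h hLp less_imp_le[OF p]])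
  obtain K where K: "\<And>k Q. k \<ge> K \<Longrightarrow> Q \<in> D k \<Longrightarrow> \<exists>v. \<forall>x\<in>Q. s x = v"
    using step_const_on_small[OF s(1)] by blast
  define M where "M = nat (K - j)"
  have M: "K \<le> j + int M" by (simp add: M_def)
  have "Lp_int lborel p (\<lambda>x. partial_sum b (\<lambda>x. indicator R x *\<^sub>R v) \<F> x) \<le> ennreal e"
    if fin: "finite \<F>" and small: "\<And>Q. Q \<in> \<F> \<Longrightarrow> Q \<subseteq> R \<and> (\<exists>l\<ge>j + int M. Q \<in> D l)" for \<F>
  proof -
    let ?f = "\<lambda>x. indicator R x *\<^sub>R v"
    have sub: "\<F> \<subseteq> cubes D"
    proof
      fix Q assume "Q \<in> \<F>"
      with small[of Q] show "Q \<in> cubes D" by (auto simp: cubes_def)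
    qed
    obtain k0 m0 where km: "\<And>Q. Q \<in> \<F> \<Longrightarrow> \<exists>i<m0. Q \<in> D (k0 + int i)"
      using levels_bounded[OF fin sub] by blast
    define m where "m = nat (k0 + int m0 - (j + int M))"
    have levels: "\<exists>i<m. Q \<in> D ((j + int M) + int i)" if Q: "Q \<in> \<F>" for Q
    proof -
      obtain l where l: "j + int M \<le> l" "Q \<in> D l" using small[OF Q] by blast
      obtain i where i: "i < m0" "Q \<in> D (k0 + int i)" using km[OF Q] by blast
      have "l = k0 + int i" using dyadic_level_unique[OF l(2) i(2)] .
      then have "nat (l - (j + int M)) < m" "(j + int M) + int (nat (l - (j + int M))) = l"
        using l(1) i(1) by (auto simp: m_def)
      then show ?thesis using l(2) by (intro exI[of _ "nat (l - (j + int M))"]) simp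
    qed
    \<comment> \<open>The generation is fine enough for \<open>s\<close> to be constant on each of
      these cubes, and coarse enough for every member of \<open>\<F>\<close> to lie in one of
      them.\<close>
    define \<R> where "\<R> = {R' \<in> D (j + int M). R' \<subseteq> R}"
    have \<R>: "\<R> \<subseteq> D (j + int M)" "finite \<R>"
    proof -
      show "\<R> \<subseteq> D (j + int M)" by (simp add: \<R>_def)
      moreover have "Q \<subseteq> R" if "Q \<in> \<R>" for Q using that by (simp add: \<R>_def)
      moreover have "emeasure lborel R < \<infinity>" using cubes_measure(2)[OF cube] by simp
      ultimately show "finite \<R>" using finite_dyadic_in(1)[OF _ _ sets] by blast
    qed
    note [measurable] = partial_sum_measurable[OF sub, of b ?f] smeas_norm[OF smeas_diff[OF h smeas_step[OF s(1)]]]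
    have "Lp_int lborel p (partial_sum b ?f \<F>)
        = Lp_int_on (\<Union>\<R>) p (partial_sum b ?f \<F>)"
    proof (rule nn_integral_cong)
      fix x
      show "ennreal (norm (partial_sum b ?f \<F> x) powr p) = ennreal (norm (partial_sum b ?f \<F> x) powr p) * indicator (\<Union>\<R>) x"
      proof (cases "x \<in> \<Union>\<R>")
        case False
        have "x \<notin> Q" if Q: "Q \<in> \<F>" for Q
        proof
          assume x: "x \<in> Q"
          obtain i where "Q \<in> D ((j + int M) + int i)" using levels[OF Q] by blast
          then obtain R' where R': "R' \<in> D (j + int M)" "Q \<subseteq> R'" using dyadic_ancestor by blast
          have "x \<in> R" "x \<in> R'" using x small[OF Q] R'(2) by auto
          then have "R' \<subseteq> R" using dyadic_nested[OF R R'(1)] by simp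
          then show False using False R' x unfolding \<R>_def by blast
        qed
        then show ?thesis using p by (simp add: partial_sum_outside)
      qed simp
    qed
    also have "\<dots> = (\<Sum>R'\<in>\<R>. Lp_int_on R' p (partial_sum b ?f \<F>))"
      by (rule nn_integral_dyadic_Union[OF \<R>, symmetric]) measurable
    also have "\<dots> \<le> (\<Sum>R'\<in>\<R>. ennreal L * Lp_int_on R' p (\<lambda>x. h x - s x))"
    proof (rule sum_mono)
      fix R' assume R'R: "R' \<in> \<R>"
      then have R': "R' \<in> D (j + int M)" "R' \<subseteq> R" by (auto simp: \<R>_def)
      obtain c where c: "\<And>x. x \<in> R' \<Longrightarrow> s x = c" using K[OF M R'(1)] by blast
      have "Lp_int_on R' p (partial_sum b ?f \<F>)
          \<le> ennreal ((C\<^sup>2 * C' * norm v) powr p) * Lp_int_on R' p (\<lambda>x. b x - average b R')"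
      proof (rule local_partial_sum_bound[OF R'(1) fin levels])
        show "average ?f Q = v" if "Q \<in> \<F>" for Q
          using that sub small[OF that] by (intro average_indicator_subset) auto
      qed
      also have "\<dots> \<le> ennreal ((C\<^sup>2 * C' * norm v) powr p) * (ennreal (2 powr p * 2) * Lp_int_on R' p (\<lambda>x. b x - c))"
        by (intro mult_left_mono osc_le_const[OF R'(1)]) simp
      also have "Lp_int_on R' p (\<lambda>x. b x - c) = Lp_int_on R' p (\<lambda>x. h x - s x)"
        using R'(2) c by (intro nn_integral_cong) (auto simp: indicator_def h_def)
      finally show "Lp_int_on R' p (partial_sum b ?f \<F>)
          \<le> ennreal L * Lp_int_on R' p (\<lambda>x. h x - s x)"
        by (simp add: L_def ennreal_mult mult.assoc)
    qed
    also have "\<dots> = ennreal L * Lp_int_on (\<Union>\<R>) p (\<lambda>x. h x - s x)"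
    proof -
      have "(\<Sum>R'\<in>\<R>. Lp_int_on R' p (\<lambda>x. h x - s x)) = Lp_int_on (\<Union>\<R>) p (\<lambda>x. h x - s x)"
        by (rule nn_integral_dyadic_Union[OF \<R>]) measurable
      then show ?thesis by (simp only: sum_distrib_left[symmetric])
    qed
    also have "\<dots> \<le> ennreal L * Lp_int lborel p (\<lambda>x. h x - s x)"
      by (intro mult_left_mono nn_integral_mono) (auto simp: indicator_def)
    also have "\<dots> \<le> ennreal L * ennreal (e / (L + 1))"
      by (intro mult_left_mono s(2)) simp
    also have "\<dots> = ennreal (L * (e / (L + 1)))"
      using L e by (intro ennreal_mult[symmetric]) auto
    also have "\<dots> \<le> ennreal e"
      using L e by (intro ennreal_leI) (simp add: field_simps)
    finally show ?thesis .
  qed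
  then show ?thesis by (rule that)
qed

text \<open>A cube meeting \<open>R\<close> contains it or is contained in it; all others have
  average 0. Very large and very small cubes are handled by the two preceding estimates, and the
  finitely many in the intermediate generations form \<open>\<G>\<close>.\<close>

lemma tail_small_indicator:
  fixes v :: 'e
  assumes "R \<in> cubes D" shows "tail_small p b (\<lambda>x. indicator R x *\<^sub>R v)"
  unfolding tail_small_def
proof (intro allI impI)
  fix e :: real assume "0 < e"
  let ?e = "e / (2 powr p * 2)" and ?f = "\<lambda>x. indicator R x *\<^sub>R v"
  have e': "0 < ?e" using \<open>0 < e\<close> by simp
  obtain j where R: "R \<in> D j" using assms by (auto simp: cubes_def)
  obtain J where J: "\<And>\<F>. finite \<F> \<Longrightarrow> (\<And>Q. Q \<in> \<F> \<Longrightarrow> R \<subseteq> Q \<and> (\<exists>l\<le>j - int J. Q \<in> D l)) \<Longrightarrow>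
    Lp_int lborel p (partial_sum b ?f \<F>) \<le> ennreal ?e"
    using large_cubes_small[OF R e', of v] by metis
  obtain M where M: "\<And>\<F>. finite \<F> \<Longrightarrow> (\<And>Q. Q \<in> \<F> \<Longrightarrow> Q \<subseteq> R \<and> (\<exists>l\<ge>j + int M. Q \<in> D l)) \<Longrightarrow>
    Lp_int lborel p (partial_sum b ?f \<F>) \<le> ennreal ?e"
    using small_cubes_small[OF R e', of v] by metis
  define \<G> where "\<G> = (\<Union>i\<in>{..J}. {Q \<in> D (j - int i). R \<subseteq> Q}) \<union> (\<Union>i\<in>{..<M}. {Q \<in> D (j + int i). Q \<subseteq> R})"
  obtain y where y: "y \<in> R" using dyadic_nonempty[OF R] by blast
  have "finite {Q \<in> D l. R \<subseteq> Q}" for l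
  proof -
    obtain Q0 where Q0: "Q0 \<in> D l" "y \<in> Q0" by (rule dyadic_cover)
    have "Q = Q0" if "Q \<in> D l" "R \<subseteq> Q" for Q
      by (rule dyadic_eqI[OF that(1) Q0(1) _ Q0(2)]) (use that(2) y in blast)
    then have "{Q \<in> D l. R \<subseteq> Q} \<subseteq> {Q0}" by (intro subsetI) (simp only: mem_Collect_eq singleton_iff)
    then show ?thesis by (rule finite_subset) simp
  qed
  moreover have "finite {Q \<in> D l. Q \<subseteq> R}" for l
    by (rule finite_dyadic_in(1)[of _ l R]) (use cubes_measure[OF assms] in auto)
  ultimately have fin\<G>: "finite \<G>" by (simp add: \<G>_def)
  have sub\<G>: "\<G> \<subseteq> cubes D" by (auto simp: \<G>_def cubes_def)
  have "Lp_int lborel p (partial_sum b ?f \<F>) \<le> ennreal e"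
    if fin: "finite \<F>" and sub: "\<F> \<subseteq> cubes D" and disj: "\<F> \<inter> \<G> = {}" for \<F>
  proof -
    define \<F>1 where "\<F>1 = {Q\<in>\<F>. R \<subseteq> Q \<and> (\<exists>l\<le>j - int J. Q \<in> D l)}"
    \<comment> \<open>Removing \<open>\<F>1\<close> guarantees disjointness: \<open>R\<close> itself
      could satisfy both conditions.\<close>
    define \<F>2 where "\<F>2 = {Q\<in>\<F>. Q \<subseteq> R \<and> (\<exists>l\<ge>j + int M. Q \<in> D l)} - \<F>1"
    have fin12: "finite \<F>1" "finite \<F>2" "\<F>1 \<inter> \<F>2 = {}" "\<F>1 \<subseteq> cubes D" "\<F>2 \<subseteq> cubes D"
      using fin sub by (auto simp: \<F>1_def \<F>2_def)
    have zero: "average ?f Q = 0" if Q: "Q \<in> \<F>" "Q \<notin> \<F>1 \<union> \<F>2" for Q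
    proof -
      obtain l where l: "Q \<in> D l" using Q(1) sub by (auto simp: cubes_def)
      have QG: "Q \<notin> \<G>" using Q(1) disj by blast
      have "\<not> R \<subseteq> Q"
      proof
        assume RQ: "R \<subseteq> Q"
        have "l \<le> j" by (rule level_le_of_subset[OF l R RQ])
        then have "Q \<in> D (j - int (nat (j - l)))" using l by simp
        then have "\<not> nat (j - l) \<le> J" using QG RQ unfolding \<G>_def by blast
        then have "l \<le> j - int J" by linarith
        then show False using Q RQ l unfolding \<F>1_def by blast
      qed
      moreover have "\<not> Q \<subseteq> R"
      proof
        assume QR: "Q \<subseteq> R"
        have "j \<le> l" by (rule level_le_of_subset[OF R l QR])
        then have "Q \<in> D (j + int (nat (l - j)))" using l by simp
        then have "\<not> nat (l - j) < M" using QG QR unfolding \<G>_def by blast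
        then have "j + int M \<le> l" using \<open>j \<le> l\<close> by linarith
        then show False using Q QR l unfolding \<F>2_def by blast
      qed
      ultimately have "Q \<inter> R = {}"
        using dyadic_nested[OF l R] dyadic_nested[OF R l] by (metis disjoint_iff linear)
      then show ?thesis using Q(1) sub by (intro average_indicator_disjoint) auto
    qed
    have "partial_sum b ?f \<F> x = partial_sum b ?f \<F>1 x + partial_sum b ?f \<F>2 x" for x
    proof -
      have "partial_sum b ?f \<F> x = partial_sum b ?f (\<F>1 \<union> \<F>2) x"
        unfolding partial_sum_def using zero fin
        by (intro sum.mono_neutral_right) (auto simp: \<F>1_def \<F>2_def)
      then show ?thesis using partial_sum_Un[OF fin12(1-3)] by simp
    qed
    then have "Lp_int lborel p (partial_sum b ?f \<F>)
        = Lp_int lborel p (\<lambda>x. partial_sum b ?f \<F>1 x + partial_sum b ?f \<F>2 x)" by simp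
    also have "\<dots> \<le> ennreal (2 powr p) * (Lp_int lborel p (partial_sum b ?f \<F>1)
        + Lp_int lborel p (partial_sum b ?f \<F>2))"
      using p by (intro nn_integral_powr_add_le smeas_simple simple_function_partial_sum fin12) simp
    also have "\<dots> \<le> ennreal (2 powr p) * (ennreal ?e + ennreal ?e)"
      using fin12 by (intro mult_left_mono add_mono J M) (auto simp: \<F>1_def \<F>2_def)
    also have "\<dots> = ennreal e"
      using e' by (simp flip: ennreal_plus ennreal_mult)
    finally show ?thesis .
  qed
  then show "\<exists>\<G>. finite \<G> \<and> \<G> \<subseteq> cubes D \<and> (\<forall>\<F>. finite \<F> \<and> \<F> \<subseteq> cubes D \<and> \<F> \<inter> \<G> = {} \<longrightarrow>
       Lp_int lborel p (partial_sum b ?f \<F>) \<le> ennreal e)"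
    using fin\<G> sub\<G> by (intro exI[of _ \<G>]) simp
qed

lemma tail_small_step:
  assumes "step s" shows "loc_int s \<and> tail_small p b s"
  using assms
proof (induction rule: step.induct)
  case step_0
  have "partial_sum b (\<lambda>_. 0) \<F> x = 0" if "\<F> \<subseteq> cubes D" for \<F> x
    using that average_const[of _ "0::'e"] unfolding partial_sum_def by (intro sum.neutral) auto
  then have "tail_small p b (\<lambda>_. 0)"
    unfolding tail_small_def using p by (intro allI impI exI[of _ "{}"]) auto
  then show ?case by (simp add: loc_int_const)
next
  case (step_add s Q c)
  have ind: "loc_int (\<lambda>x. indicator Q x *\<^sub>R c)"
    by (rule loc_int_indicator_const[OF cubes_measure(1)[OF step_add(2)]])
  have "tail_small p b (\<lambda>x. s x + indicator Q x *\<^sub>R c)"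
    using step_add p by (intro tail_small_add ind tail_small_indicator) auto
  then show ?case using loc_int_add[OF _ ind] step_add by blast
qed

lemma tail_small_Lp:
  assumes f: "smeas lborel f" "Lp_int lborel p f < \<infinity>"
  shows "tail_small p b f"
  unfolding tail_small_def
proof (intro allI impI)
  fix e :: real assume "0 < e"
  define K where "K = (6 * 2 ^ CARD('n) * p * (p / (p - 1)) * C\<^sup>2 * C' * B) powr p"
  let ?e = "e / (2 powr p * 2)"
  have e': "0 < ?e" using \<open>0 < e\<close> by simp
  have K: "0 \<le> K" by (simp add: K_def)
  then have "0 < ?e / (K + 1)" by (intro divide_pos_pos[OF e']) simp
  then obtain s where s: "step s" "Lp_int lborel p (\<lambda>x. f x - s x) \<le> ennreal (?e / (K + 1))"
    by (rule step_dense[OF f less_imp_le[OF p]])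
  have ls: "loc_int s" "tail_small p b s" using tail_small_step[OF s(1)] by auto
  have lf: "loc_int f" using p by (intro loc_int_Lp[OF f]) simp
  have lfs: "loc_int (\<lambda>x. f x + (-1) *\<^sub>R s x)" by (intro loc_int_add lf loc_int_scaleR ls)
  obtain \<G> where G: "finite \<G>" "\<G> \<subseteq> cubes D"
    "\<And>\<F>. finite \<F> \<Longrightarrow> \<F> \<subseteq> cubes D \<Longrightarrow> \<F> \<inter> \<G> = {} \<Longrightarrow>
       Lp_int lborel p (partial_sum b s \<F>) \<le> ennreal ?e"
    using ls(2) e' unfolding tail_small_def by meson
  have "Lp_int lborel p (partial_sum b f \<F>) \<le> ennreal e"
    if F: "finite \<F>" "\<F> \<subseteq> cubes D" "\<F> \<inter> \<G> = {}" for \<F>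
  proof -
    have "Lp_int lborel p (partial_sum b f \<F>)
        = Lp_int lborel p (\<lambda>x. partial_sum b (\<lambda>x. f x + (-1) *\<^sub>R s x) \<F> x + partial_sum b s \<F> x)"
      using partial_sum_add[OF lfs ls(1) F(2), of b] by simp
    also have "\<dots> \<le> ennreal (2 powr p) * (Lp_int lborel p (\<lambda>x. partial_sum b (\<lambda>x. f x + (-1) *\<^sub>R s x) \<F> x)
        + Lp_int lborel p (partial_sum b s \<F>))"
      using p by (intro nn_integral_powr_add_le smeas_simple simple_function_partial_sum F(2)) simp
    also have "\<dots> \<le> ennreal (2 powr p) * (ennreal ?e + ennreal ?e)"
    proof (intro mult_left_mono add_mono G(3) F)
      have "Lp_int lborel p (\<lambda>x. partial_sum b (\<lambda>x. f x + (-1) *\<^sub>R s x) \<F> x)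
          \<le> ennreal K * Lp_int lborel p (\<lambda>x. f x + (-1) *\<^sub>R s x)"
        unfolding K_def by (rule partial_sum_bound[OF F(1,2) lfs])
      also have "\<dots> \<le> ennreal K * ennreal (?e / (K + 1))"
        using s(2) by (intro mult_left_mono) auto
      also have "\<dots> = ennreal (K * (?e / (K + 1)))"
        by (rule ennreal_mult[symmetric, OF K less_imp_le[OF \<open>0 < ?e / (K + 1)\<close>]])
      also have "\<dots> \<le> ennreal ?e"
      proof (rule ennreal_leI)
        have "K * (?e / (K + 1)) \<le> (K + 1) * (?e / (K + 1))"
          using \<open>0 < ?e / (K + 1)\<close> by (intro mult_right_mono less_imp_le) simp
        also have "\<dots> = ?e" using K by simp
        finally show "K * (?e / (K + 1)) \<le> ?e" .
      qed
      finally show "Lp_int lborel p (\<lambda>x. partial_sum b (\<lambda>x. f x + (-1) *\<^sub>R s x) \<F> x) \<le> ennreal ?e" .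
    qed simp
    also have "\<dots> = ennreal e"
      using e' by (simp flip: ennreal_plus ennreal_mult)
    finally show ?thesis .
  qed
  then show "\<exists>\<G>. finite \<G> \<and> \<G> \<subseteq> cubes D \<and> (\<forall>\<F>. finite \<F> \<and> \<F> \<subseteq> cubes D \<and> \<F> \<inter> \<G> = {} \<longrightarrow>
       Lp_int lborel p (partial_sum b f \<F>) \<le> ennreal e)"
    using G(1,2) by (intro exI[of _ \<G>]) simp
qed

end

section \<open>Convergence of the paraproduct\<close>

context paraproduct_setting
begin

definition paraproduct_const :: real where
  "paraproduct_const = 6 * 2 ^ CARD('n) * p * (p / (p - 1)) * C\<^sup>2 * C' * B"

lemma paraproduct_const_nonneg: "0 \<le> paraproduct_const"
  using p UE UT B by (simp add: paraproduct_const_def UMD_bound_def)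

lemma partial_sum_diff:
  assumes "finite \<F>" "\<G> \<subseteq> \<F>" shows "partial_sum b f \<F> x - partial_sum b f \<G> x = partial_sum b f (\<F> - \<G>) x"
proof -
  have "partial_sum b f (\<G> \<union> (\<F> - \<G>)) x = partial_sum b f \<G> x + partial_sum b f (\<F> - \<G>) x"
    using assms finite_subset by (intro partial_sum_Un) auto
  moreover have "\<G> \<union> (\<F> - \<G>) = \<F>" using assms(2) by blast
  ultimately show ?thesis by simp
qed

text \<open>A rapidly converging subsequence of partial sums converges almost everywhere.\<close>

lemma paraproduct_exists:
  assumes f: "smeas lborel f" "Lp_int lborel p f < \<infinity>"
  shows "\<exists>g. has_paraproduct D p b f g"
proof -
  \<comment> \<open>Decay by 4^(-p): after weighting the j-th difference with 2^(pj), a convergent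
    geometric series with ratio 2^(-p) is left.\<close>
  define \<epsilon> where "\<epsilon> j = (1 / 4 powr p) ^ j" for j :: nat
  have \<epsilon>: "0 < \<epsilon> j" for j by (simp add: \<epsilon>_def)
  have "\<forall>j. \<exists>\<G>. finite \<G> \<and> \<G> \<subseteq> cubes D \<and> (\<forall>\<F>. finite \<F> \<and> \<F> \<subseteq> cubes D \<and> \<F> \<inter> \<G> = {} \<longrightarrow>
       Lp_int lborel p (partial_sum b f \<F>) \<le> ennreal (\<epsilon> j))"
    using tail_small_Lp[OF f] \<epsilon> unfolding tail_small_def by blast
  from choice[OF this] obtain H where H': "\<forall>j. finite (H j) \<and> H j \<subseteq> cubes D \<and>
      (\<forall>\<F>. finite \<F> \<and> \<F> \<subseteq> cubes D \<and> \<F> \<inter> H j = {} \<longrightarrow>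
       Lp_int lborel p (partial_sum b f \<F>) \<le> ennreal (\<epsilon> j))" ..
  then have H: "finite (H j)" "H j \<subseteq> cubes D"
    "finite \<F> \<Longrightarrow> \<F> \<subseteq> cubes D \<Longrightarrow> \<F> \<inter> H j = {} \<Longrightarrow>
       Lp_int lborel p (partial_sum b f \<F>) \<le> ennreal (\<epsilon> j)" for j \<F>
    by simp_all
  \<comment> \<open>The families are made increasing, so that the partial sums over them
    telescope.\<close>
  define G where "G j = (\<Union>i\<le>j. H i)" for j
  have G: "finite (G j)" "G j \<subseteq> cubes D" "H j \<subseteq> G j" for j
    using H(1,2) by (auto simp: G_def)
  have Gmono: "G i \<subseteq> G j" if "i \<le> j" for i j
  proof -
    have "{..i} \<subseteq> {..j}" using that by simp
    then show ?thesis unfolding G_def by (rule UN_mono) simp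
  qed
  let ?S = "partial_sum b f"
  have tail: "Lp_int lborel p (\<lambda>x. ?S \<F> x - ?S (G j) x) \<le> ennreal (\<epsilon> j)"
    if "finite \<F>" "\<F> \<subseteq> cubes D" "G j \<subseteq> \<F>" for \<F> j
    unfolding partial_sum_diff[OF that(1,3)] using that G(3)[of j] by (intro H(3)) auto
  have simple: "simple_function lborel (?S \<F>)" if "\<F> \<subseteq> cubes D" for \<F>
    by (rule simple_function_partial_sum[OF that])
  have meas: "(\<lambda>x. norm (?S \<F> x - ?S \<F>' x)) \<in> borel_measurable lborel" if "\<F> \<subseteq> cubes D" "\<F>' \<subseteq> cubes D" for \<F> \<F>'
    by (intro smeas_norm smeas_diff smeas_simple simple that)
  define u where "u j x = ?S (G (Suc j)) x - ?S (G j) x" for j x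
  have um[measurable]: "(\<lambda>x. norm (u j x)) \<in> borel_measurable lborel" for j
    unfolding u_def by (rule meas[OF G(2) G(2)])
  have "(\<integral>\<^sup>+x. (\<Sum>j. ennreal ((2 powr p) ^ j * norm (u j x) powr p)) \<partial>lborel)
      = (\<Sum>j. \<integral>\<^sup>+x. ennreal ((2 powr p) ^ j * norm (u j x) powr p) \<partial>lborel)"
    by (rule nn_integral_suminf) measurable
  also have "\<dots> \<le> (\<Sum>j. ennreal ((1 / 2 powr p) ^ j))"
  proof (rule suminf_le)
    fix j
    have "(\<integral>\<^sup>+x. ennreal ((2 powr p) ^ j * norm (u j x) powr p) \<partial>lborel)
        = (\<integral>\<^sup>+x. ennreal ((2 powr p) ^ j) * ennreal (norm (u j x) powr p) \<partial>lborel)"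
      by (simp add: ennreal_mult)
    also have "\<dots> = ennreal ((2 powr p) ^ j) * Lp_int lborel p (u j)"
      by (rule nn_integral_cmult) measurable
    also have "\<dots> \<le> ennreal ((2 powr p) ^ j) * ennreal (\<epsilon> j)"
      unfolding u_def using G Gmono[of j "Suc j"] by (intro mult_left_mono tail) auto
    also have "\<dots> = ennreal ((1 / 2 powr p) ^ j)"
    proof -
      have "(4::real) powr p = 2 powr p * 2 powr p" by (simp flip: powr_mult)
      then have "(2 powr p) ^ j * \<epsilon> j = (1 / 2 powr p) ^ j"
        by (simp add: \<epsilon>_def flip: power_mult_distrib)
      then show ?thesis by (metis ennreal_mult' powr_ge_zero zero_le_power)
    qed
    finally show "(\<integral>\<^sup>+x. ennreal ((2 powr p) ^ j * norm (u j x) powr p) \<partial>lborel) \<le> ennreal ((1 / 2 powr p) ^ j)" .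
  qed auto
  also have "\<dots> < \<infinity>"
  proof -
    have "1 < (2::real) powr p" using p by simp
    then have "summable (\<lambda>j. (1 / 2 powr p) ^ j)" by (intro summable_geometric) simp
    then have "(\<Sum>j. ennreal ((1 / 2 powr p) ^ j)) \<noteq> top" by (intro ennreal_suminf_neq_top) auto
    then show ?thesis by (simp add: less_top)
  qed
  finally have "(\<integral>\<^sup>+x. (\<Sum>j. ennreal ((2 powr p) ^ j * norm (u j x) powr p)) \<partial>lborel) \<noteq> \<infinity>" by simp
  then have "AE x in lborel. (\<Sum>j. ennreal ((2 powr p) ^ j * norm (u j x) powr p)) \<noteq> \<infinity>"
    by (intro nn_integral_PInf_AE) measurable
  then have conv: "AE x in lborel. convergent (\<lambda>j. ?S (G j) x)"
  proof eventually_elim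
    fix x assume "(\<Sum>j. ennreal ((2 powr p) ^ j * norm (u j x) powr p)) \<noteq> \<infinity>"
    then obtain c where c: "0 \<le> c" "(\<Sum>j. ennreal ((2 powr p) ^ j * norm (u j x) powr p)) = ennreal c"
      by (auto simp: less_top[symmetric] elim: ennreal_cases)
    \<comment> \<open>A single term of the finite weighted series already forces geometric decay of
      the differences, hence absolute convergence of the telescoping series at
      \<open>x\<close>.\<close>
    have "norm (u j x) \<le> c powr (1 / p) * (1 / 2) ^ j" for j
    proof -
      have "(\<Sum>i\<in>{j}. ennreal ((2 powr p) ^ i * norm (u i x) powr p)) \<le> (\<Sum>j. ennreal ((2 powr p) ^ j * norm (u j x) powr p))"
        by (rule sum_le_suminf) auto
      then have "ennreal ((2 powr p) ^ j * norm (u j x) powr p) \<le> ennreal c"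
        unfolding c(2) by simp
      then have "(2 powr p) ^ j * norm (u j x) powr p \<le> c" using c(1) by (simp only: ennreal_le_iff)
      moreover have "(2 powr p) ^ j * norm (u j x) powr p = (2 ^ j * norm (u j x)) powr p"
        by (simp add: powr_mult powr_power powr_realpow[symmetric] powr_powr mult.commute)
      ultimately have "((2 ^ j * norm (u j x)) powr p) powr (1 / p) \<le> c powr (1 / p)"
        using p by (intro powr_mono2) auto
      then have "2 ^ j * norm (u j x) \<le> c powr (1 / p)"
        using p by (simp add: powr_powr)
      then show ?thesis by (simp add: power_one_over field_simps)
    qed
    moreover have "summable (\<lambda>j. c powr (1 / p) * (1 / 2 :: real) ^ j)"
      by (rule summable_mult[OF summable_geometric]) simp
    ultimately have "summable (\<lambda>j. u j x)"
      using summable_comparison_test'[of _ 0 "\<lambda>j. u j x"] by blast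
    then have "convergent (\<lambda>n. \<Sum>j<n. u j x)"
      by (simp only: summable_iff_convergent)
    then have "convergent (\<lambda>n. ?S (G 0) x + (\<Sum>j<n. u j x))"
      by (rule convergent_add[OF convergent_const])
    moreover have "?S (G 0) x + (\<Sum>j<n. u j x) = ?S (G n) x" for n
      unfolding u_def using sum_lessThan_telescope[of "\<lambda>n. ?S (G n) x" n] by simp
    ultimately show "convergent (\<lambda>j. ?S (G j) x)" by simp
  qed
  define g where "g x = lim (\<lambda>j. ?S (G j) x)" for x
  have lim: "AE x in lborel. (\<lambda>j. ?S (G j) x) \<longlonglongrightarrow> g x"
    using conv by eventually_elim (simp add: g_def convergent_LIMSEQ_iff)
  have sm: "strongly_measurable lborel g"
    unfolding strongly_measurable_def by (intro exI[of _ "\<lambda>j. ?S (G j)"] conjI allI simple[OF G(2)] lim)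
  \<comment> \<open>Bounds on the distance to the partial sums over \<open>G j\<close>, for all
    large \<open>j\<close>, pass to the almost everywhere limit \<open>g\<close>.\<close>
  have Fatou: "Lp_int lborel p (\<lambda>x. ?S \<F> x - g x) \<le> c"
    if F: "\<F> \<subseteq> cubes D" and c: "\<And>j. i \<le> j \<Longrightarrow> Lp_int lborel p (\<lambda>x. ?S \<F> x - ?S (G j) x) \<le> c" for \<F> c i
  proof -
    have "Lp_int lborel p (\<lambda>x. ?S \<F> x - g x)
        = (\<integral>\<^sup>+x. liminf (\<lambda>j. ennreal (norm (?S \<F> x - ?S (G j) x) powr p)) \<partial>lborel)"
    proof (rule nn_integral_cong_AE)
      show "AE x in lborel. ennreal (norm (?S \<F> x - g x) powr p) = liminf (\<lambda>j. ennreal (norm (?S \<F> x - ?S (G j) x) powr p))"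
        using lim
      proof eventually_elim
        fix x assume "(\<lambda>j. ?S (G j) x) \<longlonglongrightarrow> g x"
        then have "(\<lambda>j. norm (?S \<F> x - ?S (G j) x)) \<longlonglongrightarrow> norm (?S \<F> x - g x)"
          by (intro tendsto_intros)
        then have "(\<lambda>j. norm (?S \<F> x - ?S (G j) x) powr p) \<longlonglongrightarrow> norm (?S \<F> x - g x) powr p"
          using p by (intro tendsto_powr2) auto
        then have "(\<lambda>j. ennreal (norm (?S \<F> x - ?S (G j) x) powr p)) \<longlonglongrightarrow> ennreal (norm (?S \<F> x - g x) powr p)"
          by (rule tendsto_ennrealI)
        then show "ennreal (norm (?S \<F> x - g x) powr p) = liminf (\<lambda>j. ennreal (norm (?S \<F> x - ?S (G j) x) powr p))"
          using lim_imp_Liminf[OF sequentially_bot] by metis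
      qed
    qed
    also have "\<dots> \<le> liminf (\<lambda>j. Lp_int lborel p (\<lambda>x. ?S \<F> x - ?S (G j) x))"
    proof (rule nn_integral_liminf)
      fix j
      note [measurable] = meas[OF F G(2)[of j]]
      show "(\<lambda>x. ennreal (norm (?S \<F> x - ?S (G j) x) powr p)) \<in> borel_measurable lborel" by measurable
    qed
    also have "\<dots> \<le> limsup (\<lambda>j. Lp_int lborel p (\<lambda>x. ?S \<F> x - ?S (G j) x))"
      by (rule Liminf_le_Limsup) simp
    also have "\<dots> \<le> c"
      by (rule Limsup_bounded) (use c in \<open>auto simp: eventually_sequentially\<close>)
    finally show ?thesis .
  qed
  have "in_Lp lborel p g"
    unfolding in_Lp_def
  proof (intro conjI sm)
    have lf: "loc_int f" using p by (intro loc_int_Lp[OF f]) simp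
    \<comment> \<open>The empty family has partial sum 0, so this is the norm of \<open>g\<close>,
      and the uniform bound for the \<open>G j\<close> applies.\<close>
    have "Lp_int lborel p (\<lambda>x. ?S {} x - g x)
        \<le> ennreal (paraproduct_const powr p) * Lp_int lborel p f"
    proof (rule Fatou)
      fix j
      have "norm (?S {} x - ?S (G j) x) = norm (?S (G j) x)" for x by (simp add: partial_sum_def)
      then show "Lp_int lborel p (\<lambda>x. ?S {} x - ?S (G j) x)
          \<le> ennreal (paraproduct_const powr p) * Lp_int lborel p f"
        using partial_sum_bound[OF G(1,2) lf, of j] by (simp add: paraproduct_const_def)
    qed simp
    also have "\<dots> < \<infinity>" using f(2) by (simp add: ennreal_mult_less_top)
    finally show "Lp_int lborel p g < \<infinity>" by (simp add: partial_sum_def)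
  qed
  moreover have "((\<lambda>\<F>. Lp_int lborel p (\<lambda>x. ?S \<F> x - g x)) \<longlongrightarrow> 0) (finite_subsets_at_top (cubes D))"
  proof (rule order_tendstoI)
    fix a :: ennreal assume "0 < a"
    have "(1 / 4 powr p) < (1::real)" using p by simp
    then have "\<epsilon> \<longlonglongrightarrow> 0" unfolding \<epsilon>_def by (intro LIMSEQ_realpow_zero) auto
    then have "(\<lambda>i. 2 powr p * (\<epsilon> i + \<epsilon> i)) \<longlonglongrightarrow> 2 powr p * (0 + 0)" by (intro tendsto_intros)
    then have "(\<lambda>i. ennreal (2 powr p * (\<epsilon> i + \<epsilon> i))) \<longlonglongrightarrow> ennreal (2 powr p * (0 + 0))" by (rule tendsto_ennrealI)
    then have "eventually (\<lambda>i. ennreal (2 powr p * (\<epsilon> i + \<epsilon> i)) < a) sequentially"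
      using \<open>0 < a\<close> by (intro order_tendstoD(2)) auto
    then obtain i where i: "ennreal (2 powr p * (\<epsilon> i + \<epsilon> i)) < a"
      using eventually_happens'[OF sequentially_bot] by blast
    \<comment> \<open>A finite family containing \<open>G i\<close> differs from it only by cubes
      outside \<open>H i\<close>. Hence it and every later \<open>G j\<close> are close to
      \<open>G i\<close>, and therefore to each other.\<close>
    have "Lp_int lborel p (\<lambda>x. ?S \<F> x - g x) < a"
      if F: "finite \<F>" "G i \<subseteq> \<F>" "\<F> \<subseteq> cubes D" for \<F>
    proof -
      have "Lp_int lborel p (\<lambda>x. ?S \<F> x - g x) \<le> ennreal (2 powr p * (\<epsilon> i + \<epsilon> i))"
      proof (rule Fatou[OF F(3)])
        fix j assume j: "i \<le> j"
        have "Lp_int lborel p (\<lambda>x. ?S \<F> x - ?S (G j) x)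
            = Lp_int lborel p (\<lambda>x. (?S \<F> x - ?S (G i) x) + (?S (G i) x - ?S (G j) x))" by simp
        also have "\<dots> \<le> ennreal (2 powr p) * (Lp_int lborel p (\<lambda>x. ?S \<F> x - ?S (G i) x)
            + Lp_int lborel p (\<lambda>x. ?S (G i) x - ?S (G j) x))"
          using p by (intro nn_integral_powr_add_le smeas_diff smeas_simple simple F G(2)) simp
        also have "\<dots> \<le> ennreal (2 powr p) * (ennreal (\<epsilon> i) + ennreal (\<epsilon> i))"
        proof (intro mult_left_mono add_mono tail F)
          show "Lp_int lborel p (\<lambda>x. ?S (G i) x - ?S (G j) x) \<le> ennreal (\<epsilon> i)"
            using tail[OF G(1,2) Gmono[OF j]] by (simp add: norm_minus_commute)
        qed simp
        also have "\<dots> = ennreal (2 powr p * (\<epsilon> i + \<epsilon> i))"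
          using \<epsilon>[of i] by (simp add: less_imp_le flip: ennreal_plus ennreal_mult)
        finally show "Lp_int lborel p (\<lambda>x. ?S \<F> x - ?S (G j) x) \<le> ennreal (2 powr p * (\<epsilon> i + \<epsilon> i))" .
      qed
      then show ?thesis using i by (rule le_less_trans)
    qed
    then show "eventually (\<lambda>\<F>. (Lp_int lborel p (\<lambda>x. ?S \<F> x - g x)) < a) (finite_subsets_at_top (cubes D))"
      unfolding eventually_finite_subsets_at_top using G(1,2) by (intro exI[of _ "G i"]) simp
  qed simp
  ultimately have "has_paraproduct D p b f g"
    unfolding has_paraproduct_def partial_sum_def by (rule conjI)
  then show ?thesis by (intro exI[of _ g])
qed

text \<open>This concerns every representative of the sum, not only the one constructed above.
  Splitting \<open>g\<close> into a partial sum and a vanishing error by the weighted inequality,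
  then letting \<open>c\<close> tend to 1, transfers the uniform bound without enlarging the
  constant.\<close>

lemma paraproduct_norm_le:
  assumes f: "smeas lborel f" "Lp_int lborel p f < \<infinity>"
    and g: "has_paraproduct D p b f g"
  shows "Lp_int lborel p g
    \<le> ennreal (paraproduct_const powr p) * Lp_int lborel p f"
proof -
  let ?S = "partial_sum b f" and ?\<Phi> = "finite_subsets_at_top (cubes D)"
  let ?R = "ennreal (paraproduct_const powr p) * Lp_int lborel p f"
  have lf: "loc_int f" using p by (intro loc_int_Lp[OF f]) simp
  have sm: "strongly_measurable lborel g" using g by (simp add: has_paraproduct_def in_Lp_def)
  obtain g' where g': "smeas lborel g'" "AE x in lborel. g x = g' x"
    by (rule strongly_measurable_obtain_smeas[OF sm])
  have eq: "Lp_int lborel p (\<lambda>x. h x - g x) = Lp_int lborel p (\<lambda>x. h x - g' x)" for h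
    using g'(2) by (intro nn_integral_cong_AE) auto
  have lim: "((\<lambda>\<F>. Lp_int lborel p (\<lambda>x. ?S \<F> x - g' x)) \<longlongrightarrow> 0) ?\<Phi>"
    using g unfolding has_paraproduct_def partial_sum_def eq by blast
  let ?I = "Lp_int lborel p g'"
  have bound: "?I \<le> ennreal (c powr (1 - p)) * ?R" if c: "0 < c" "c < 1" for c
  proof (rule tendsto_le[of ?\<Phi>])
    let ?h = "\<lambda>\<F>. ennreal (c powr (1 - p)) * ?R + ennreal ((1 - c) powr (1 - p)) * Lp_int lborel p (\<lambda>x. ?S \<F> x - g' x)"
    show "?\<Phi> \<noteq> bot" by simp
    have "(?h \<longlongrightarrow> ennreal (c powr (1 - p)) * ?R + ennreal ((1 - c) powr (1 - p)) * 0) ?\<Phi>"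
      by (intro tendsto_add tendsto_const ennreal_tendsto_cmult lim) simp
    then show "(?h \<longlongrightarrow> ennreal (c powr (1 - p)) * ?R) ?\<Phi>" by simp
    show "((\<lambda>_. ?I) \<longlongrightarrow> ?I) ?\<Phi>" by simp
    have "?I \<le> ?h \<F>" if F: "finite \<F>" "\<F> \<subseteq> cubes D" for \<F>
    proof -
      have "?I = Lp_int lborel p (\<lambda>x. ?S \<F> x + (g' x - ?S \<F> x))" by simp
      also have "\<dots> \<le> ennreal (c powr (1 - p)) * Lp_int lborel p (?S \<F>)
          + ennreal ((1 - c) powr (1 - p)) * Lp_int lborel p (\<lambda>x. g' x - ?S \<F> x)"
        using p by (intro nn_integral_powr_add_weighted c smeas_diff smeas_simple simple_function_partial_sum[OF F(2)] g'(1)) simp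
      also have "\<dots> \<le> ?h \<F>"
        using partial_sum_bound[OF F lf]
        by (intro add_mono mult_left_mono) (auto simp: paraproduct_const_def norm_minus_commute)
      finally show ?thesis .
    qed
    then show "eventually (\<lambda>\<F>. ?I \<le> ?h \<F>) ?\<Phi>"
      unfolding eventually_finite_subsets_at_top by (intro exI[of _ "{}"]) simp
  qed
  have "((\<lambda>c. c powr (1 - p)) \<longlongrightarrow> 1 powr (1 - p)) (at_left (1::real))"
    by (intro tendsto_powr tendsto_const) auto
  then have "((\<lambda>c. c powr (1 - p)) \<longlongrightarrow> 1) (at_left (1::real))" by simp
  moreover obtain r where r: "0 \<le> r" "?R = ennreal r"
    using f(2) by (cases ?R) (auto simp: ennreal_mult_eq_top_iff)
  ultimately have "((\<lambda>c. ennreal (c powr (1 - p) * r)) \<longlongrightarrow> ennreal (1 * r)) (at_left (1::real))"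
    by (intro tendsto_ennrealI tendsto_mult tendsto_const)
  moreover have "eventually (\<lambda>c. ?I \<le> ennreal (c powr (1 - p) * r)) (at_left (1::real))"
    using eventually_at_left_real[of 0 1]
  proof (rule eventually_mono)
    fix c :: real assume "c \<in> {0<..<1}"
    then show "?I \<le> ennreal (c powr (1 - p) * r)"
      using bound[of c] r by (simp add: ennreal_mult)
  qed simp
  ultimately have "?I \<le> ennreal (1 * r)"
    by (intro tendsto_lowerbound[where F="at_left (1::real)"]) auto
  moreover have "Lp_int lborel p g = ?I"
    using eq[of "\<lambda>_. 0"] by simp
  ultimately show ?thesis using r by simp
qed

end

lemma average_cong_AE: "AE x in lborel. f x = g x \<Longrightarrow> average f Q = average g Q"
  unfolding average_def by (subst bint_cong_AE[of _ "\<lambda>x. indicator Q x *\<^sub>R g x"]) (auto elim: eventually_mono)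

theorem theorem1p6:
  fixes p :: real
    and D :: "int \<Rightarrow> (real^'n) set set"
    and T :: "('e::banach \<Rightarrow>\<^sub>L 'e) set"
    and b :: "real^'n \<Rightarrow> 'e \<Rightarrow>\<^sub>L 'e"
    and f :: "real^'n \<Rightarrow> 'e"
  assumes "1 < p"
    and "dyadic_system D"
    and "UMD p (UNIV :: 'e set)"
    and "UMD p T"
    and "in_BMO D p T b"
    and "in_Lp lborel p f"
  shows "(\<exists>g. has_paraproduct D p b f g) \<and>
    (\<forall>g. has_paraproduct D p b f g \<longrightarrow>
      Lp_norm lborel p g \<le>
        6 * 2 ^ CARD('n) * p * (p / (p - 1)) * (UMD_const p (UNIV :: 'e set))\<^sup>2 * UMD_const p T *
        BMO_norm D p b * Lp_norm lborel p f)"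
proof -
  interpret dyadic_grid D by unfold_locales fact
  have p: "1 < p" by fact
  \<comment> \<open>Both functions enter the partial sums only through their averages, so they may
    be replaced by representatives that are limits of simple functions everywhere.\<close>
  obtain b' where b': "smeas lborel b'" "AE x in lborel. b x = b' x"
    using assms(5) strongly_measurable_obtain_smeas unfolding in_BMO_def by metis
  obtain f' where f': "smeas lborel f'" "AE x in lborel. f x = f' x"
    using assms(6) strongly_measurable_obtain_smeas unfolding in_Lp_def by metis
  have avb: "average b Q = average b' Q" for Q by (rule average_cong_AE[OF b'(2)])
  have avf: "average f Q = average f' Q" for Q by (rule average_cong_AE[OF f'(2)])
  have haar: "haar_proj D Q b = haar_proj D Q b'" for Q
    by (simp add: haar_proj_def[abs_def] avb)
  have para: "has_paraproduct D p b f g \<longleftrightarrow> has_paraproduct D p b' f' g" for g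
    unfolding has_paraproduct_def haar avf ..
  have fint: "Lp_int lborel p f = Lp_int lborel p f'"
    using f'(2) by (intro nn_integral_cong_AE) auto
  have f'fin: "Lp_int lborel p f' < \<infinity>"
    using assms(6) unfolding in_Lp_def fint by simp
  define B where "B = BMO_norm D p b"
  have bdd: "bdd_above (mean_osc p b ` cubes D)" using assms(5) by (simp add: in_BMO_def)
  have osc_le: "mean_osc p b Q \<le> B" if "Q \<in> cubes D" for Q
    unfolding B_def BMO_norm_def using bdd that by (intro cSUP_upper)
  have B: "0 \<le> B"
  proof -
    obtain Q where "Q \<in> D 0" by (rule dyadic_cover[of 0 0])
    then have "Q \<in> cubes D" by (auto simp: cubes_def)
    then have "mean_osc p b Q \<le> B" by (rule osc_le)
    moreover have "0 \<le> mean_osc p b Q" by (simp add: mean_osc_def)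
    ultimately show ?thesis by simp
  qed
  have osc: "Lp_int_on Q p (\<lambda>x. b' x - average b' Q) \<le> ennreal (B powr p * measure lborel Q)"
    if Q: "Q \<in> cubes D" for Q
  proof -
    let ?I = "Lp_int_on Q p (\<lambda>x. b x - average b Q)"
    have fin: "?I < \<infinity>" using assms(5) Q by (auto simp: in_BMO_def)
    have m: "0 < measure lborel Q" by (rule cubes_measure(3)[OF Q])
    have "((1 / measure lborel Q * enn2real ?I) powr (1 / p)) powr p \<le> B powr p"
      using osc_le[OF Q] p unfolding mean_osc_def by (intro powr_mono2) auto
    then have "1 / measure lborel Q * enn2real ?I \<le> B powr p"
      using p by (simp add: powr_powr)
    then have "enn2real ?I \<le> B powr p * measure lborel Q" using m by (simp add: divide_le_eq)
    then have "ennreal (enn2real ?I) \<le> ennreal (B powr p * measure lborel Q)" by (rule ennreal_leI)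
    moreover have "ennreal (enn2real ?I) = ?I" using fin by (simp add: less_top)
    moreover have "?I = Lp_int_on Q p (\<lambda>x. b' x - average b' Q)"
      using b'(2) unfolding avb by (intro nn_integral_cong_AE) auto
    ultimately show ?thesis by (simp only:)
  qed
  \<comment> \<open>Integrability of the norm on a cube follows from the finite oscillation, since t
    is at most 1 + t^p for the distance t to the average.\<close>
  have lb: "loc_int b'"
    unfolding loc_int_def
  proof (intro conjI ballI b'(1))
    fix Q assume Q: "Q \<in> cubes D"
    let ?a = "average b' Q"
    note [measurable] = smeas_norm[OF smeas_add[OF b'(1) smeas_simple[OF simple_function_const[of lborel "- ?a"]]], simplified]
      cubes_measure(1)[OF Q]
    have "(\<integral>\<^sup>+x\<in>Q. ennreal (norm (b' x)) \<partial>lborel)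
        \<le> (\<integral>\<^sup>+x. ennreal (norm ?a + 1) * indicator Q x + ennreal (norm (b' x - ?a) powr p) * indicator Q x \<partial>lborel)"
    proof (rule nn_integral_mono)
      fix x
      have "norm (b' x) \<le> norm ?a + norm (b' x - ?a)" using norm_triangle_sub by blast
      also have "\<dots> \<le> norm ?a + 1 + norm (b' x - ?a) powr p" using le_one_plus_powr[of "norm (b' x - ?a)" p] p by simp
      finally have "ennreal (norm (b' x)) \<le> ennreal (norm ?a + 1 + norm (b' x - ?a) powr p)"
        by (rule ennreal_leI)
      also have "\<dots> = ennreal (norm ?a + 1) + ennreal (norm (b' x - ?a) powr p)"
        by (rule ennreal_plus) auto
      finally have "ennreal (norm (b' x)) \<le> ennreal (norm ?a + 1) + ennreal (norm (b' x - ?a) powr p)" .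
      then show "ennreal (norm (b' x)) * indicator Q x
          \<le> ennreal (norm ?a + 1) * indicator Q x + ennreal (norm (b' x - ?a) powr p) * indicator Q x"
        by (auto simp: indicator_def)
    qed
    also have "\<dots> = (\<integral>\<^sup>+x\<in>Q. ennreal (norm ?a + 1) \<partial>lborel) + Lp_int_on Q p (\<lambda>x. b' x - ?a)"
      by (rule nn_integral_add) measurable
    also have "(\<integral>\<^sup>+x\<in>Q. ennreal (norm ?a + 1) \<partial>lborel) = ennreal (norm ?a + 1) * emeasure lborel Q"
      by (rule nn_integral_cmult_indicator[OF cubes_measure(1)[OF Q]])
    also have "ennreal (norm ?a + 1) * emeasure lborel Q + Lp_int_on Q p (\<lambda>x. b' x - ?a) < \<infinity>"
      using osc[OF Q] cubes_measure(2)[OF Q] by (auto simp: ennreal_mult_less_top intro: le_less_trans)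
    finally show "(\<integral>\<^sup>+x\<in>Q. ennreal (norm (b' x)) \<partial>lborel) < \<infinity>" .
  qed
  have T: "subspace T" "closed T"
    using assms(4) complete_imp_closed by (auto simp: UMD_def)
  \<comment> \<open>Completeness makes \<open>T\<close> closed, so Bochner integrals of
    \<open>T\<close>-valued functions stay in \<open>T\<close>; the tree estimates require this of
    all averages.\<close>
  have bT: "average b' Q \<in> T" if Q: "Q \<in> cubes D" for Q
  proof -
    have "AE x in lborel. b' x \<in> T"
      using assms(5) b'(2) unfolding in_BMO_def by (auto elim: eventually_elim2)
    then have "AE x in lborel. indicator Q x *\<^sub>R b' x \<in> T"
      by eventually_elim (intro subspace_scale[OF T(1)])
    then have "measure lborel Q *\<^sub>R average b' Q \<in> T"
      by (intro has_bint_in_subspace[OF has_bint_average[OF lb Q] _ T])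
    then have "(1 / measure lborel Q) *\<^sub>R measure lborel Q *\<^sub>R average b' Q \<in> T"
      by (rule subspace_scale[OF T(1)])
    then show ?thesis using cubes_measure(3)[OF Q] by simp
  qed
  interpret paraproduct_setting D p "UMD_const p (UNIV :: 'e set)" "UMD_const p T" B T b'
    by unfold_locales (use p UMD_bound_UMD_const assms(3,4) T(1) lb bT B osc in auto)
  have ex: "\<exists>g. has_paraproduct D p b f g"
    unfolding para by (rule paraproduct_exists[OF f'(1) f'fin])
  have "Lp_norm lborel p g \<le> paraproduct_const * Lp_norm lborel p f" if g: "has_paraproduct D p b f g" for g
  proof -
    let ?F = "Lp_int lborel p f"
    have "Lp_int lborel p g \<le> ennreal (paraproduct_const powr p) * ?F"
      using paraproduct_norm_le[OF f'(1) f'fin] g unfolding para fint by blast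
    then have "enn2real (Lp_int lborel p g) \<le> enn2real (ennreal (paraproduct_const powr p) * ?F)"
      using f'fin unfolding fint by (intro enn2real_mono) (auto simp: ennreal_mult_less_top)
    also have "\<dots> = paraproduct_const powr p * enn2real ?F" by (simp add: enn2real_mult)
    finally have "Lp_norm lborel p g \<le> (paraproduct_const powr p * enn2real ?F) powr (1 / p)"
      unfolding Lp_norm_def using p by (intro powr_mono2) auto
    also have "\<dots> = paraproduct_const * Lp_norm lborel p f"
      using p paraproduct_const_nonneg by (simp add: Lp_norm_def powr_mult powr_powr)
    finally show ?thesis .
  qed
  from ex this[unfolded paraproduct_const_def, unfolded B_def] show ?thesis
    by (intro conjI allI impI)
qed

end
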